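(* Let $X$ and $Y$ be $C^1$ Finsler manifolds, where $X$ is complete and $Y$ has smooth norm, and let $f:X\to Y$ be a locally Lipschitz map. Suppose that $Jf$ is a strong pseudo-Jacobian mapping for $f$ and that $f$ is $Jf$-regular at every point $x\in X$. If $f$ is a strong submersion, then $f$ is a covering map, the set-valued inverse map $f^{-1}$ has the pseudo-Lipschitz property around $(y,x)$ for every $y\in Y$ and $x\in f^{-1}(y)$, and $$\operatorname{lip} f^{-1}(y|x)\le C(Jf(x))^{-1}.$$
   Context: **Manifolds and charts.** Manifolds are $C^1$ manifolds modeled on (possibly infinite-dimensional) real Banach spaces. A chart $(W,\varphi)$ at $x\in X$ is an open set $W\ni x$ with a chart map $\varphi$ from $W$ onto an open subset of the model space $E$; $d\varphi^{-1}(\varphi(x)):E\to T_xX$ is the induced linear isomorphism. $\mathcal L(E,F)$ denotes the bounded linear operators. **Finsler manifolds.** A Finsler structure on $X$ (modeled on $(E,|\cdot|_E)$) is a continuous map $\|\cdot\|:TX\to[0,\infty)$ such that: (1) for each $x$, its restriction $\|\cdot\|_x$ to $T_xX$ is a norm such that for every chart $(W,\varphi)$ at $x$, $\|d\varphi^{-1}(\varphi(x))(\cdot)\|_x$ is a norm on $E$ equivalent to $|\cdot|_E$; (2) for each $x_0\in X$, chart $(W,\varphi)$ at $x_0$ and $\varepsilon>0$ there is an open neighborhood $U\subset W$ of $x_0$ with $\frac1{1+\varepsilon}\|d\varphi^{-1}(\varphi(x_0))\mathbf v\|_{x_0}\le\|d\varphi^{-1}(\varphi(x))\mathbf v\|_x\le(1+\varepsilon)\|d\varphi^{-1}(\varphi(x_0))\mathbf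 v\|_{x_0}$ for all $x\in U$, $\mathbf v\in E$. A Finsler manifold is a $C^1$ Banach manifold with a Finsler structure; all Finsler manifolds are assumed connected. $d_X(u,u')$ is the infimum of the lengths $\int_a^b\|\dot\sigma(t)\|_{\sigma(t)}dt$ of $C^1$ paths $\sigma$ joining $u$ to $u'$; $B_X(x;r)$ is the open $d_X$-ball; $X$ is complete if $(X,d_X)$ is. $X$ has smooth norm if each $\|\cdot\|_x$ is Fréchet differentiable away from $0$. Locally Lipschitz means with respect to $d_X,d_Y$ (equivalently, in charts). **Pseudo-Jacobians.** For Banach spaces $E,F$, $U\subset E$ open and $\mathbf f:U\to F$ continuous, a nonempty set $J\mathbf f(\mathbf x)\subset\mathcal L(E,F)$ is a pseudo-Jacobian of $\mathbf f$ at $\mathbf x\in U$ if for all $y^*\in F^*$, $v\in E$: $\limsup_{t\to0^+}\frac{y^*(\mathbf f(\mathbf x+tv))-y^*(\mathbf f(\mathbf x))}{t}\le\sup\{\langle y^*,T(v)\rangle:T\in J\mathbf f(\mathbf x)\}$. A set-valued map $J\mathbf f:U\to2^{\mathcal L(E,F)}$ is a pseudo-Jacobian mapping if this holds at every point; it is locally bounded if each point has a ball $B\subset U$ around it with $\bigcup_{\mathbf z\in B}J\mathbf f(\mathbf z)$ norm bounded. Let $f:X\to Y$ be locally Lipschitz between $C^1$ manifolds modeled on $E,F$. An assignment $x\mapsto Jf(x)$, with $Jf(x)$ a set of linear operators $T_xX\to T_{f(x)}Y$, is a pseudo-Jacobian mapping for $f$ if for each $x\in X$ there are charts $(W,\varphi)$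 at $x$ and $(V,\psi)$ at $f(x)$ with $f(W)\subset V$ and a locally bounded pseudo-Jacobian mapping $J\mathbf f:\varphi(W)\to2^{\mathcal L(E,F)}$ of $\mathbf f=\psi\circ f\circ\varphi^{-1}$ such that $Jf(u)=d\psi^{-1}(\psi(f(u)))\,J\mathbf f(\varphi(u))\,[d\varphi^{-1}(\varphi(u))]^{-1}$ for all $u\in W$. It is strong if in addition the charts can be chosen so that each $J\mathbf f(\mathbf u)$, $\mathbf u\in\varphi(W)$, is convex and compact in the weak operator topology. **Finsler regularity index.** For $T\in\mathcal L(T_xX,T_{f(x)}Y)$ let $C_{\rm Finsler}(T)=\inf_{|y^*|_{f(x)}=1}|T^*y^*|_x$, with $|\cdot|_x,|\cdot|_{f(x)}$ the dual norms of $\|\cdot\|_x,\|\cdot\|_{f(x)}$. Set $C(Jf(x)):=\sup_{R>0}\inf\{C_{\rm Finsler}(T):T\in\mathrm{co}\,Jf(B_X(x;R))\}$, where co is the convex hull and $Jf(B_X(x;R))=\bigcup_{u\in B_X(x;R)}Jf(u)$ is regarded (for small $R$) as a subset of $\mathcal L(T_xX,T_{f(x)}Y)$ by means of a pair of charts $(W,\varphi)$ at $x$ and $(V,\psi)$ at $f(x)$ with $f(W)\subset V$ for which there is a locally bounded pseudo-Jacobian mapping $J\mathbf f:\varphi(W)\to2^{\mathcal L(E,F)}$ of $\mathbf f=\psi\circ f\circ\varphi^{-1}$ such that $Jf(u)=d\psi^{-1}(\psi(f(u)))\,J\mathbf f(\varphi(u))\,[d\varphi^{-1}(\varphi(u))]^{-1}$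 for all $u\in W$: the operator of $Jf(u)$ represented by $\mathbf T\in J\mathbf f(\varphi(u))$ is identified with $d\psi^{-1}(\psi(f(x)))\,\mathbf T\,[d\varphi^{-1}(\varphi(x))]^{-1}$. (The value does not depend on the charts.) **$Jf$-regularity.** $f$ is $Jf$-regular at $x$ if $C(Jf(x))>0$ and there is $R>0$ such that every $T\in\mathrm{co}\,Jf(B_X(x;R))$ is a linear isomorphism. **Strong submersion.** $f$ is a strong submersion if there is no sequence $\{x_n\}$ in $X$ with $f(x_n)\to y$ for some $y\in Y$ and $C(Jf(x_n))\to0$. **Pseudo-Lipschitz property.** A set-valued map $g:Y\to2^X$ has the pseudo-Lipschitz property around $(y,x)$ if there are neighborhoods $V_y$, $W_x$ and $\mu>0$ with $d_X(u,g(z))\le\mu\,d_Y(w,z)$ whenever $w,z\in V_y$, $u\in W_x$ and $u\in g(w)$; the infimum of such $\mu$ is $\operatorname{lip} g(y|x)$. *)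

theory Defs
  imports "HOL-Analysis.Analysis" "HOL-Library.Function_Algebras"
begin

text \<open>
  Pointwise scalar multiplication complements the pointwise addition of
  \<^theory>\<open>HOL-Library.Function_Algebras\<close>. With it, tangent vectors (families of coordinate vectors
  indexed by charts) and operators between tangent spaces live in real vector spaces, and
  \<open>convex hull\<close> applies to sets of such operators.
\<close>

instantiation "fun" :: (type, real_vector) real_vector
begin

definition scaleR_fun :: "real \<Rightarrow> ('a \<Rightarrow> 'b) \<Rightarrow> 'a \<Rightarrow> 'b"
  where "scaleR_fun r g = (\<lambda>x. r *\<^sub>R g x)"

instance
  by standard (auto simp: scaleR_fun_def fun_eq_iff scaleR_add_right scaleR_add_left)

end

definition lin_on :: "'a::real_vector set \<Rightarrow> ('a \<Rightarrow> 'b::real_vector) \<Rightarrow> bool"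
  where "lin_on S g \<longleftrightarrow>
    (\<forall>u\<in>S. \<forall>v\<in>S. g (u + v) = g u + g v) \<and> (\<forall>r. \<forall>v\<in>S. g (r *\<^sub>R v) = r *\<^sub>R g v)"

definition norm_on :: "'a::real_vector set \<Rightarrow> ('a \<Rightarrow> real) \<Rightarrow> bool"
  where "norm_on S p \<longleftrightarrow>
    (\<forall>v\<in>S. 0 \<le> p v \<and> (p v = 0 \<longleftrightarrow> v = 0)) \<and>
    (\<forall>r. \<forall>v\<in>S. p (r *\<^sub>R v) = \<bar>r\<bar> * p v) \<and>
    (\<forall>u\<in>S. \<forall>v\<in>S. p (u + v) \<le> p u + p v)"

text \<open>
  The underlying set of a manifold is a whole Hausdorff space, and a chart is a pair of an open domain
  and a chart map; values of the chart map outside the domain are irrelevant.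
\<close>

type_synonym ('x, 'e) chart = "'x set \<times> ('x \<Rightarrow> 'e)"

definition is_chart :: "('x::topological_space, 'e::banach) chart \<Rightarrow> bool"
  where "is_chart c \<longleftrightarrow> open (fst c) \<and> open (snd c ` fst c) \<and>
    (\<exists>g. homeomorphism (fst c) (snd c ` fst c) (snd c) g)"

definition C1_on :: "'e::real_normed_vector set \<Rightarrow> ('e \<Rightarrow> 'f::real_normed_vector) \<Rightarrow> bool"
  where "C1_on U g \<longleftrightarrow>
    (\<exists>g' :: 'e \<Rightarrow> 'e \<Rightarrow>\<^sub>L 'f. (\<forall>z\<in>U. (g has_derivative blinfun_apply (g' z)) (at z)) \<and> continuous_on U g')"

definition chart_inv :: "('x, 'e) chart \<Rightarrow> 'e \<Rightarrow> 'x"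
  where "chart_inv c = inv_into (fst c) (snd c)"

definition transition :: "('x, 'e) chart \<Rightarrow> ('x, 'e) chart \<Rightarrow> 'e \<Rightarrow> 'e"
  where "transition c c' = snd c' \<circ> chart_inv c"

definition C1_compatible :: "('x, 'e::banach) chart \<Rightarrow> ('x, 'e) chart \<Rightarrow> bool"
  where "C1_compatible c c' \<longleftrightarrow>
    C1_on (snd c ` (fst c \<inter> fst c')) (transition c c') \<and>
    C1_on (snd c' ` (fst c \<inter> fst c')) (transition c' c)"

text \<open>The atlas is taken to be maximal, so that its members are all the charts of the manifold.\<close>

definition C1_manifold :: "('x::t2_space, 'e::banach) chart set \<Rightarrow> bool"
  where "C1_manifold A \<longleftrightarrow>
    (\<forall>c\<in>A. is_chart c) \<and> (\<Union>c\<in>A. fst c) = UNIV \<and>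
    (\<forall>c\<in>A. \<forall>c'\<in>A. C1_compatible c c') \<and>
    (\<forall>c. is_chart c \<and> (\<forall>c'\<in>A. C1_compatible c c') \<longrightarrow> c \<in> A)"

definition charts_at :: "('x, 'e) chart set \<Rightarrow> 'x \<Rightarrow> ('x, 'e) chart set"
  where "charts_at A x = {c \<in> A. x \<in> fst c}"

text \<open>
  A tangent vector at \<open>x\<close> is the family of its coordinate vectors in all the charts at \<open>x\<close>, that is,
  a family which transforms by the derivatives of the transition maps (and which is set to \<open>0\<close> at
  all other charts). So \<open>\<xi> c\<close> is the image of \<open>\<xi>\<close> under the inverse of
  \<open>d\<phi>\<^sup>-\<^sup>1(\<phi>(x)) : E \<rightarrow> T\<^sub>xX\<close> for \<open>c = (W, \<phi>)\<close>, and \<open>d\<phi>\<^sup>-\<^sup>1(\<phi>(x))\<close> itself is \<open>chart_lift A c x\<close>.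
\<close>

type_synonym ('x, 'e) tvec = "('x, 'e) chart \<Rightarrow> 'e"

definition transition_deriv ::
    "('x, 'e::banach) chart \<Rightarrow> ('x, 'e) chart \<Rightarrow> 'x \<Rightarrow> 'e \<Rightarrow> 'e"
  where "transition_deriv c c' x = frechet_derivative (transition c c') (at (snd c x))"

definition tangent_space :: "('x, 'e::banach) chart set \<Rightarrow> 'x \<Rightarrow> ('x, 'e) tvec set"
  where "tangent_space A x =
    {\<xi>. (\<forall>c\<in>charts_at A x. \<forall>c'\<in>charts_at A x. \<xi> c' = transition_deriv c c' x (\<xi> c)) \<and>
        (\<forall>c. c \<notin> charts_at A x \<longrightarrow> \<xi> c = 0)}"

definition chart_lift :: "('x, 'e::banach) chart set \<Rightarrow> ('x, 'e) chart \<Rightarrow> 'x \<Rightarrow> 'e \<Rightarrow> ('x, 'e) tvec"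
  where "chart_lift A c x v = (\<lambda>c'. if c' \<in> charts_at A x then transition_deriv c c' x v else 0)"

definition velocity :: "('x, 'e::banach) chart set \<Rightarrow> (real \<Rightarrow> 'x) \<Rightarrow> real set \<Rightarrow> real \<Rightarrow> ('x, 'e) tvec"
  where "velocity A \<sigma> I t =
    (\<lambda>c. if c \<in> charts_at A (\<sigma> t) then vector_derivative (snd c \<circ> \<sigma>) (at t within I) else 0)"

definition C1_path ::
    "('x::topological_space, 'e::banach) chart set \<Rightarrow> real \<Rightarrow> real \<Rightarrow> (real \<Rightarrow> 'x) \<Rightarrow> bool"
  where "C1_path A a b \<sigma> \<longleftrightarrow> continuous_on {a..b} \<sigma> \<and>
    (\<forall>c\<in>A. \<exists>D. continuous_on ({a..b} \<inter> \<sigma> -` fst c) D \<and>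
      (\<forall>t \<in> {a..b} \<inter> \<sigma> -` fst c. ((snd c \<circ> \<sigma>) has_vector_derivative D t) (at t within {a..b})))"

text \<open>
  \<open>N x\<close> is the norm on the tangent space at \<open>x\<close>; its values at other families are irrelevant.
  Since the charts of \<open>TX\<close> are \<open>(x, d\<phi>\<^sup>-\<^sup>1(\<phi>(x)) v) \<mapsto> (\<phi>(x), v)\<close>, continuity on \<open>TX\<close> is continuity in
  \<open>(x, v) \<in> W \<times> E\<close> for every chart.
\<close>

definition finsler_structure ::
    "('x::topological_space, 'e::banach) chart set \<Rightarrow> ('x \<Rightarrow> ('x, 'e) tvec \<Rightarrow> real) \<Rightarrow> bool"
  where "finsler_structure A N \<longleftrightarrow>
    (\<forall>c\<in>A. continuous_on (fst c \<times> UNIV) (\<lambda>(x, v). N x (chart_lift A c x v))) \<and>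
    (\<forall>x. norm_on (tangent_space A x) (N x) \<and>
      (\<forall>c\<in>charts_at A x. norm_on UNIV (\<lambda>v. N x (chart_lift A c x v)) \<and>
        (\<exists>m>0. \<exists>M>0. \<forall>v. m * norm v \<le> N x (chart_lift A c x v) \<and>
          N x (chart_lift A c x v) \<le> M * norm v))) \<and>
    (\<forall>x0. \<forall>c\<in>charts_at A x0. \<forall>\<epsilon>>0. \<exists>U. open U \<and> x0 \<in> U \<and> U \<subseteq> fst c \<and>
      (\<forall>x\<in>U. \<forall>v.
        1 / (1 + \<epsilon>) * N x0 (chart_lift A c x0 v) \<le> N x (chart_lift A c x v) \<and>
        N x (chart_lift A c x v) \<le> (1 + \<epsilon>) * N x0 (chart_lift A c x0 v)))"

definition finsler_manifold ::
    "('x::t2_space, 'e::banach) chart set \<Rightarrow> ('x \<Rightarrow> ('x, 'e) tvec \<Rightarrow> real) \<Rightarrow> bool"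
  where "finsler_manifold A N \<longleftrightarrow>
    C1_manifold A \<and> finsler_structure A N \<and> connected (UNIV :: 'x set)"

definition finsler_dist ::
    "('x::topological_space, 'e::banach) chart set \<Rightarrow> ('x \<Rightarrow> ('x, 'e) tvec \<Rightarrow> real) \<Rightarrow> 'x \<Rightarrow> 'x \<Rightarrow> real"
  where "finsler_dist A N u u' =
    Inf {integral {a..b} (\<lambda>t. N (\<sigma> t) (velocity A \<sigma> {a..b} t)) | \<sigma> a b.
      a < b \<and> C1_path A a b \<sigma> \<and> \<sigma> a = u \<and> \<sigma> b = u'}"

abbreviation finsler_ball ::
    "('x::topological_space, 'e::banach) chart set \<Rightarrow> ('x \<Rightarrow> ('x, 'e) tvec \<Rightarrow> real) \<Rightarrow> 'x \<Rightarrow> real \<Rightarrow> 'x set"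
  where "finsler_ball A N x r \<equiv> Metric_space.mball UNIV (finsler_dist A N) x r"

definition finsler_complete ::
    "('x::topological_space, 'e::banach) chart set \<Rightarrow> ('x \<Rightarrow> ('x, 'e) tvec \<Rightarrow> real) \<Rightarrow> bool"
  where "finsler_complete A N \<longleftrightarrow> Metric_space.mcomplete UNIV (finsler_dist A N)"

text \<open>
  Frechet differentiability on a tangent space is differentiability in the coordinates of a chart:
  the norm of the tangent space is equivalent to that of the model space.
\<close>

definition smooth_norm ::
    "('x, 'e::banach) chart set \<Rightarrow> ('x \<Rightarrow> ('x, 'e) tvec \<Rightarrow> real) \<Rightarrow> bool"
  where "smooth_norm A N \<longleftrightarrow>
    (\<forall>x. \<forall>c\<in>charts_at A x. \<forall>v. v \<noteq> 0 \<longrightarrow> (\<lambda>v. N x (chart_lift A c x v)) differentiable (at v))"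

definition finsler_locally_lipschitz ::
    "('x::topological_space, 'e::banach) chart set \<Rightarrow> ('x \<Rightarrow> ('x, 'e) tvec \<Rightarrow> real) \<Rightarrow>
     ('y::topological_space, 'f::banach) chart set \<Rightarrow> ('y \<Rightarrow> ('y, 'f) tvec \<Rightarrow> real) \<Rightarrow>
     ('x \<Rightarrow> 'y) \<Rightarrow> bool"
  where "finsler_locally_lipschitz A NX B NY f \<longleftrightarrow>
    (\<forall>x. \<exists>R>0. \<exists>K. \<forall>u\<in>finsler_ball A NX x R. \<forall>v\<in>finsler_ball A NX x R.
      finsler_dist B NY (f u) (f v) \<le> K * finsler_dist A NX u v)"

definition pseudo_jacobian_at ::
    "('e::banach \<Rightarrow> 'f::banach) \<Rightarrow> 'e \<Rightarrow> ('e \<Rightarrow>\<^sub>L 'f) set \<Rightarrow> bool"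
  where "pseudo_jacobian_at g x J \<longleftrightarrow> J \<noteq> {} \<and>
    (\<forall>(y :: 'f \<Rightarrow>\<^sub>L real) v.
      Limsup (at_right 0) (\<lambda>t. ereal ((y (g (x + t *\<^sub>R v)) - y (g x)) / t))
        \<le> (SUP T\<in>J. ereal (y (blinfun_apply T v))))"

definition pseudo_jacobian_map ::
    "'e::banach set \<Rightarrow> ('e \<Rightarrow> 'f::banach) \<Rightarrow> ('e \<Rightarrow> ('e \<Rightarrow>\<^sub>L 'f) set) \<Rightarrow> bool"
  where "pseudo_jacobian_map U g J \<longleftrightarrow>
    open U \<and> continuous_on U g \<and> (\<forall>x\<in>U. pseudo_jacobian_at g x (J x))"

definition locally_bounded_map ::
    "'e::banach set \<Rightarrow> ('e \<Rightarrow> ('e \<Rightarrow>\<^sub>L 'f::banach) set) \<Rightarrow> bool"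
  where "locally_bounded_map U J \<longleftrightarrow> (\<forall>x\<in>U. \<exists>r>0. ball x r \<subseteq> U \<and> bounded (\<Union>z\<in>ball x r. J z))"

definition weak_operator_topology :: "('e::banach \<Rightarrow>\<^sub>L 'f::banach) topology"
  where "weak_operator_topology =
    pullback_topology UNIV (\<lambda>T (y :: 'f \<Rightarrow>\<^sub>L real, v). y (blinfun_apply T v)) euclidean"

text \<open>
  An operator from the tangent space at \<open>x\<close> to the tangent space at \<open>y\<close> is extended by \<open>0\<close> outside
  the tangent space, so that equal operators are equal functions; \<open>tangent_op A B c d x y T\<close> is
  \<open>d\<psi>\<^sup>-\<^sup>1(\<psi>(y)) T [d\<phi>\<^sup>-\<^sup>1(\<phi>(x))]\<^sup>-\<^sup>1\<close> for \<open>c = (W, \<phi>)\<close> and \<open>d = (V, \<psi>)\<close>.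
\<close>

definition tangent_op ::
    "('x, 'e::banach) chart set \<Rightarrow> ('y, 'f::banach) chart set \<Rightarrow> ('x, 'e) chart \<Rightarrow> ('y, 'f) chart \<Rightarrow>
     'x \<Rightarrow> 'y \<Rightarrow> ('e \<Rightarrow>\<^sub>L 'f) \<Rightarrow> ('x, 'e) tvec \<Rightarrow> ('y, 'f) tvec"
  where "tangent_op A B c d x y T =
    (\<lambda>\<xi>. if \<xi> \<in> tangent_space A x then chart_lift B d y (blinfun_apply T (\<xi> c)) else 0)"

definition jacobian_rep ::
    "('x, 'e::banach) chart set \<Rightarrow> ('y, 'f::banach) chart set \<Rightarrow> ('x \<Rightarrow> 'y) \<Rightarrow>
     ('x \<Rightarrow> (('x, 'e) tvec \<Rightarrow> ('y, 'f) tvec) set) \<Rightarrow>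
     'x \<Rightarrow> ('x, 'e) chart \<Rightarrow> ('y, 'f) chart \<Rightarrow> ('e \<Rightarrow> ('e \<Rightarrow>\<^sub>L 'f) set) \<Rightarrow> bool"
  where "jacobian_rep A B f J x c d Jb \<longleftrightarrow>
    c \<in> charts_at A x \<and> d \<in> charts_at B (f x) \<and> f ` fst c \<subseteq> fst d \<and>
    pseudo_jacobian_map (snd c ` fst c) (snd d \<circ> f \<circ> chart_inv c) Jb \<and>
    locally_bounded_map (snd c ` fst c) Jb \<and>
    (\<forall>u\<in>fst c. J u = tangent_op A B c d u (f u) ` Jb (snd c u))"

definition pseudo_jacobian_mapping ::
    "('x, 'e::banach) chart set \<Rightarrow> ('y, 'f::banach) chart set \<Rightarrow> ('x \<Rightarrow> 'y) \<Rightarrow>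
     ('x \<Rightarrow> (('x, 'e) tvec \<Rightarrow> ('y, 'f) tvec) set) \<Rightarrow> bool"
  where "pseudo_jacobian_mapping A B f J \<longleftrightarrow> (\<forall>x. \<exists>c d Jb. jacobian_rep A B f J x c d Jb)"

definition strong_pseudo_jacobian_mapping ::
    "('x, 'e::banach) chart set \<Rightarrow> ('y, 'f::banach) chart set \<Rightarrow> ('x \<Rightarrow> 'y) \<Rightarrow>
     ('x \<Rightarrow> (('x, 'e) tvec \<Rightarrow> ('y, 'f) tvec) set) \<Rightarrow> bool"
  where "strong_pseudo_jacobian_mapping A B f J \<longleftrightarrow>
    (\<forall>x. \<exists>c d Jb. jacobian_rep A B f J x c d Jb \<and>
      (\<forall>z\<in>snd c ` fst c. convex (Jb z) \<and> compactin weak_operator_topology (Jb z)))"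

definition dual_norm_on :: "'a set \<Rightarrow> ('a \<Rightarrow> real) \<Rightarrow> ('a \<Rightarrow> real) \<Rightarrow> ennreal"
  where "dual_norm_on S p y = (SUP \<xi>\<in>{\<xi>\<in>S. p \<xi> \<le> 1}. ennreal \<bar>y \<xi>\<bar>)"

text \<open>
  Functionals of dual norm \<open>1\<close> are automatically bounded. If the target is zero-dimensional, there
  are none, and the infimum is \<open>\<infinity>\<close>.
\<close>

definition C_finsler ::
    "('x, 'e::banach) chart set \<Rightarrow> ('x \<Rightarrow> ('x, 'e) tvec \<Rightarrow> real) \<Rightarrow>
     ('y, 'f::banach) chart set \<Rightarrow> ('y \<Rightarrow> ('y, 'f) tvec \<Rightarrow> real) \<Rightarrow>
     'x \<Rightarrow> 'y \<Rightarrow> (('x, 'e) tvec \<Rightarrow> ('y, 'f) tvec) \<Rightarrow> ennreal"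
  where "C_finsler A NX B NY x y T =
    (INF \<eta> \<in> {\<eta>. lin_on (tangent_space B y) \<eta> \<and> dual_norm_on (tangent_space B y) (NY y) \<eta> = 1}.
      dual_norm_on (tangent_space A x) (NX x) (\<eta> \<circ> T))"

text \<open>
  Identification, by means of the charts \<open>c\<close> and \<open>d\<close>, of operators between the tangent spaces at
  \<open>u\<close> and \<open>f u\<close> with operators between those at \<open>x\<close> and \<open>f x\<close>: if \<open>S\<close> is represented by \<open>T\<close> in
  these charts at \<open>u\<close>, then the operator represented by \<open>T\<close> at \<open>x\<close> is \<open>transport_op A B f c d x u S\<close>.
\<close>

definition transport_op ::
    "('x, 'e::banach) chart set \<Rightarrow> ('y, 'f::banach) chart set \<Rightarrow> ('x \<Rightarrow> 'y) \<Rightarrow>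
     ('x, 'e) chart \<Rightarrow> ('y, 'f) chart \<Rightarrow> 'x \<Rightarrow> 'x \<Rightarrow>
     (('x, 'e) tvec \<Rightarrow> ('y, 'f) tvec) \<Rightarrow> ('x, 'e) tvec \<Rightarrow> ('y, 'f) tvec"
  where "transport_op A B f c d x u S =
    (\<lambda>\<xi>. if \<xi> \<in> tangent_space A x then chart_lift B d (f x) (S (chart_lift A c u (\<xi> c)) d) else 0)"

text \<open>
  The identification uses any pair of charts in which \<open>J\<close> is represented by a locally bounded
  pseudo-Jacobian mapping. The index below does not depend on the pair: by local boundedness,
  two such identifications differ on \<open>J u\<close> in operator norm by a quantity that tends to \<open>0\<close> as
  \<open>u\<close> tends to \<open>x\<close>. For the same reason the regularity notion is independent of the pair.
\<close>

definition adapted_charts ::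
    "('x, 'e::banach) chart set \<Rightarrow> ('y, 'f::banach) chart set \<Rightarrow> ('x \<Rightarrow> 'y) \<Rightarrow>
     ('x \<Rightarrow> (('x, 'e) tvec \<Rightarrow> ('y, 'f) tvec) set) \<Rightarrow> 'x \<Rightarrow> ('x, 'e) chart \<times> ('y, 'f) chart"
  where "adapted_charts A B f J x = (SOME (c, d). \<exists>Jb. jacobian_rep A B f J x c d Jb)"

definition jacobian_ball ::
    "('x::topological_space, 'e::banach) chart set \<Rightarrow> ('x \<Rightarrow> ('x, 'e) tvec \<Rightarrow> real) \<Rightarrow>
     ('y, 'f::banach) chart set \<Rightarrow> ('x \<Rightarrow> 'y) \<Rightarrow>
     ('x \<Rightarrow> (('x, 'e) tvec \<Rightarrow> ('y, 'f) tvec) set) \<Rightarrow> 'x \<Rightarrow> real \<Rightarrow>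
     (('x, 'e) tvec \<Rightarrow> ('y, 'f) tvec) set"
  where "jacobian_ball A NX B f J x R =
    (case adapted_charts A B f J x of (c, d) \<Rightarrow>
      (\<Union>u\<in>finsler_ball A NX x R. transport_op A B f c d x u ` J u))"

definition small_radii ::
    "('x::topological_space, 'e::banach) chart set \<Rightarrow> ('x \<Rightarrow> ('x, 'e) tvec \<Rightarrow> real) \<Rightarrow>
     ('y, 'f::banach) chart set \<Rightarrow> ('x \<Rightarrow> 'y) \<Rightarrow>
     ('x \<Rightarrow> (('x, 'e) tvec \<Rightarrow> ('y, 'f) tvec) set) \<Rightarrow> 'x \<Rightarrow> real set"
  where "small_radii A NX B f J x =
    {R. R > 0 \<and> finsler_ball A NX x R \<subseteq> fst (fst (adapted_charts A B f J x))}"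

text \<open>
  The infimum decreases as \<open>R\<close> grows, so the supremum over all \<open>R > 0\<close> is the supremum over small
  radii.
\<close>

definition regularity_index ::
    "('x::topological_space, 'e::banach) chart set \<Rightarrow> ('x \<Rightarrow> ('x, 'e) tvec \<Rightarrow> real) \<Rightarrow>
     ('y, 'f::banach) chart set \<Rightarrow> ('y \<Rightarrow> ('y, 'f) tvec \<Rightarrow> real) \<Rightarrow> ('x \<Rightarrow> 'y) \<Rightarrow>
     ('x \<Rightarrow> (('x, 'e) tvec \<Rightarrow> ('y, 'f) tvec) set) \<Rightarrow> 'x \<Rightarrow> ennreal"
  where "regularity_index A NX B NY f J x =
    (SUP R\<in>small_radii A NX B f J x.
      INF T\<in>convex hull (jacobian_ball A NX B f J x R). C_finsler A NX B NY x (f x) T)"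

definition jacobian_regular ::
    "('x::topological_space, 'e::banach) chart set \<Rightarrow> ('x \<Rightarrow> ('x, 'e) tvec \<Rightarrow> real) \<Rightarrow>
     ('y, 'f::banach) chart set \<Rightarrow> ('y \<Rightarrow> ('y, 'f) tvec \<Rightarrow> real) \<Rightarrow> ('x \<Rightarrow> 'y) \<Rightarrow>
     ('x \<Rightarrow> (('x, 'e) tvec \<Rightarrow> ('y, 'f) tvec) set) \<Rightarrow> 'x \<Rightarrow> bool"
  where "jacobian_regular A NX B NY f J x \<longleftrightarrow>
    regularity_index A NX B NY f J x > 0 \<and>
    (\<exists>R\<in>small_radii A NX B f J x. \<forall>T\<in>convex hull (jacobian_ball A NX B f J x R).
      lin_on (tangent_space A x) T \<and> bij_betw T (tangent_space A x) (tangent_space B (f x)))"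

definition strong_submersion ::
    "('x::topological_space, 'e::banach) chart set \<Rightarrow> ('x \<Rightarrow> ('x, 'e) tvec \<Rightarrow> real) \<Rightarrow>
     ('y::topological_space, 'f::banach) chart set \<Rightarrow> ('y \<Rightarrow> ('y, 'f) tvec \<Rightarrow> real) \<Rightarrow> ('x \<Rightarrow> 'y) \<Rightarrow>
     ('x \<Rightarrow> (('x, 'e) tvec \<Rightarrow> ('y, 'f) tvec) set) \<Rightarrow> bool"
  where "strong_submersion A NX B NY f J \<longleftrightarrow>
    \<not> (\<exists>(s :: nat \<Rightarrow> 'x) y. (\<lambda>n. f (s n)) \<longlonglongrightarrow> y \<and>
        (\<lambda>n. regularity_index A NX B NY f J (s n)) \<longlonglongrightarrow> 0)"

text \<open>The distance to the empty set is \<open>\<infinity>\<close>.\<close>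

definition pseudo_lipschitz_const ::
    "('x::topological_space \<Rightarrow> 'x \<Rightarrow> real) \<Rightarrow> ('y::topological_space \<Rightarrow> 'y \<Rightarrow> real) \<Rightarrow>
     ('y \<Rightarrow> 'x set) \<Rightarrow> 'y \<Rightarrow> 'x \<Rightarrow> real \<Rightarrow> bool"
  where "pseudo_lipschitz_const dX dY g y x \<mu> \<longleftrightarrow> \<mu> > 0 \<and>
    (\<exists>V W. open V \<and> y \<in> V \<and> open W \<and> x \<in> W \<and>
      (\<forall>w\<in>V. \<forall>z\<in>V. \<forall>u\<in>W \<inter> g w. (INF v\<in>g z. ennreal (dX u v)) \<le> ennreal (\<mu> * dY w z)))"

definition pseudo_lipschitz ::
    "('x::topological_space \<Rightarrow> 'x \<Rightarrow> real) \<Rightarrow> ('y::topological_space \<Rightarrow> 'y \<Rightarrow> real) \<Rightarrow>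
     ('y \<Rightarrow> 'x set) \<Rightarrow> 'y \<Rightarrow> 'x \<Rightarrow> bool"
  where "pseudo_lipschitz dX dY g y x \<longleftrightarrow> (\<exists>\<mu>. pseudo_lipschitz_const dX dY g y x \<mu>)"

definition lip_modulus ::
    "('x::topological_space \<Rightarrow> 'x \<Rightarrow> real) \<Rightarrow> ('y::topological_space \<Rightarrow> 'y \<Rightarrow> real) \<Rightarrow>
     ('y \<Rightarrow> 'x set) \<Rightarrow> 'y \<Rightarrow> 'x \<Rightarrow> ennreal"
  where "lip_modulus dX dY g y x = (INF \<mu>\<in>{\<mu>. pseudo_lipschitz_const dX dY g y x \<mu>}. ennreal \<mu>)"

end

theory Submission
  imports Defs
begin

text \<open>
  In charts, and with the norms of the two tangent spaces frozen, regularity bounds the adjoints of all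
  convex combinations of nearby pseudo-Jacobian operators from below by some \<open>k\<close>. Ekeland's variational
  principle applied to \<open>u \<mapsto> \<parallel>f u - y\<parallel>\<close>, whose slope at an almost minimal point is governed by the
  derivative of the smooth norm, shows that \<open>f\<close> is open; the minimax argument that produces a direction of
  descent common to all operators of \<open>J u\<close> uses their convexity and weak compactness. Applied to a
  single operator \<open>T\<close>, the same argument gives \<open>\<parallel>T v\<parallel> \<ge> k \<parallel>v\<parallel>\<close>, and the mean value theorem transfers
  this bound to \<open>f\<close>. So \<open>f\<close> is locally an open embedding whose inverse is Lipschitz with constant \<open>1/k\<close>.

  Strong submersivity makes \<open>k\<close> uniform over the fibres near a point \<open>y\<close>. In a coordinate ball around
  \<open>y\<close>, segments then lift to paths of controlled length, which exist up to the end because \<open>X\<close> is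
  complete. Lifting the radial segments to the centre retracts the preimage of the ball onto the fibre of
  \<open>y\<close>; this retraction is locally constant, and its level sets are the sheets.
\<close>

text \<open>The two halves of regularity do different work. The bound on adjoints is a surjectivity
  statement: with constant \<open>c\<close>, the image of the unit ball covers the open ball of
  radius \<open>c\<close>. Bijectivity upgrades this to an estimate from below on the operator
  itself, since a covered point has only one preimage. Both are needed on the whole convex hull near
  a point, because the mean value theorem locates the increment of a nonsmooth map only in the
  closure of the hull applied to the displacement.

  Constants are obtained with a strict loss: Ekeland's principle, the Dini derivatives behind the
  pseudo-Jacobian inequality and the distortion of charts each need a gap. The gap below the index
  can be taken arbitrarily small, so the final modulus is still bounded by the reciprocal of the
  index.

  Lifts are merely continuous; their Lipschitz bound is proved for the distance and not by
  integrating a speed.\<close>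

subsection \<open>Equivalent norms on Banach spaces\<close>

text \<open>A Finsler norm at one point, read in a chart, is of this kind. The type class norm
  supplies topology and completeness, while the sharp constants are measured by
  \<open>p\<close>.\<close>

locale equiv_norm =
  fixes p :: "'a::banach \<Rightarrow> real"
  assumes scale: "p (r *\<^sub>R v) = \<bar>r\<bar> * p v"
    and triangle: "p (u + v) \<le> p u + p v"
    and lower_bound: "\<exists>m>0. \<forall>v. m * norm v \<le> p v"
    and upper_bound: "\<exists>M>0. \<forall>v. p v \<le> M * norm v"
begin

lemma zero [simp]: "p 0 = 0"
  using scale[of 0 0] by simp

lemma nonneg [simp]: "0 \<le> p v"
proof -
  obtain m where "m > 0" "m * norm v \<le> p v" using lower_bound by blast
  then show ?thesis using order_trans[of 0 "m * norm v"] by simp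
qed

lemma eq_0_iff [simp]: "p v = 0 \<longleftrightarrow> v = 0"
proof
  assume "p v = 0"
  moreover obtain m where "m > 0" "m * norm v \<le> p v" using lower_bound by blast
  ultimately have "norm v \<le> 0" by (simp add: mult_le_0_iff)
  then show "v = 0" by simp
qed simp

lemma pos: "v \<noteq> 0 \<Longrightarrow> 0 < p v"
  using nonneg[of v] eq_0_iff[of v] by linarith

lemma minus: "p (- v) = p v"
  using scale[of "-1" v] by simp

lemma minus_commute: "p (u - v) = p (v - u)"
  using minus[of "u - v"] by simp

lemma diff_triangle: "p (u - w) \<le> p (u - v) + p (v - w)"
  using triangle[of "u - v" "v - w"] by simp

lemma diff_le: "p u - p v \<le> p (u - v)"
  using triangle[of "u - v" v] by simp

lemma lipschitz_bound:
  assumes "\<And>v. p v \<le> M * norm v"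
  shows "\<bar>p u - p v\<bar> \<le> M * norm (u - v)"
  using diff_le[of u v] diff_le[of v u] minus_commute[of u v] assms[of "u - v"] by linarith

lemma continuous: "continuous_on S p"
proof -
  obtain M where M: "M > 0" "\<And>v. p v \<le> M * norm v" using upper_bound by blast
  have "M-lipschitz_on S p"
    using M lipschitz_bound[OF M(2)]
    by (intro lipschitz_onI) (auto simp: dist_norm)
  then show ?thesis by (rule lipschitz_on_continuous_on)
qed

lemma tendsto: "(h \<longlongrightarrow> l) F \<Longrightarrow> ((\<lambda>x. p (h x)) \<longlongrightarrow> p l) F"
  using continuous_on_tendsto_compose[OF continuous[of UNIV]] by auto

lemma ball_subset:
  assumes "open U" "a \<in> U"
  obtains r where "r > 0" "{u. p (u - a) \<le> r} \<subseteq> U"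
proof -
  obtain m where m: "m > 0" "\<And>v. m * norm v \<le> p v" using lower_bound by blast
  obtain e where e: "e > 0" "ball a e \<subseteq> U" using assms openE by blast
  have "u \<in> U" if "p (u - a) \<le> m * e / 2" for u
  proof -
    have "m * norm (u - a) \<le> m * (e / 2)" using m(2)[of "u - a"] that by simp
    then have "norm (u - a) \<le> e / 2" using m(1) by (simp only: mult_le_cancel_left_pos)
    then show ?thesis using e by (auto simp: dist_norm norm_minus_commute subset_iff)
  qed
  then show thesis using that[of "m * e / 2"] m e by auto
qed

lemma open_ball: "open {u. p (u - a) < r}"
  by (intro open_Collect_less continuous_on_const continuous_on_compose2[OF continuous[of UNIV]])
    (auto intro!: continuous_intros)

lemma closed_cball: "closed {u. p (u - a) \<le> r}"
  by (intro closed_Collect_le continuous_on_const continuous_on_compose2[OF continuous[of UNIV]])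
    (auto intro!: continuous_intros)

lemma convex_ball: "convex {u. p (u - a) < r}"
proof (rule convexI)
  fix x y and s t :: real
  assume xy: "x \<in> {u. p (u - a) < r}" "y \<in> {u. p (u - a) < r}" and st: "0 \<le> s" "0 \<le> t" "s + t = 1"
  have "s *\<^sub>R x + t *\<^sub>R y - a = s *\<^sub>R (x - a) + t *\<^sub>R (y - a)"
    using st by (simp add: algebra_simps flip: scaleR_left_distrib)
  then have "p (s *\<^sub>R x + t *\<^sub>R y - a) \<le> s * p (x - a) + t * p (y - a)"
    using triangle[of "s *\<^sub>R (x - a)" "t *\<^sub>R (y - a)"] st by (simp add: scale)
  also have "\<dots> < r"
    using xy st by (intro convex_bound_lt) auto
  finally show "s *\<^sub>R x + t *\<^sub>R y \<in> {u. p (u - a) < r}" by simp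
qed

text \<open>The sets \<open>R u\<close> of points that improve enough on \<open>u\<close> are nested
  along \<open>s\<close>, by transitivity. Choosing each \<open>s (Suc n)\<close> almost minimal for
  \<open>h\<close> in \<open>R (s n)\<close> forces their diameters to 0, and the limit of
  \<open>s\<close> can only be improved by itself.\<close>

lemma ekeland:
  fixes h :: "'a \<Rightarrow> real"
  assumes S: "closed S" "a \<in> S" and h: "continuous_on S h" "\<And>u. u \<in> S \<Longrightarrow> 0 \<le> h u" and e: "e > 0"
  obtains u where "u \<in> S" "h u + e * p (u - a) \<le> h a"
    "\<And>w. w \<in> S \<Longrightarrow> w \<noteq> u \<Longrightarrow> h u < h w + e * p (w - u)"
proof -
  define R where "R u = {w \<in> S. h w + e * p (w - u) \<le> h u}" for u
  have R_refl: "u \<in> R u" if "u \<in> S" for u using that by (simp add: R_def)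
  have R_trans: "w' \<in> R u" if "w \<in> R u" "w' \<in> R w" for u w w'
  proof -
    have "e * p (w' - u) \<le> e * p (w' - w) + e * p (w - u)"
      using mult_left_mono[OF diff_triangle[of w' u w], of e] e by (simp add: algebra_simps)
    then show ?thesis using that by (simp add: R_def)
  qed
  have step: "\<exists>w. w \<in> R u \<and> (\<forall>w'\<in>R u. h w \<le> h w' + d)" if "u \<in> S" "d > 0" for u d
  proof -
    have bdd: "bdd_below (h ` R u)" using h(2) by (auto simp: R_def intro!: bdd_belowI[of _ 0])
    have ne: "h ` R u \<noteq> {}" using R_refl[OF that(1)] by auto
    have "\<exists>x\<in>h ` R u. x < Inf (h ` R u) + d"
      using cInf_lessD[OF ne, of "Inf (h ` R u) + d"] that(2) by auto
    then obtain w where w: "w \<in> R u" "h w < Inf (h ` R u) + d" by auto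
    moreover have "Inf (h ` R u) \<le> h w'" if "w' \<in> R u" for w'
      using bdd that by (intro cInf_lower) auto
    ultimately show ?thesis by force
  qed
  have "\<exists>s. \<forall>n. (s n \<in> S \<and> (n = 0 \<longrightarrow> s n = a)) \<and>
     s (Suc n) \<in> R (s n) \<and> (\<forall>w'\<in>R (s n). h (s (Suc n)) \<le> h w' + inverse (real (Suc n)))"
  proof (rule dependent_nat_choice[of "\<lambda>n x. x \<in> S \<and> (n = 0 \<longrightarrow> x = a)"
      "\<lambda>n x y. y \<in> R x \<and> (\<forall>w'\<in>R x. h y \<le> h w' + inverse (real (Suc n)))"])
    show "\<exists>x. x \<in> S \<and> (0 = (0::nat) \<longrightarrow> x = a)" using S by auto
  next
    fix x and n :: nat assume "x \<in> S \<and> (n = 0 \<longrightarrow> x = a)"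
    then have "x \<in> S" by simp
    from step[OF this, of "inverse (real (Suc n))"]
    obtain w where "w \<in> R x" "\<forall>w'\<in>R x. h w \<le> h w' + inverse (real (Suc n))" by auto
    then show "\<exists>y. (y \<in> S \<and> (Suc n = 0 \<longrightarrow> y = a)) \<and>
        (y \<in> R x \<and> (\<forall>w'\<in>R x. h y \<le> h w' + inverse (real (Suc n))))"
      by (auto simp: R_def)
  qed
  then obtain s where s: "\<And>n. s n \<in> S" "s 0 = a" "\<And>n. s (Suc n) \<in> R (s n)"
    "\<And>n w'. w' \<in> R (s n) \<Longrightarrow> h (s (Suc n)) \<le> h w' + inverse (real (Suc n))" by metis
  have sR: "s m \<in> R (s n)" if "n \<le> m" for m n
    using that
  proof (induction rule: dec_induct)
    case base then show ?case using s(1) R_refl by simp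
  next
    case (step k) then show ?case using R_trans s(3) by blast
  qed
  obtain m where m: "m > 0" "\<And>v. m * norm v \<le> p v" using lower_bound by blast
  \<comment> \<open>Near minimality of \<open>h (s (Suc n))\<close> leaves at most
    \<open>1 / (n + 1)\<close> for the penalty \<open>e * p (w - s (Suc n))\<close>.\<close>
  have small: "norm (w - s (Suc n)) \<le> inverse (real (Suc n)) / (e * m)" if "w \<in> R (s (Suc n))" for w n
  proof -
    have "w \<in> R (s n)" using R_trans[OF s(3) that] .
    then have "h (s (Suc n)) \<le> h w + inverse (real (Suc n))" by (rule s(4))
    moreover have "h w + e * p (w - s (Suc n)) \<le> h (s (Suc n))" using that by (simp add: R_def)
    moreover have "e * (m * norm (w - s (Suc n))) \<le> e * p (w - s (Suc n))" using m(2) e by simp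
    ultimately have "norm (w - s (Suc n)) * (e * m) \<le> inverse (real (Suc n))" by (simp add: ac_simps)
    then show ?thesis using e m(1) by (simp only: pos_le_divide_eq mult_pos_pos)
  qed
  have lim0: "(\<lambda>n. inverse (real (Suc n)) / (e * m)) \<longlonglongrightarrow> 0"
    using tendsto_divide[OF LIMSEQ_inverse_real_of_nat tendsto_const[of "e*m"]] e m by simp
  have "Cauchy s"
  proof (rule metric_CauchyI)
    fix d :: real assume "d > 0"
    then obtain n where n: "inverse (real (Suc n)) / (e * m) < d / 2"
      using order_tendstoD(2)[OF lim0, of "d/2"] by (auto simp: eventually_sequentially)
    have "dist (s i) (s j) < d" if "i \<ge> Suc n" "j \<ge> Suc n" for i j
    proof -
      have "norm (s i - s (Suc n)) < d / 2" "norm (s j - s (Suc n)) < d / 2"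
        using small[OF sR[OF that(1)]] small[OF sR[OF that(2)]] n by linarith+
      then show ?thesis by (smt (verit) dist_norm dist_triangle_half_l)
    qed
    then show "\<exists>M. \<forall>m\<ge>M. \<forall>n\<ge>M. dist (s m) (s n) < d" by blast
  qed
  then obtain u where u: "s \<longlonglongrightarrow> u" using Cauchy_convergent convergent_def by blast
  have uS: "u \<in> S" using S(1) s(1) u closed_sequentially by blast
  have hs: "(\<lambda>n. h (s n)) \<longlonglongrightarrow> h u"
    using continuous_on_tendsto_compose[OF h(1) u uS] s(1) by auto
  \<comment> \<open>Since \<open>h\<close> and \<open>p\<close> are continuous, the inequality
    defining \<open>R (s n)\<close> passes to the limit.\<close>
  have uR: "u \<in> R (s n)" for n
  proof -
    have "(\<lambda>k. h (s k) + e * p (s k - s n)) \<longlonglongrightarrow> h u + e * p (u - s n)"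
      by (intro tendsto_intros hs tendsto u)
    moreover have "\<forall>k\<ge>n. h (s k) + e * p (s k - s n) \<le> h (s n)"
      using sR by (simp add: R_def)
    ultimately have "h u + e * p (u - s n) \<le> h (s n)"
      by (intro LIMSEQ_le_const2) auto
    then show ?thesis using uS by (simp add: R_def)
  qed
  have uniq: "w = u" if "w \<in> R u" for w
  proof -
    have wR: "w \<in> R (s (Suc n))" for n using R_trans[OF uR that] .
    have "(\<lambda>n. w - s (Suc n)) \<longlonglongrightarrow> 0"
      by (rule Lim_null_comparison[OF _ lim0]) (use small[OF wR] in auto)
    moreover have "(\<lambda>n. w - s (Suc n)) \<longlonglongrightarrow> w - u"
      by (intro tendsto_intros LIMSEQ_Suc u)
    ultimately show ?thesis using LIMSEQ_unique by fastforce
  qed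
  show thesis
  proof (rule that[OF uS])
    show "h u + e * p (u - a) \<le> h a" using uR[of 0] s(2) by (simp add: R_def)
    fix w assume "w \<in> S" "w \<noteq> u"
    then show "h u < h w + e * p (w - u)" using uniq[of w] by (force simp: R_def)
  qed
qed

section \<open>One-sided derivatives of a smooth norm\<close>

lemma directional_deriv:
  assumes D: "(p has_derivative D) (at z)"
  shows "((\<lambda>t. (p (z + t *\<^sub>R v) - p z) / t) \<longlongrightarrow> D v) (at_right 0)"
proof -
  have "((\<lambda>t. z + t *\<^sub>R v) has_derivative (\<lambda>t. t *\<^sub>R v)) (at 0)"
    by (auto intro!: derivative_eq_intros)
  then have "((\<lambda>t. p (z + t *\<^sub>R v)) has_derivative (\<lambda>t. D (t *\<^sub>R v))) (at 0)"
    using has_derivative_compose[of "\<lambda>t. z + t *\<^sub>R v" "\<lambda>t. t *\<^sub>R v" 0 UNIV p D] D by simp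
  then have "((\<lambda>t. p (z + t *\<^sub>R v)) has_derivative (\<lambda>t. t * D v)) (at 0)"
    using linear_scale[OF has_derivative_linear[OF D]] by simp
  then have "((\<lambda>t. p (z + t *\<^sub>R v)) has_real_derivative D v) (at 0)"
    by (simp add: has_field_derivative_def mult.commute[of _ "D v"])
  then have "((\<lambda>t. (p (z + t *\<^sub>R v) - p z) / t) \<longlongrightarrow> D v) (at 0)"
    by (simp add: DERIV_def)
  then show ?thesis by (rule filterlim_mono) (auto simp: at_le)
qed

text \<open>Euler's identity for a positively homogeneous function: along the ray through
  \<open>z\<close> the difference quotient is constantly \<open>p z\<close>.\<close>

lemma deriv_self:
  assumes D: "(p has_derivative D) (at z)"
  shows "D z = p z"
proof -
  have "\<forall>\<^sub>F t in at_right 0. (p (z + t *\<^sub>R z) - p z) / t = p z"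
  proof -
    have "(p (z + t *\<^sub>R z) - p z) / t = p z" if "t > 0" for t
    proof -
      have "z + t *\<^sub>R z = (1 + t) *\<^sub>R z" by (simp add: algebra_simps)
      then have "p (z + t *\<^sub>R z) = \<bar>1 + t\<bar> * p z" by (simp only: scale)
      then have "p (z + t *\<^sub>R z) - p z = t * p z" using that by (simp add: algebra_simps)
      then show ?thesis using that by simp
    qed
    then show ?thesis by (intro eventually_at_rightI[of _ 1]) auto
  qed
  with directional_deriv[OF D, where v = z] have "((\<lambda>t::real. p z) \<longlongrightarrow> D z) (at_right 0)"
    using tendsto_cong by force
  then show ?thesis by (simp add: tendsto_const_iff)
qed

text \<open>The triangle inequality bounds each right difference quotient by \<open>p v\<close>, and
  \<open>- v\<close> gives the other sign. With \<open>deriv_self\<close> this makes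
  \<open>D\<close>, for \<open>z \<noteq> 0\<close>, a functional of norm 1 that attains its
  norm.\<close>

lemma deriv_le:
  assumes D: "(p has_derivative D) (at z)"
  shows "\<bar>D v\<bar> \<le> p v"
proof -
  have *: "D v \<le> p v" for v
  proof (rule tendsto_upperbound[OF directional_deriv[OF D]])
    show "\<forall>\<^sub>F t in at_right 0. (p (z + t *\<^sub>R v) - p z) / t \<le> p v"
    proof -
      have "(p (z + t *\<^sub>R v) - p z) / t \<le> p v" if "t > 0" for t
        using triangle[of z "t *\<^sub>R v"] that by (simp add: scale field_simps)
      then show ?thesis by (intro eventually_at_rightI[of _ 1]) auto
    qed
  qed simp
  have "D (- v) = - D v" using linear_neg[OF has_derivative_linear[OF D]] by blast
  then show ?thesis using *[of v] *[of "- v"] minus by auto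
qed

text \<open>Converts Ekeland minimality along a segment into an inequality for the
  derivative.\<close>

lemma deriv_ge:
  assumes D: "(p has_derivative D) (at z)" and d: "d > 0"
    and ge: "\<And>t. 0 < t \<Longrightarrow> t < d \<Longrightarrow> p z - k * t \<le> p (z + t *\<^sub>R v)"
  shows "- k \<le> D v"
proof (rule tendsto_lowerbound[OF directional_deriv[OF D]])
  have "- k \<le> (p (z + t *\<^sub>R v) - p z) / t" if "0 < t" "t < d" for t
    using ge[OF that] that by (simp add: field_simps)
  then show "\<forall>\<^sub>F t in at_right 0. - k \<le> (p (z + t *\<^sub>R v) - p z) / t"
    using d by (intro eventually_at_rightI[of _ d]) auto
qed simp

text \<open>For a smooth norm, approximate nearest points replace the Hahn-Banach theorem.\<close>

lemma separation:
  assumes smooth: "\<forall>v. v \<noteq> 0 \<longrightarrow> p differentiable (at v)"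
    and C: "convex C" "bounded C" "C \<noteq> {}" and w: "w \<notin> closure C"
  obtains y :: "'a \<Rightarrow>\<^sub>L real" and \<delta> where "\<delta> > 0" "\<And>k. k \<in> C \<Longrightarrow> \<delta> \<le> y (k - w)"
proof -
  let ?K = "closure C"
  obtain d where d: "d > 0" "\<And>k. k \<in> ?K \<Longrightarrow> d \<le> dist w k"
  proof -
    obtain e where "e > 0" "ball w e \<subseteq> - ?K" using w openE[of "- ?K" w] by (metis ComplI closed_closure open_Compl)
    then show thesis using that[of e] by (force simp: subset_iff not_less)
  qed
  obtain m where m: "m > 0" "\<And>v. m * norm v \<le> p v" using lower_bound by blast
  define \<delta> where "\<delta> = m * d"
  have \<delta>: "\<delta> > 0" using m d by (simp add: \<delta>_def)
  have far: "\<delta> \<le> p (k - w)" if "k \<in> ?K" for k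
  proof -
    have "m * d \<le> m * norm (k - w)" using d(2)[OF that] m by (simp add: dist_norm norm_minus_commute)
    then show ?thesis using m(2)[of "k - w"] by (simp add: \<delta>_def)
  qed
  obtain M where M: "M > 0" "\<And>v. p v \<le> M * norm v" using upper_bound by blast
  have "bounded ?K" using C(2) by (rule bounded_closure)
  then obtain b where b: "\<And>k k'. k \<in> ?K \<Longrightarrow> k' \<in> ?K \<Longrightarrow> dist k k' \<le> b" "b \<ge> 0"
    by (metis bounded_two_points order_trans zero_le_dist C(3) closure_eq_empty ex_in_conv)
  \<comment> \<open>This size keeps the Ekeland penalty between any two points of the bounded set at
    most \<open>\<delta> / 2\<close>, half of the gap.\<close>
  define e where "e = \<delta> / (2 * (M * b + 1))"
  have Mb: "M * b + 1 > 0" using mult_nonneg_nonneg[of M b] M(1) b(2) by linarith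
  have e: "e > 0" using \<delta> Mb by (simp add: e_def)
  have eb: "e * p (k - k') \<le> \<delta> / 2" if "k \<in> ?K" "k' \<in> ?K" for k k'
  proof -
    have "p (k - k') \<le> M * b"
      using order_trans[OF M(2)[of "k - k'"] mult_left_mono[OF b(1)[OF that], of M, unfolded dist_norm]] M(1)
      by simp
    then have "e * p (k - k') \<le> e * (M * b + 1)" using e by (intro mult_left_mono) auto
    also have "\<dots> = \<delta> / 2" using Mb by (simp add: e_def divide_simps)
    finally show ?thesis .
  qed
  obtain k1 where "k1 \<in> ?K" using C(3) closure_subset[of C] by blast
  moreover have "continuous_on ?K (\<lambda>k. p (k - w))"
    by (intro continuous_on_compose2[OF continuous[of UNIV]]) (auto intro!: continuous_intros)
  ultimately obtain k0 where k0: "k0 \<in> ?K"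
    "\<And>k. k \<in> ?K \<Longrightarrow> k \<noteq> k0 \<Longrightarrow> p (k0 - w) < p (k - w) + e * p (k - k0)"
    using ekeland[of ?K k1 "\<lambda>k. p (k - w)" e] e by auto
  have "k0 - w \<noteq> 0" using far[OF k0(1)] \<delta> by force
  then obtain D where D: "(p has_derivative D) (at (k0 - w))"
    using smooth unfolding differentiable_def by blast
  have bl: "bounded_linear D" using D has_derivative_bounded_linear by blast
  \<comment> \<open>Moving from the almost nearest point \<open>k0\<close> towards \<open>k\<close>
    cannot lower \<open>p\<close> at a rate above the penalty, while
    \<open>D (k0 - w) = p (k0 - w)\<close> is at least the full gap.\<close>
  have "\<delta> / 2 \<le> D (k - w)" if k: "k \<in> ?K" for k
  proof -
    have "- (e * p (k - k0)) \<le> D (k - k0)"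
    proof (rule deriv_ge[OF D, of 1])
      fix t :: real assume t: "0 < t" "t < 1"
      let ?k = "k0 + t *\<^sub>R (k - k0)"
      have "?k = (1 - t) *\<^sub>R k0 + t *\<^sub>R k" by (simp add: algebra_simps)
      then have "?k \<in> ?K" using convex_closure[OF C(1)] k k0(1) t
        by (auto simp: convex_def)
      moreover have "?k - w = k0 - w + t *\<^sub>R (k - k0)" by simp
      moreover have "p (?k - k0) = t * p (k - k0)" using t by (simp add: scale)
      ultimately show "p (k0 - w) - e * p (k - k0) * t \<le> p (k0 - w + t *\<^sub>R (k - k0))"
        using k0(2)[of ?k] by (cases "?k = k0") (auto simp: algebra_simps)
    qed simp
    moreover have "D (k0 - w) = p (k0 - w)" by (rule deriv_self[OF D])
    moreover have "D (k - w) = D (k - k0) + D (k0 - w)"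
      using linear_add[OF has_derivative_linear[OF D], of "k - k0" "k0 - w"] by simp
    ultimately show ?thesis using eb[OF k k0(1)] far[OF k0(1)] by linarith
  qed
  then show thesis
    using that[of "\<delta> / 2" "Blinfun D"] \<delta> closure_subset[of C] bl
    by (auto simp: bounded_linear_Blinfun_apply)
qed

end

text \<open>The last point at which the inequality with slope \<open>K'\<close> holds can be pushed
  to the right by the Dini bound unless it is \<open>b\<close>. Only right increments enter, which
  is the information that a pseudo-Jacobian gives; the excess \<open>K' - K\<close> is removed at
  the end.\<close>

lemma dini_mvt:
  fixes \<phi> :: "real \<Rightarrow> real"
  assumes ab: "a \<le> b" and cont: "continuous_on {a..b} \<phi>"
    and dini: "\<And>s K'. a \<le> s \<Longrightarrow> s < b \<Longrightarrow> K < K' \<Longrightarrow> \<forall>\<^sub>F t in at_right 0. \<phi> (s + t) - \<phi> s \<le> K' * t"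
  shows "\<phi> b - \<phi> a \<le> K * (b - a)"
proof -
  have main: "\<phi> b - \<phi> a \<le> K' * (b - a)" if "K < K'" for K'
  proof (rule ccontr)
    assume neg: "\<not> ?thesis"
    let ?S = "{s \<in> {a..b}. \<phi> s - \<phi> a \<le> K' * (s - a)}"
    have "closed ({a..b} \<inter> (\<lambda>s. \<phi> s - \<phi> a - K' * (s - a)) -` {..0})"
      by (intro continuous_closed_preimage) (auto intro!: continuous_intros cont)
    moreover have "?S = {a..b} \<inter> (\<lambda>s. \<phi> s - \<phi> a - K' * (s - a)) -` {..0}" by auto
    ultimately have "closed ?S" by simp
    then have "compact ?S"
      by (metis (no_types, lifting) bounded_closed_interval bounded_subset compact_eq_bounded_closed mem_Collect_eq subsetI)
    moreover have "a \<in> ?S" using ab by simp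
    ultimately obtain s where s: "s \<in> ?S" "\<And>r. r \<in> ?S \<Longrightarrow> r \<le> s"
      using compact_attains_sup[of ?S] by blast
    have "s < b" using s(1) neg by (cases "s = b") auto
    with dini[of s K'] that s(1) obtain d where d: "d > 0" "\<And>t. 0 < t \<Longrightarrow> t < d \<Longrightarrow> \<phi> (s + t) - \<phi> s \<le> K' * t"
      by (auto simp: eventually_at_right_field)
    define t where "t = min (d / 2) (b - s)"
    have t: "0 < t" "t < d" "s + t \<le> b" using d \<open>s < b\<close> by (auto simp: t_def)
    then have "s + t \<in> ?S" using s(1) d(2)[of t] by (auto simp: algebra_simps)
    from s(2)[OF this] t show False by simp
  qed
  show ?thesis
  proof (rule field_le_epsilon)
    fix e :: real assume e: "e > 0"
    show "\<phi> b - \<phi> a \<le> K * (b - a) + e"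
    proof (cases "a = b")
      case False
      then have "b - a > 0" using ab by simp
      moreover from this have "(K + e / (b - a)) * (b - a) = K * (b - a) + e" by (simp add: distrib_right)
      ultimately show ?thesis using main[of "K + e / (b - a)"] e by simp
    qed (use e in simp)
  qed
qed

subsection \<open>Pseudo-Jacobians in Banach spaces\<close>

text \<open>The strict gap between \<open>K\<close> and \<open>K'\<close> turns the limit superior
  into an inequality for all small \<open>t\<close>, in the form that \<open>dini_mvt\<close>
  consumes.\<close>

lemma pseudo_jacobian_dini:
  fixes y :: "'b::banach \<Rightarrow>\<^sub>L real" and g :: "'a::banach \<Rightarrow> 'b"
  assumes pj: "pseudo_jacobian_at g x J" and b: "\<And>T. T \<in> J \<Longrightarrow> y (blinfun_apply T v) \<le> K" and K: "K < K'"
  shows "\<forall>\<^sub>F t in at_right 0. y (g (x + t *\<^sub>R v)) - y (g x) \<le> K' * t"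
proof -
  have "Limsup (at_right 0) (\<lambda>t. ereal ((y (g (x + t *\<^sub>R v)) - y (g x)) / t))
      \<le> (SUP T\<in>J. ereal (y (blinfun_apply T v)))"
    using pj by (simp add: pseudo_jacobian_at_def)
  also have "\<dots> \<le> ereal K" using b by (intro SUP_least) simp
  also have "\<dots> < ereal K'" using K by simp
  finally have ev: "\<forall>\<^sub>F t in at_right 0. ereal ((y (g (x + t *\<^sub>R v)) - y (g x)) / t) < ereal K'"
    by (rule Limsup_lessD)
  have "\<forall>\<^sub>F t in at_right (0::real). 0 < t" by (rule eventually_at_right_less)
  with ev show ?thesis
  proof eventually_elim
    case (elim t)
    then show ?case by (simp add: pos_divide_less_eq)
  qed
qed

text \<open>A functional separating the increment from \<open>C\<close> would make every right
  derivative along the segment smaller than the increment by a fixed amount, against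
  \<open>dini_mvt\<close>. The set \<open>C\<close> is left free: it is a set of values of the hull
  in one use and a norm ball in another.\<close>

lemma mvt_closure:
  fixes g :: "'a::banach \<Rightarrow> 'b::banach" and q :: "'b \<Rightarrow> real"
  assumes q: "equiv_norm q" and smooth: "\<forall>v. v \<noteq> 0 \<longrightarrow> q differentiable (at v)"
    and cont: "continuous_on {0..1} (\<lambda>s. g (u + s *\<^sub>R h))"
    and pj: "\<And>s. 0 \<le> s \<Longrightarrow> s < 1 \<Longrightarrow> pseudo_jacobian_at g (u + s *\<^sub>R h) (J s)"
    and C: "convex C" "bounded C"
    and JC: "\<And>s T. 0 \<le> s \<Longrightarrow> s < 1 \<Longrightarrow> T \<in> J s \<Longrightarrow> blinfun_apply T h \<in> C"
  shows "g (u + h) - g u \<in> closure C"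
proof (rule ccontr)
  let ?w = "g (u + h) - g u"
  assume "?w \<notin> closure C"
  moreover obtain T where "T \<in> J 0" using pj[of 0] by (auto simp: pseudo_jacobian_at_def)
  then have "C \<noteq> {}" using JC[of 0] by auto
  ultimately obtain y :: "'b \<Rightarrow>\<^sub>L real" and \<delta>
    where y: "\<delta> > 0" "\<And>k. k \<in> C \<Longrightarrow> \<delta> \<le> y (k - ?w)"
    using equiv_norm.separation[OF q smooth C] by metis
  \<comment> \<open>\<open>separation\<close> bounds from below, while the pseudo-Jacobian
    inequality bounds from above; hence the sign.\<close>
  define y' where "y' = - y"
  have y': "y' (blinfun_apply T h) \<le> y' ?w - \<delta>" if "0 \<le> s" "s < 1" "T \<in> J s" for s T
    using y(2)[OF JC[OF that]] by (simp add: y'_def blinfun.bilinear_simps)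
  let ?\<phi> = "\<lambda>s. y' (g (u + s *\<^sub>R h))"
  have "?\<phi> 1 - ?\<phi> 0 \<le> (y' ?w - \<delta>) * (1 - 0)"
  proof (rule dini_mvt)
    show "continuous_on {0..1} ?\<phi>" by (intro continuous_intros cont)
    fix s K' :: real
    assume s: "0 \<le> s" "s < 1" and K': "y' ?w - \<delta> < K'"
    have "u + (s + t) *\<^sub>R h = (u + s *\<^sub>R h) + t *\<^sub>R h" for t by (simp add: algebra_simps)
    then show "\<forall>\<^sub>F t in at_right 0. ?\<phi> (s + t) - ?\<phi> s \<le> K' * t"
      using pseudo_jacobian_dini[OF pj[OF s] y'[OF s] K'] by (simp only:)
  qed simp
  then show False using y(1) by (simp add: blinfun.bilinear_simps)
qed

text \<open>From an Ekeland point of \<open>q (g u - z)\<close>, this function decreases by at most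
  \<open>e\<close> per unit of \<open>p\<close>-length. If \<open>g u \<noteq> z\<close>, the
  derivative of \<open>q\<close> at \<open>g u - z\<close> is a functional to which
  \<open>descent\<close> applies, and it gives a decrease at rate \<open>c > e\<close>.\<close>

lemma ekeland_open_step:
  fixes g :: "'a::banach \<Rightarrow> 'b::banach"
  assumes p: "equiv_norm p" and q: "equiv_norm q"
    and smooth: "\<forall>v. v \<noteq> 0 \<longrightarrow> q differentiable (at v)"
    and cont: "continuous_on {u. p (u - a) \<le> r} g"
    and lip: "\<And>u v. p (u - a) < r \<Longrightarrow> \<exists>L. \<forall>\<^sub>F t in at_right 0. norm (g (u + t *\<^sub>R v) - g u) \<le> L * t"
    and descent: "\<And>u (y :: 'b \<Rightarrow>\<^sub>L real). p (u - a) < r \<Longrightarrow> (\<And>w. \<bar>y w\<bar> \<le> q w) \<Longrightarrow> (\<exists>w. w \<noteq> 0 \<and> y w = q w)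
        \<Longrightarrow> \<exists>v. p v \<le> 1 \<and> (\<forall>\<^sub>F t in at_right 0. y (g (u + t *\<^sub>R v)) - y (g u) \<le> - c * t)"
    and c: "0 < c" and r: "0 < r" and z: "q (z - g a) < c * r"
  obtains u where "p (u - a) < r" "g u = z"
proof -
  interpret p: equiv_norm p by (rule p)
  interpret q: equiv_norm q by (rule q)
  let ?S = "{u. p (u - a) \<le> r}"
  \<comment> \<open>The lower bound on \<open>e\<close> will keep \<open>u\<close> strictly inside
    the ball, where \<open>descent\<close> is available; the upper bound leaves the gap
    \<open>c - e\<close>.\<close>
  have "q (z - g a) / r < c" using z r by (simp add: pos_divide_less_eq)
  moreover have "0 \<le> q (z - g a) / r" using r by simp
  ultimately obtain e where e: "q (z - g a) / r < e" "e < c" "0 < e"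
    using dense by (metis le_less_trans)
  have er: "q (g a - z) < e * r" using e(1) r q.minus_commute[of z "g a"] by (simp add: pos_divide_less_eq)
  have "continuous_on ?S (\<lambda>u. q (g u - z))"
    by (intro continuous_on_compose2[OF q.continuous[of UNIV]] continuous_intros cont) auto
  then obtain u where u: "u \<in> ?S" "q (g u - z) + e * p (u - a) \<le> q (g a - z)"
    "\<And>w. w \<in> ?S \<Longrightarrow> w \<noteq> u \<Longrightarrow> q (g u - z) < q (g w - z) + e * p (w - u)"
    using p.ekeland[OF p.closed_cball, of a a r "\<lambda>u. q (g u - z)" e] r e(3) by auto
  have "e * p (u - a) < e * r" using u(2) er q.nonneg[of "g u - z"] by linarith
  then have pu: "p (u - a) < r" using e(3) by simp
  show thesis
  proof (cases "g u = z")
    case True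
    then show ?thesis using that pu by blast
  next
    case False
    define w where "w = g u - z"
    have w: "w \<noteq> 0" using False by (simp add: w_def)
    then obtain D where D: "(q has_derivative D) (at w)"
      using smooth unfolding differentiable_def by blast
    have bl: "bounded_linear D" using D has_derivative_bounded_linear by blast
    define y where "y = Blinfun D"
    have yD: "blinfun_apply y = D" using bl by (simp add: y_def bounded_linear_Blinfun_apply)
    obtain v where v: "p v \<le> 1" "\<forall>\<^sub>F t in at_right 0. y (g (u + t *\<^sub>R v)) - y (g u) \<le> - c * t"
      using descent[OF pu, of y] w q.deriv_le[OF D] q.deriv_self[OF D] yD by auto
    obtain L0 where "\<forall>\<^sub>F t in at_right 0. norm (g (u + t *\<^sub>R v) - g u) \<le> L0 * t"
      using lip[OF pu] by blast
    define L where "L = max L0 1"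
    have L: "L > 0" "L0 \<le> L" by (auto simp: L_def)
    \<comment> \<open>With \<open>norm \<Delta> \<le> L * t\<close>, this tolerance makes the error
      of linearizing \<open>q\<close> at most half of \<open>(c - e) * t\<close>.\<close>
    define k where "k = (c - e) / (2 * L)"
    have k: "k > 0" using e L by (simp add: k_def)
    obtain d where d: "d > 0" "\<And>w'. norm (w' - w) < d \<Longrightarrow> norm (q w' - q w - D (w' - w)) \<le> k * norm (w' - w)"
      using D k unfolding has_derivative_at_alt by blast
    have "\<forall>\<^sub>F t in at_right 0. t < min (d / L) (r - p (u - a))"
      using d L pu by (intro eventually_at_rightI[of _ "min (d / L) (r - p (u - a))"]) auto
    with v(2) \<open>\<forall>\<^sub>F t in at_right 0. norm (g (u + t *\<^sub>R v) - g u) \<le> L0 * t\<close>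
      eventually_at_right_less[of "0::real"]
    have "\<forall>\<^sub>F t in at_right (0::real). False"
    proof eventually_elim
      case (elim t)
      define \<Delta> where "\<Delta> = g (u + t *\<^sub>R v) - g u"
      have "L0 * t \<le> L * t" using L elim by (intro mult_right_mono) auto
      then have \<Delta>1: "norm \<Delta> \<le> L * t" using elim unfolding \<Delta>_def by linarith
      have "L * t < d" using elim L by (simp add: pos_less_divide_eq mult.commute)
      then have "norm (q (w + \<Delta>) - q w - D \<Delta>) \<le> k * norm \<Delta>"
        using d(2)[of "w + \<Delta>"] \<Delta>1 by simp
      also have "\<dots> \<le> k * (L * t)" using \<Delta>1 k by (intro mult_left_mono) auto
      also have "\<dots> = (c - e) / 2 * t" using L by (simp add: k_def)
      finally have "q (w + \<Delta>) \<le> q w + D \<Delta> + (c - e) / 2 * t" unfolding real_norm_def by linarith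
      moreover have D\<Delta>: "D \<Delta> \<le> - c * t" using elim by (simp add: \<Delta>_def blinfun.bilinear_simps flip: yD)
      ultimately have "q (w + \<Delta>) \<le> q w + (- c * t) + (c - e) / 2 * t" by linarith
      also have "\<dots> = q w - e * t - (c - e) / 2 * t" by (simp add: field_simps)
      also have "\<dots> < q w - e * t" using e elim by simp
      finally have lt: "q (w + \<Delta>) < q w - e * t" .
      have ptv: "p (t *\<^sub>R v) \<le> t" using v(1) elim mult_left_mono[of "p v" 1 t] by (simp add: p.scale)
      have "p (u + t *\<^sub>R v - a) \<le> p (u - a) + p (t *\<^sub>R v)"
        using p.triangle[of "u - a" "t *\<^sub>R v"] by (simp add: algebra_simps)
      then have inS: "u + t *\<^sub>R v \<in> ?S" using ptv elim by simp
      \<comment> \<open>Ekeland's strict inequality excludes the point \<open>u\<close> itself; if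
        the step does not move, then \<open>\<Delta> = 0\<close>, which already contradicts a
        descent of \<open>c * t\<close>.\<close>
      show False
      proof (cases "u + t *\<^sub>R v = u")
        case True
        then have "\<Delta> = 0" unfolding \<Delta>_def by (simp only: diff_self)
        then have "D \<Delta> = 0" using linear_0[OF bounded_linear.linear[OF bl]] by simp
        then show False using D\<Delta> c elim mult_pos_pos[of c t] by linarith
      next
        case False
        have "q w < q (w + \<Delta>) + e * p (t *\<^sub>R v)"
          using u(3)[OF inS False] by (simp add: w_def \<Delta>_def)
        moreover have "e * p (t *\<^sub>R v) \<le> e * t" using ptv e by (intro mult_left_mono) auto
        ultimately show False using lt by linarith
      qed
    qed
    then show ?thesis by simp
  qed
qed

section \<open>Minimax in the weak operator topology\<close>

lemma wot_continuous:
  fixes y :: "'b::banach \<Rightarrow>\<^sub>L real" and v :: "'a::banach"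
  shows "continuous_map weak_operator_topology euclideanreal (\<lambda>T. y (blinfun_apply T v))"
proof -
  have "continuous_map euclidean euclideanreal (\<lambda>F. F (y, v) :: real)"
    by simp
  from continuous_map_pullback[OF this, of UNIV "\<lambda>T (y :: 'b \<Rightarrow>\<^sub>L real, v). y (blinfun_apply T v)"]
  show ?thesis by (simp add: weak_operator_topology_def o_def)
qed

text \<open>Changes of charts act on representing operators in this way, so weak compactness
  survives them.\<close>

lemma wot_continuous_compose:
  fixes D1 :: "'a::banach \<Rightarrow>\<^sub>L 'c::banach" and D2 :: "'d::banach \<Rightarrow>\<^sub>L 'b::banach"
  shows "continuous_map weak_operator_topology weak_operator_topology (\<lambda>T. D2 o\<^sub>L T o\<^sub>L D1)"
proof -
  let ?ev = "\<lambda>T (y :: 'd \<Rightarrow>\<^sub>L real, v :: 'c). y (blinfun_apply T v)"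
  let ?k = "\<lambda>F (y :: 'b \<Rightarrow>\<^sub>L real, v). F (y o\<^sub>L D2, blinfun_apply D1 v) :: real"
  have "continuous_on UNIV ?k"
    by (rule continuous_on_coordinatewise_then_product) (auto simp: split_beta)
  then have "continuous_map euclidean euclidean ?k" by simp
  from continuous_map_pullback[OF this, of UNIV ?ev]
  have "continuous_map weak_operator_topology euclidean (?k \<circ> ?ev)"
    by (simp add: weak_operator_topology_def)
  moreover have "?k \<circ> ?ev = (\<lambda>T (y :: 'b \<Rightarrow>\<^sub>L real, v). y (blinfun_apply T v)) \<circ> (\<lambda>T. D2 o\<^sub>L T o\<^sub>L D1)"
    by (auto simp: fun_eq_iff)
  ultimately show ?thesis
    using continuous_map_pullback'[of weak_operator_topology euclidean
        "\<lambda>T (y :: 'b \<Rightarrow>\<^sub>L real, v :: 'a). y (blinfun_apply T v)" "\<lambda>T. D2 o\<^sub>L T o\<^sub>L D1" UNIV]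
    by (simp add: weak_operator_topology_def)
qed

lemma topspace_wot [simp]: "topspace weak_operator_topology = UNIV"
  by (simp add: weak_operator_topology_def topspace_pullback_topology)

lemma wot_closed_halfspace:
  fixes y :: "'b::banach \<Rightarrow>\<^sub>L real" and v :: "'a::banach"
  shows "closedin weak_operator_topology {T. k \<le> y (blinfun_apply T v)}"
  using closedin_continuous_map_preimage[OF wot_continuous, of "{k..}" y v] by simp

text \<open>The pairs \<open>(y (T v), y (T w))\<close> form a compact convex set in the plane. If
  it misses the quadrant, the normal of a separating line has nonnegative entries; normalized to sum
  1, they are the weights of a convex combination of \<open>v\<close> and \<open>w\<close> at which
  the hypothesis fails.\<close>

lemma wot_minimax_two:
  fixes J :: "('a::banach \<Rightarrow>\<^sub>L 'b::banach) set" and y :: "'b \<Rightarrow>\<^sub>L real"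
  assumes J: "convex J" "compactin weak_operator_topology J"
    and ex: "\<And>s. 0 \<le> s \<Longrightarrow> s \<le> 1 \<Longrightarrow> \<exists>T\<in>J. k \<le> y (blinfun_apply T (s *\<^sub>R v + (1 - s) *\<^sub>R w))"
  shows "\<exists>T\<in>J. k \<le> y (blinfun_apply T v) \<and> k \<le> y (blinfun_apply T w)"
proof (rule ccontr)
  assume neg: "\<not> ?thesis"
  let ?h = "\<lambda>T. (y (blinfun_apply T v), y (blinfun_apply T w))"
  let ?K = "?h ` J" and ?Q = "{k..} \<times> {k..}"
  have "linear ?h" by (rule linearI) (auto simp: blinfun.bilinear_simps)
  then have "convex ?K" using J(1) convex_linear_image by blast
  moreover have "compact ?K"
  proof -
    have "continuous_map weak_operator_topology (prod_topology euclideanreal euclideanreal) ?h"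
      by (intro continuous_map_pairedI wot_continuous)
    then show ?thesis using image_compactin[OF J(2)] by fastforce
  qed
  moreover have "?K \<noteq> {}" using ex[of 0] by auto
  moreover have "convex ?Q" by (intro convex_Times convex_real_interval)
  moreover have "closed ?Q" by (intro closed_Times) auto
  moreover have "?K \<inter> ?Q = {}" using neg by auto
  ultimately obtain a b where ab: "\<And>x. x \<in> ?K \<Longrightarrow> inner a x < b" "\<And>x. x \<in> ?Q \<Longrightarrow> b < inner a x"
    using separating_hyperplane_compact_closed[of ?K ?Q] by blast
  obtain a1 a2 where a: "a = (a1, a2)" by (cases a)
  have Q: "b < a1 * s + a2 * t" if "k \<le> s" "k \<le> t" for s t
    using ab(2)[of "(s, t)"] that by (simp add: a inner_prod_def)
  \<comment> \<open>A linear function bounded below on a half-line has nonnegative slope; for a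
    negative one the witness below would give \<open>B < - \<bar>B\<bar>\<close>.\<close>
  have sgn: "0 \<le> x" if "\<And>n. 0 \<le> n \<Longrightarrow> B < x * n" for x B :: real
  proof (rule ccontr)
    assume "\<not> 0 \<le> x"
    then have "- x > 0" by simp
    then have "x * (\<bar>B\<bar> / (- x)) = - \<bar>B\<bar>" "0 \<le> \<bar>B\<bar> / (- x)"
      by (simp, intro divide_nonneg_pos) auto
    with that[of "\<bar>B\<bar> / (- x)"] have "B < - \<bar>B\<bar>" by simp
    then show False by simp
  qed
  have a1: "0 \<le> a1"
    using Q[of "k + n" k for n] by (intro sgn[of "b - a1 * k - a2 * k"]) (auto simp: algebra_simps)
  have a2: "0 \<le> a2"
    using Q[of k "k + n" for n] by (intro sgn[of "b - a1 * k - a2 * k"]) (auto simp: algebra_simps)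
  have "a1 + a2 \<noteq> 0"
  proof
    assume "a1 + a2 = 0"
    then have "a1 = 0" "a2 = 0" using a1 a2 by linarith+
    then show False using Q[of k k] ab(1) \<open>?K \<noteq> {}\<close> by (force simp: a inner_prod_def)
  qed
  then have pos: "a1 + a2 > 0" using a1 a2 by linarith
  define s where "s = a1 / (a1 + a2)"
  have s: "0 \<le> s" "s \<le> 1" using a1 a2 pos by (auto simp: s_def)
  have sa: "(a1 + a2) * s = a1" "(a1 + a2) * (1 - s) = a2"
    using pos by (auto simp: s_def right_diff_distrib)
  obtain T where T: "T \<in> J" "k \<le> y (blinfun_apply T (s *\<^sub>R v + (1 - s) *\<^sub>R w))" using ex[OF s] by blast
  then have "(a1 + a2) * k \<le> (a1 + a2) * (s * y (blinfun_apply T v) + (1 - s) * y (blinfun_apply T w))"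
    using pos by (intro mult_left_mono) (auto simp: blinfun.bilinear_simps)
  also have "\<dots> = ((a1 + a2) * s) * y (blinfun_apply T v) + ((a1 + a2) * (1 - s)) * y (blinfun_apply T w)"
    by (simp add: distrib_left)
  also have "\<dots> = a1 * y (blinfun_apply T v) + a2 * y (blinfun_apply T w)" by (simp only: sa)
  also have "\<dots> < b" using ab(1)[of "?h T"] T(1) by (simp add: a inner_prod_def)
  finally show False using Q[of k k] by (simp add: distrib_right)
qed

text \<open>Each step cuts \<open>J\<close> by one half-space. The two-point case, applied to the
  new vector and an arbitrary \<open>w\<close>, shows that the hypothesis on \<open>V\<close>
  survives for the smaller set, which is again convex and compact; hence the induction varies
  \<open>J\<close>.\<close>

lemma wot_minimax_finite:
  fixes J :: "('a::banach \<Rightarrow>\<^sub>L 'b::banach) set" and y :: "'b \<Rightarrow>\<^sub>L real"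
  assumes "finite I" "convex J" "compactin weak_operator_topology J" "convex V" "I \<subseteq> V"
    and "\<And>v. v \<in> V \<Longrightarrow> \<exists>T\<in>J. k \<le> y (blinfun_apply T v)" and "J \<noteq> {}"
  shows "\<exists>T\<in>J. \<forall>v\<in>I. k \<le> y (blinfun_apply T v)"
  using assms
proof (induction I arbitrary: J rule: finite_induct)
  case empty
  then show ?case by auto
next
  case (insert v I)
  let ?J = "J \<inter> {T. k \<le> y (blinfun_apply T v)}"
  have "convex {T. k \<le> y (blinfun_apply T v)}"
  proof -
    have "linear (\<lambda>T. y (blinfun_apply T v))" by (rule linearI) (auto simp: blinfun.bilinear_simps)
    then have "convex ((\<lambda>T. y (blinfun_apply T v)) -` {k..})"
      by (rule convex_linear_vimage) (rule convex_real_interval)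
    then show ?thesis by (simp add: vimage_def)
  qed
  then have "convex ?J" using insert.prems(1) by (rule convex_Int[rotated])
  moreover have "compactin weak_operator_topology ?J"
    using compact_Int_closedin[OF insert.prems(2) wot_closed_halfspace] .
  moreover have "\<exists>T\<in>?J. k \<le> y (blinfun_apply T w)" if w: "w \<in> V" for w
  proof -
    have "\<exists>T\<in>J. k \<le> y (blinfun_apply T (s *\<^sub>R v + (1 - s) *\<^sub>R w))" if "0 \<le> s" "s \<le> 1" for s
      using insert.prems(3-5) w that by (intro insert.prems(5)) (auto simp: convex_def)
    from wot_minimax_two[OF insert.prems(1,2) this] show ?thesis by blast
  qed
  moreover have "?J \<noteq> {}" using insert.prems(4,5) by fastforce
  ultimately show ?case using insert.IH[of ?J] insert.prems by auto
qed

text \<open>The finite intersection property passes from finitely many vectors to all. The use is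
  contrapositive: without a direction of descent common to all operators of \<open>J\<close>, a
  single operator would violate \<open>dual_lower_bound\<close>.\<close>

lemma wot_minimax:
  fixes J :: "('a::banach \<Rightarrow>\<^sub>L 'b::banach) set" and y :: "'b \<Rightarrow>\<^sub>L real"
  assumes J: "convex J" "compactin weak_operator_topology J" "J \<noteq> {}" and V: "convex V"
    and ex: "\<And>v. v \<in> V \<Longrightarrow> \<exists>T\<in>J. k \<le> y (blinfun_apply T v)"
  shows "\<exists>T\<in>J. \<forall>v\<in>V. k \<le> y (blinfun_apply T v)"
proof -
  let ?H = "\<lambda>v. {T. k \<le> y (blinfun_apply T v)}"
  have "J \<inter> \<Inter>(?H ` V) \<noteq> {}"
  proof -
    have "J \<inter> \<Inter>F \<noteq> {}" if F: "finite F" "F \<subseteq> ?H ` V" for F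
    proof -
      obtain I where I: "finite I" "I \<subseteq> V" "F = ?H ` I" using finite_subset_image[OF F] by blast
      then show ?thesis using wot_minimax_finite[OF I(1) J(1,2) V I(2) ex J(3)] by blast
    qed
    moreover have "\<forall>C\<in>?H ` V. closedin weak_operator_topology C" using wot_closed_halfspace by blast
    ultimately show ?thesis using J(2) unfolding compactin_fip by blast
  qed
  then show ?thesis by blast
qed

text \<open>
  The adjoint of \<open>T\<close> expands by at least \<open>c\<close> those functionals of norm \<open>1\<close> that attain their norm;
  the derivatives of \<open>q\<close>, to which it is applied, are of this kind.
\<close>

definition dual_lower_bound :: "('a::banach \<Rightarrow> real) \<Rightarrow> ('b::banach \<Rightarrow> real) \<Rightarrow> real \<Rightarrow> ('a \<Rightarrow>\<^sub>L 'b) \<Rightarrow> bool"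
  where "dual_lower_bound p q c T \<longleftrightarrow>
    (\<forall>y :: 'b \<Rightarrow>\<^sub>L real. (\<forall>w. \<bar>y w\<bar> \<le> q w) \<and> (\<exists>w. w \<noteq> 0 \<and> y w = q w) \<longrightarrow>
      (\<forall>c'<c. \<exists>v. p v \<le> 1 \<and> y (blinfun_apply T v) < - c'))"

text \<open>The adjoint bound lets \<open>T\<close> cover the \<open>q\<close>-ball of radius
  \<open>c' * r\<close> by the \<open>p\<close>-ball of radius \<open>r\<close>. If
  \<open>T v\<close> were too small, it would have a preimage \<open>u\<close> with
  \<open>p u < r < p v\<close>, against injectivity.\<close>

lemma inj_lower_bound:
  assumes p: "equiv_norm p" and q: "equiv_norm q"
    and smooth: "\<forall>v. v \<noteq> 0 \<longrightarrow> q differentiable (at v)"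
    and T: "dual_lower_bound p q c T" "inj (blinfun_apply T)"
  shows "c * p v \<le> q (blinfun_apply T v)"
proof -
  interpret p: equiv_norm p by (rule p)
  interpret q: equiv_norm q by (rule q)
  have *: "c' * p v \<le> q (blinfun_apply T v)" if c': "0 < c'" "c' < c" for c'
  proof (rule ccontr)
    assume "\<not> ?thesis"
    then have "q (blinfun_apply T v) / c' < p v" using c' by (simp add: pos_divide_less_eq mult.commute)
    then obtain r where r: "q (blinfun_apply T v) / c' < r" "r < p v" using dense by blast
    have "0 \<le> q (blinfun_apply T v) / c'" using c' by simp
    then have r0: "r > 0" using r by linarith
    show False
    proof (rule ekeland_open_step[OF p q smooth, of 0 r "blinfun_apply T" c' "blinfun_apply T v"])
      show "q (blinfun_apply T v - blinfun_apply T 0) < c' * r"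
        using r(1) c' by (simp add: pos_divide_less_eq mult.commute blinfun.bilinear_simps)
      show "\<exists>L. \<forall>\<^sub>F t in at_right 0. norm (blinfun_apply T (u + t *\<^sub>R v) - blinfun_apply T u) \<le> L * t"
        for u v
        by (intro exI[of _ "norm (blinfun_apply T v)"] eventually_at_rightI[of _ 1])
          (auto simp: blinfun.bilinear_simps)
      show "\<exists>v. p v \<le> 1 \<and> (\<forall>\<^sub>F t in at_right 0.
          y (blinfun_apply T (u + t *\<^sub>R v)) - y (blinfun_apply T u) \<le> - c' * t)"
        if y: "\<And>w. \<bar>blinfun_apply y w\<bar> \<le> q w" "\<exists>w. w \<noteq> 0 \<and> y w = q w" for y u
      proof -
        obtain v where v: "p v \<le> 1" "y (blinfun_apply T v) < - c'"
          using T(1) y c'(2) unfolding dual_lower_bound_def by blast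
        have "t * y (blinfun_apply T v) \<le> - (c' * t)" if "t > 0" for t
          using v(2) that mult_left_mono[of "y (blinfun_apply T v)" "- c'" t] by (simp add: mult.commute)
        then show ?thesis
          using v(1) by (intro exI[of _ v] conjI eventually_at_rightI[of _ 1])
            (auto simp: blinfun.bilinear_simps)
      qed
      show "continuous_on {u. p (u - 0) \<le> r} (blinfun_apply T)" by (intro continuous_intros)
      show False if "p (u - 0) < r" "blinfun_apply T u = blinfun_apply T v" for u
        using that T(2) r(2) by (auto dest: injD)
    qed (use c' r0 in auto)
  qed
  show ?thesis
  proof (cases "c \<le> 0")
    case True
    then have "c * p v \<le> 0" by (simp add: mult_le_0_iff)
    then show ?thesis using q.nonneg order_trans by blast
  next
    case False
    show ?thesis
    proof (rule tendsto_upperbound)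
      show "((\<lambda>c'. c' * p v) \<longlongrightarrow> c * p v) (at_left c)" by (intro tendsto_intros)
      show "\<forall>\<^sub>F c' in at_left c. c' * p v \<le> q (blinfun_apply T v)"
        using * False by (intro eventually_at_leftI[of 0]) auto
    qed simp
  qed
qed

text \<open>The estimate needs the convex hull, because \<open>mvt\<close> places the increment in
  the closure of the hull applied to \<open>a - b\<close>. Openness instead works with each set
  \<open>J u\<close> separately, where convexity and weak compactness give one direction for all its
  operators.\<close>

lemma local_inverse:
  fixes g :: "'a::banach \<Rightarrow> 'b::banach" and J :: "'a \<Rightarrow> ('a \<Rightarrow>\<^sub>L 'b) set"
  assumes p: "equiv_norm p" and q: "equiv_norm q"
    and smooth: "\<forall>v. v \<noteq> 0 \<longrightarrow> q differentiable (at v)"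
    and U: "open U" "convex U" and cont: "continuous_on U g"
    and pj: "\<And>u. u \<in> U \<Longrightarrow> pseudo_jacobian_at g u (J u)"
    and J: "\<And>u. u \<in> U \<Longrightarrow> convex (J u)" "\<And>u. u \<in> U \<Longrightarrow> compactin weak_operator_topology (J u)"
    and bd: "bounded (\<Union>u\<in>U. J u)" and c: "c > 0"
    and T: "\<And>T. T \<in> convex hull (\<Union>u\<in>U. J u) \<Longrightarrow> dual_lower_bound p q c T \<and> inj (blinfun_apply T)"
  shows "\<forall>a\<in>U. \<forall>b\<in>U. c * p (a - b) \<le> q (g a - g b)" and "\<And>W. open W \<Longrightarrow> W \<subseteq> U \<Longrightarrow> open (g ` W)"
proof -
  interpret p: equiv_norm p by (rule p)
  interpret q: equiv_norm q by (rule q)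
  obtain Bd where Bd: "\<And>T u. u \<in> U \<Longrightarrow> T \<in> J u \<Longrightarrow> norm T \<le> Bd"
    using bd by (force simp: bounded_iff)
  have mvt: "g (u + h) - g u \<in> closure C"
    if u: "u \<in> U" "u + h \<in> U" and C: "convex C" "bounded C"
      and JC: "\<And>T. T \<in> (\<Union>u\<in>U. J u) \<Longrightarrow> blinfun_apply T h \<in> C" for u h C
  proof -
    have seg: "u + s *\<^sub>R h \<in> U" if "0 \<le> s" "s \<le> 1" for s
    proof -
      have "u + s *\<^sub>R h = (1 - s) *\<^sub>R u + s *\<^sub>R (u + h)" by (simp add: algebra_simps)
      then show ?thesis using U(2) u that by (auto simp: convex_def)
    qed
    show ?thesis
    proof (rule mvt_closure[OF q smooth])
      show "continuous_on {0..1} (\<lambda>s. g (u + s *\<^sub>R h))"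
        using seg by (intro continuous_on_compose2[OF cont] continuous_intros) auto
      show "pseudo_jacobian_at g (u + s *\<^sub>R h) (J (u + s *\<^sub>R h))" if "0 \<le> s" "s < 1" for s
        using pj seg that by simp
      show "blinfun_apply T h \<in> C" if "0 \<le> s" "s < 1" "T \<in> J (u + s *\<^sub>R h)" for s T
        using JC seg that by fastforce
    qed (use C in auto)
  qed
  show "\<forall>a\<in>U. \<forall>b\<in>U. c * p (a - b) \<le> q (g a - g b)"
  proof (intro ballI)
    fix a b assume ab: "a \<in> U" "b \<in> U"
    define h where "h = a - b"
    let ?C = "(\<lambda>T. blinfun_apply T h) ` (convex hull (\<Union>u\<in>U. J u))"
    have lin: "linear (\<lambda>T. blinfun_apply T h)" by (rule linearI) (auto simp: blinfun.bilinear_simps)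
    have "g (b + h) - g b \<in> closure ?C"
    proof (rule mvt)
      show "convex ?C" using lin by (rule convex_linear_image) (rule convex_convex_hull)
      have "bounded (convex hull (\<Union>u\<in>U. J u))" using bd by (rule bounded_convex_hull)
      then show "bounded ?C"
        by (rule bounded_linear_image) (rule blinfun.bounded_linear_left)
    qed (use ab in \<open>auto simp: h_def intro: hull_inc\<close>)
    moreover have "closure ?C \<subseteq> {z. c * p h \<le> q z}"
    proof (rule closure_minimal)
      show "?C \<subseteq> {z. c * p h \<le> q z}" using inj_lower_bound[OF p q smooth] T by blast
      show "closed {z. c * p h \<le> q z}" by (intro closed_Collect_le continuous_on_const q.continuous)
    qed
    ultimately show "c * p (a - b) \<le> q (g a - g b)" by (auto simp: h_def)
  qed
  show "open (g ` W)" if W: "open W" "W \<subseteq> U" for W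
  proof (subst open_subopen, intro ballI)
    fix z0 assume "z0 \<in> g ` W"
    then obtain a where a: "a \<in> W" "z0 = g a" by blast
    obtain r where r: "r > 0" "{u. p (u - a) \<le> r} \<subseteq> W" using p.ball_subset[OF W(1) a(1)] .
    have "\<exists>u\<in>W. g u = z" if z: "q (z - g a) < c / 2 * r" for z
    proof -
      \<comment> \<open>Taking a norm ball for \<open>C\<close> in \<open>mvt\<close> yields the
        Lipschitz estimate along rays.\<close>
      have lip: "\<exists>L. \<forall>\<^sub>F t in at_right 0. norm (g (u + t *\<^sub>R v) - g u) \<le> L * t" if u: "u \<in> U" for u v
      proof -
        have "((\<lambda>t. u + t *\<^sub>R v) \<longlongrightarrow> u + 0 *\<^sub>R v) (at_right 0)" by (intro tendsto_intros)
        then have "\<forall>\<^sub>F t in at_right 0. u + t *\<^sub>R v \<in> U" using U(1) u topological_tendstoD by fastforce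
        with eventually_at_right_less[of "0::real"]
        have "\<forall>\<^sub>F t in at_right 0. norm (g (u + t *\<^sub>R v) - g u) \<le> (Bd * norm v) * t"
        proof eventually_elim
          case (elim t)
          have "g (u + t *\<^sub>R v) - g u \<in> closure (cball 0 (Bd * norm v * t))"
          proof (rule mvt[OF u])
            fix T assume "T \<in> (\<Union>u\<in>U. J u)"
            then have "norm T \<le> Bd" using Bd by blast
            then have "norm T * norm (t *\<^sub>R v) \<le> Bd * norm (t *\<^sub>R v)" by (intro mult_right_mono) auto
            then show "blinfun_apply T (t *\<^sub>R v) \<in> cball 0 (Bd * norm v * t)"
              using order_trans[OF norm_blinfun[of T "t *\<^sub>R v"]] elim by (simp add: algebra_simps)
          qed (use elim in auto)
          then show ?case by simp
        qed
        then show ?thesis by blast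
      qed
      have descent: "\<exists>v. p v \<le> 1 \<and> (\<forall>\<^sub>F t in at_right 0. y (g (u + t *\<^sub>R v)) - y (g u) \<le> - (c / 2) * t)"
        if u: "u \<in> U" and y: "\<And>w. \<bar>blinfun_apply y w\<bar> \<le> q w" "\<exists>w. w \<noteq> 0 \<and> y w = q w" for u y
      proof -
        \<comment> \<open>A value strictly between \<open>c / 2\<close> and \<open>c\<close>: one
          gap is spent on \<open>dual_lower_bound\<close>, the other on the Dini inequality.\<close>
        define k where "k = 3 / 4 * c"
        have k: "k < c" "- k < - (c / 2)" using c by (auto simp: k_def)
        have "\<exists>v. p v \<le> 1 \<and> (\<forall>T\<in>J u. y (blinfun_apply T v) \<le> - k)"
        proof (rule ccontr)
          assume neg: "\<not> ?thesis"
          \<comment> \<open>Convexity of the closed ball is inherited from the open balls of larger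
            radius.\<close>
          have "{v. p v \<le> 1} = (\<Inter>e\<in>{1<..}. {v. p (v - 0) < e})"
            by (auto intro: dense_ge less_imp_le)
          then have "convex {v. p v \<le> 1}" by (simp only: convex_INT p.convex_ball)
          moreover have "J u \<noteq> {}" using pj[OF u] by (simp add: pseudo_jacobian_at_def)
          ultimately have "\<exists>T\<in>J u. \<forall>v\<in>{v. p v \<le> 1}. - k \<le> y (blinfun_apply T v)"
            using neg by (intro wot_minimax J u) force+
          then obtain T0 where T0: "T0 \<in> J u" "\<And>v. p v \<le> 1 \<Longrightarrow> - k \<le> y (blinfun_apply T0 v)" by blast
          have "dual_lower_bound p q c T0" using T T0(1) u by (blast intro: hull_inc)
          then obtain v where "p v \<le> 1" "y (blinfun_apply T0 v) < - k"
            using k(1) y unfolding dual_lower_bound_def by blast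
          then show False using T0(2)[of v] by simp
        qed
        then obtain v where "p v \<le> 1" "\<And>T. T \<in> J u \<Longrightarrow> y (blinfun_apply T v) \<le> - k" by blast
        then show ?thesis using pseudo_jacobian_dini[OF pj[OF u] _ k(2)] by blast
      qed
      have sub: "{u. p (u - a) \<le> r} \<subseteq> U" using r W by blast
      show ?thesis
      proof (rule ekeland_open_step[OF p q smooth, of a r g "c / 2" z])
        show "continuous_on {u. p (u - a) \<le> r} g" using cont sub by (rule continuous_on_subset)
        show "\<exists>L. \<forall>\<^sub>F t in at_right 0. norm (g (u + t *\<^sub>R v) - g u) \<le> L * t" if "p (u - a) < r" for u v
          using lip sub that by force
        show "\<exists>v. p v \<le> 1 \<and> (\<forall>\<^sub>F t in at_right 0. y (g (u + t *\<^sub>R v)) - y (g u) \<le> - (c / 2) * t)"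
          if "p (u - a) < r" "\<And>w. \<bar>blinfun_apply y w\<bar> \<le> q w" "\<exists>w. w \<noteq> 0 \<and> y w = q w" for u y
          using that sub by (intro descent) auto
        show "\<exists>u\<in>W. g u = z" if "p (u - a) < r" "g u = z" for u
          using that r(2) by force
      qed (use c r z in auto)
    qed
    then have "{z. q (z - g a) < c / 2 * r} \<subseteq> g ` W" by blast
    moreover have "open {z. q (z - g a) < c / 2 * r}" by (rule q.open_ball)
    moreover have "z0 \<in> {z. q (z - g a) < c / 2 * r}" using a c r by simp
    ultimately show "\<exists>T. open T \<and> z0 \<in> T \<and> T \<subseteq> g ` W" by blast
  qed
qed

subsection \<open>Charts, tangent spaces and paths\<close>

locale C1_mfd =
  fixes A :: "('x::t2_space, 'e::banach) chart set"
  assumes C1_mfd: "C1_manifold A"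
begin

lemma chart: "c \<in> A \<Longrightarrow> is_chart c"
  using C1_mfd by (simp add: C1_manifold_def)

lemma open_domain: "c \<in> A \<Longrightarrow> open (fst c)"
  and open_range: "c \<in> A \<Longrightarrow> open (snd c ` fst c)"
  using chart unfolding is_chart_def by blast+

lemma exists_chart: "\<exists>c. c \<in> charts_at A x"
proof -
  have "(\<Union>c\<in>A. fst c) = UNIV" using C1_mfd by (simp add: C1_manifold_def)
  then show ?thesis unfolding charts_at_def by blast
qed

lemma charts_atD: "c \<in> charts_at A x \<Longrightarrow> c \<in> A" "c \<in> charts_at A x \<Longrightarrow> x \<in> fst c"
  and charts_atI: "c \<in> A \<Longrightarrow> x \<in> fst c \<Longrightarrow> c \<in> charts_at A x"
  by (auto simp: charts_at_def)

lemma chart_homeomorphism: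
  assumes "c \<in> A"
  shows "homeomorphism (fst c) (snd c ` fst c) (snd c) (chart_inv c)"
proof -
  obtain g where g: "homeomorphism (fst c) (snd c ` fst c) (snd c) g"
    using chart[OF assms] unfolding is_chart_def by blast
  then have inj: "inj_on (snd c) (fst c)"
    by (intro inj_on_inverseI[of _ g]) (rule homeomorphism_apply1)
  have "chart_inv c z = g z" if "z \<in> snd c ` fst c" for z
  proof -
    obtain x where "x \<in> fst c" "z = snd c x" using \<open>z \<in> snd c ` fst c\<close> by blast
    then show ?thesis using inj g by (simp add: chart_inv_def homeomorphism_apply1)
  qed
  then show ?thesis by (rule homeomorphism_cong[OF g refl refl refl])
qed

lemma chart_inv_chart [simp]: "c \<in> A \<Longrightarrow> x \<in> fst c \<Longrightarrow> chart_inv c (snd c x) = x"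
  and chart_chart_inv [simp]: "c \<in> A \<Longrightarrow> z \<in> snd c ` fst c \<Longrightarrow> snd c (chart_inv c z) = z"
  and continuous_chart: "c \<in> A \<Longrightarrow> continuous_on (fst c) (snd c)"
  and continuous_chart_inv: "c \<in> A \<Longrightarrow> continuous_on (snd c ` fst c) (chart_inv c)"
  using chart_homeomorphism unfolding homeomorphism_def by blast+

lemma chart_inv_in: "c \<in> A \<Longrightarrow> z \<in> snd c ` fst c \<Longrightarrow> chart_inv c z \<in> fst c"
  by (elim imageE) simp

lemma chart_inj: "c \<in> A \<Longrightarrow> x \<in> fst c \<Longrightarrow> y \<in> fst c \<Longrightarrow> snd c x = snd c y \<longleftrightarrow> x = y"
  by (metis chart_inv_chart)

lemma open_chart_image:
  assumes "c \<in> A" "open W" "W \<subseteq> fst c"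
  shows "open (snd c ` W)"
proof -
  have "snd c ` W = snd c ` fst c \<inter> chart_inv c -` W"
    using assms by (auto intro: image_eqI[of _ _ "chart_inv c _"])
  then show ?thesis
    using continuous_open_preimage[OF continuous_chart_inv open_range assms(2)] assms(1) by simp
qed

lemma open_chart_preimage:
  assumes "c \<in> A" "open V"
  shows "open {x \<in> fst c. snd c x \<in> V}"
proof -
  have "{x \<in> fst c. snd c x \<in> V} = fst c \<inter> snd c -` V" by auto
  then show ?thesis
    using continuous_open_preimage[OF continuous_chart open_domain assms(2)] assms(1) by simp
qed

lemma transition_C1:
  assumes "c \<in> A" "c' \<in> A"
  obtains g' where "continuous_on (snd c ` (fst c \<inter> fst c')) g'"
    "\<And>x. x \<in> fst c \<Longrightarrow> x \<in> fst c' \<Longrightarrow>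
      (transition c c' has_derivative blinfun_apply (g' (snd c x))) (at (snd c x))"
    "\<And>x. x \<in> fst c \<Longrightarrow> x \<in> fst c' \<Longrightarrow> transition_deriv c c' x = blinfun_apply (g' (snd c x))"
proof -
  have "C1_on (snd c ` (fst c \<inter> fst c')) (transition c c')"
    using C1_mfd assms by (simp add: C1_manifold_def C1_compatible_def)
  then obtain g' where g': "continuous_on (snd c ` (fst c \<inter> fst c')) g'"
    "\<And>z. z \<in> snd c ` (fst c \<inter> fst c') \<Longrightarrow> (transition c c' has_derivative blinfun_apply (g' z)) (at z)"
    by (auto simp: C1_on_def)
  show thesis
  proof (rule that[OF g'(1)])
    fix x assume "x \<in> fst c" "x \<in> fst c'"
    then show *: "(transition c c' has_derivative blinfun_apply (g' (snd c x))) (at (snd c x))"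
      by (intro g'(2)) auto
    show "transition_deriv c c' x = blinfun_apply (g' (snd c x))"
      unfolding transition_deriv_def using frechet_derivative_at[OF *] by simp
  qed
qed

lemma transition_has_derivative:
  assumes "c \<in> charts_at A x" "c' \<in> charts_at A x"
  shows "(transition c c' has_derivative transition_deriv c c' x) (at (snd c x))"
proof -
  obtain g' where "\<And>x. x \<in> fst c \<Longrightarrow> x \<in> fst c' \<Longrightarrow>
      (transition c c' has_derivative blinfun_apply (g' (snd c x))) (at (snd c x))"
    "\<And>x. x \<in> fst c \<Longrightarrow> x \<in> fst c' \<Longrightarrow> transition_deriv c c' x = blinfun_apply (g' (snd c x))"
    using transition_C1[of c c'] assms charts_atD by metis
  then show ?thesis using assms charts_atD by metis
qed

lemma bounded_linear_transition_deriv: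
  "c \<in> charts_at A x \<Longrightarrow> c' \<in> charts_at A x \<Longrightarrow> bounded_linear (transition_deriv c c' x)"
  using transition_has_derivative has_derivative_bounded_linear by blast

text \<open>The chain rule: near \<open>snd c x\<close> the composite of the two transitions is the
  transition from \<open>c\<close> to \<open>c''\<close>. It makes \<open>chart_lift\<close> a
  compatible family, that is, a tangent vector.\<close>

lemma transition_deriv_cocycle:
  assumes "c \<in> charts_at A x" "c' \<in> charts_at A x" "c'' \<in> charts_at A x"
  shows "transition_deriv c' c'' x (transition_deriv c c' x v) = transition_deriv c c'' x v"
proof -
  note A = charts_atD[OF assms(1)] charts_atD[OF assms(2)] charts_atD[OF assms(3)]
  have t: "transition c c' (snd c x) = snd c' x" using A by (simp add: transition_def)
  have "(transition c' c'' \<circ> transition c c' has_derivative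
      transition_deriv c' c'' x \<circ> transition_deriv c c' x) (at (snd c x))"
    using transition_has_derivative[OF assms(1,2)] transition_has_derivative[OF assms(2,3)]
    by (intro diff_chain_at) (simp_all add: t)
  moreover have "(transition c' c'' \<circ> transition c c') z = transition c c'' z"
    if "z \<in> snd c ` (fst c \<inter> fst c')" for z
    using that A by (auto simp: transition_def)
  moreover have "open (snd c ` (fst c \<inter> fst c'))" "snd c x \<in> snd c ` (fst c \<inter> fst c')"
    using A by (auto intro!: open_chart_image open_Int open_domain)
  ultimately have "(transition c c'' has_derivative
      transition_deriv c' c'' x \<circ> transition_deriv c c' x) (at (snd c x))"
    using has_derivative_transform_within_open by blast
  then have "transition_deriv c' c'' x \<circ> transition_deriv c c' x = transition_deriv c c'' x"
    using transition_has_derivative[OF assms(1,3)] has_derivative_unique by blast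
  then show ?thesis by (simp add: fun_eq_iff)
qed

lemma transition_deriv_self:
  assumes "c \<in> charts_at A x"
  shows "transition_deriv c c x v = v"
proof -
  note A = charts_atD[OF assms]
  have "transition c c z = z" if "z \<in> snd c ` fst c" for z
    using that A by (auto simp: transition_def)
  moreover have "open (snd c ` fst c)" "snd c x \<in> snd c ` fst c"
    using A by (auto intro!: open_range)
  ultimately have "(transition c c has_derivative (\<lambda>v. v)) (at (snd c x))"
    using has_derivative_transform_within_open[of "\<lambda>z. z" "\<lambda>v. v" "snd c x" UNIV "snd c ` fst c" "transition c c"]
      has_derivative_ident by fastforce
  then have "transition_deriv c c x = (\<lambda>v. v)"
    using transition_has_derivative[OF assms assms] has_derivative_unique by blast
  then show ?thesis by simp
qed

lemma chart_lift_apply: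
  "c' \<in> charts_at A x \<Longrightarrow> chart_lift A c x v c' = transition_deriv c c' x v"
  by (simp add: chart_lift_def)

lemma chart_lift_self [simp]: "c \<in> charts_at A x \<Longrightarrow> chart_lift A c x v c = v"
  by (simp add: chart_lift_apply transition_deriv_self)

lemma chart_lift_tangent [simp]: "c \<in> charts_at A x \<Longrightarrow> chart_lift A c x v \<in> tangent_space A x"
  by (auto simp: tangent_space_def chart_lift_def transition_deriv_cocycle)

lemma chart_lift_tangent_eq:
  assumes "c \<in> charts_at A x" "\<xi> \<in> tangent_space A x"
  shows "chart_lift A c x (\<xi> c) = \<xi>"
proof
  fix c'
  have "\<xi> c' = transition_deriv c c' x (\<xi> c)" if "c' \<in> charts_at A x"
    using assms that unfolding tangent_space_def by blast
  moreover have "\<xi> c' = 0" if "c' \<notin> charts_at A x"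
    using assms that unfolding tangent_space_def by blast
  ultimately show "chart_lift A c x (\<xi> c) c' = \<xi> c'" by (simp add: chart_lift_def)
qed

lemma chart_lift_change:
  assumes "c \<in> charts_at A x" "c' \<in> charts_at A x"
  shows "chart_lift A c' x (transition_deriv c c' x v) = chart_lift A c x v"
  using chart_lift_tangent_eq[OF assms(2) chart_lift_tangent[OF assms(1)], of v] assms
  by (simp add: chart_lift_apply)

lemma linear_chart_lift:
  assumes "c \<in> charts_at A x"
  shows "linear (chart_lift A c x)"
proof (rule linearI)
  have lin: "linear (transition_deriv c c' x)" if "c' \<in> charts_at A x" for c'
    using bounded_linear_transition_deriv[OF assms that] by (rule bounded_linear.linear)
  show "chart_lift A c x (u + v) = chart_lift A c x u + chart_lift A c x v" for u v
    using lin by (auto simp: chart_lift_def fun_eq_iff linear_add)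
  show "chart_lift A c x (r *\<^sub>R v) = r *\<^sub>R chart_lift A c x v" for r v
    using lin by (auto simp: chart_lift_def scaleR_fun_def fun_eq_iff linear_scale)
qed

section \<open>Velocities and operations on paths\<close>

lemma has_vector_derivative_change_chart:
  assumes c: "c \<in> charts_at A (\<sigma> t)" and c': "c' \<in> charts_at A (\<sigma> t)"
    and \<sigma>: "continuous_on S \<sigma>" and t: "t \<in> S"
    and D: "((snd c \<circ> \<sigma>) has_vector_derivative D) (at t within S)"
  shows "((snd c' \<circ> \<sigma>) has_vector_derivative transition_deriv c c' (\<sigma> t) D) (at t within S)"
proof -
  note A = charts_atD[OF c] charts_atD[OF c']
  have "(transition c c' has_derivative transition_deriv c c' (\<sigma> t)) (at ((snd c \<circ> \<sigma>) t))"
    using transition_has_derivative[OF c c'] by simp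
  then have deriv: "((transition c c' \<circ> (snd c \<circ> \<sigma>)) has_vector_derivative transition_deriv c c' (\<sigma> t) D)
      (at t within S)"
    using vector_derivative_diff_chain_within[OF D] has_derivative_at_withinI by blast
  \<comment> \<open>The transition turns the coordinates of \<open>\<sigma>\<close> in
    \<open>c\<close> into those in \<open>c'\<close> while \<open>\<sigma>\<close> stays in the
    domain of \<open>c\<close>; continuity ensures this near \<open>t\<close>.\<close>
  obtain O' where O': "open O'" "O' \<inter> S = \<sigma> -` fst c \<inter> S"
    using \<sigma> open_domain[OF A(1)] unfolding continuous_on_open_invariant by blast
  have "t \<in> O'" using O'(2) t A by blast
  then obtain d where d: "d > 0" "ball t d \<subseteq> O'" using O'(1) openE by blast
  have "(transition c c' \<circ> (snd c \<circ> \<sigma>)) s = (snd c' \<circ> \<sigma>) s" if "s \<in> S" "dist s t < d" for s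
  proof -
    have "s \<in> O'" using d(2) that(2) by (simp add: subset_iff dist_commute)
    then have "\<sigma> s \<in> fst c" using O'(2) that(1) by blast
    then show ?thesis using A(1) by (simp add: transition_def)
  qed
  with deriv d(1) t show ?thesis by (rule has_vector_derivative_transform_within)
qed

lemma velocity_eq:
  assumes "a < b" "t \<in> {a..b}" "c \<in> charts_at A (\<sigma> t)"
    and "((snd c \<circ> \<sigma>) has_vector_derivative D) (at t within {a..b})"
  shows "velocity A \<sigma> {a..b} t c = D"
  using assms vector_derivative_within_cbox[of a b t "snd c \<circ> \<sigma>" D] by (simp add: velocity_def)

lemma C1_path_velocity:
  assumes "a < b" "C1_path A a b \<sigma>" "c \<in> A"
  shows "continuous_on ({a..b} \<inter> \<sigma> -` fst c) (\<lambda>t. velocity A \<sigma> {a..b} t c)"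
    and "\<And>t. t \<in> {a..b} \<Longrightarrow> \<sigma> t \<in> fst c \<Longrightarrow>
      ((snd c \<circ> \<sigma>) has_vector_derivative velocity A \<sigma> {a..b} t c) (at t within {a..b})"
proof -
  obtain D where D: "continuous_on ({a..b} \<inter> \<sigma> -` fst c) D"
    "\<And>t. t \<in> {a..b} \<inter> \<sigma> -` fst c \<Longrightarrow> ((snd c \<circ> \<sigma>) has_vector_derivative D t) (at t within {a..b})"
    using assms unfolding C1_path_def by blast
  have eq: "velocity A \<sigma> {a..b} t c = D t" if "t \<in> {a..b} \<inter> \<sigma> -` fst c" for t
    using that assms D(2)[OF that] by (intro velocity_eq) (auto intro: charts_atI)
  show "continuous_on ({a..b} \<inter> \<sigma> -` fst c) (\<lambda>t. velocity A \<sigma> {a..b} t c)"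
    by (rule continuous_on_eq[OF D(1)]) (rule eq[symmetric])
  show "((snd c \<circ> \<sigma>) has_vector_derivative velocity A \<sigma> {a..b} t c) (at t within {a..b})"
    if "t \<in> {a..b}" "\<sigma> t \<in> fst c" for t
    using eq[of t] D(2)[of t] that by auto
qed

text \<open>Since derivatives transform by the transition maps, one chart of choice suffices to
  compute the whole family of coordinates.\<close>

lemma velocity_lift:
  assumes "a < b" "continuous_on {a..b} \<sigma>" "t \<in> {a..b}" "c \<in> charts_at A (\<sigma> t)"
    and D: "((snd c \<circ> \<sigma>) has_vector_derivative D) (at t within {a..b})"
  shows "velocity A \<sigma> {a..b} t = chart_lift A c (\<sigma> t) D"
proof
  fix c'
  show "velocity A \<sigma> {a..b} t c' = chart_lift A c (\<sigma> t) D c'"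
  proof (cases "c' \<in> charts_at A (\<sigma> t)")
    case True
    have "((snd c' \<circ> \<sigma>) has_vector_derivative transition_deriv c c' (\<sigma> t) D) (at t within {a..b})"
      using has_vector_derivative_change_chart[OF assms(4) True assms(2,3) D] .
    then show ?thesis using velocity_eq[of a b t c' \<sigma>] assms(1,3) True by (simp add: chart_lift_apply)
  qed (simp add: velocity_def chart_lift_def)
qed

lemma C1_path_velocity_lift:
  assumes "a < b" "C1_path A a b \<sigma>" "t \<in> {a..b}" "c \<in> charts_at A (\<sigma> t)"
  shows "velocity A \<sigma> {a..b} t = chart_lift A c (\<sigma> t) (velocity A \<sigma> {a..b} t c)"
  using assms C1_path_velocity(2)[OF assms(1,2)] charts_atD[OF assms(4)]
  by (intro velocity_lift) (auto simp: C1_path_def)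

lemma velocity_tangent:
  assumes "a < b" "C1_path A a b \<sigma>" "t \<in> {a..b}"
  shows "velocity A \<sigma> {a..b} t \<in> tangent_space A (\<sigma> t)"
proof -
  obtain c where c: "c \<in> charts_at A (\<sigma> t)" using exists_chart by blast
  show ?thesis by (subst C1_path_velocity_lift[OF assms c]) (simp add: c)
qed

text \<open>\<open>h\<close> is only asked to map into \<open>{a..b}\<close>, so that the same lemma
  serves for reversing a path and for slowing it down.\<close>

lemma C1_path_reparam:
  assumes ab: "a < b" "C1_path A a b \<sigma>" and pq: "p < q"
    and h: "h ` {p..q} \<subseteq> {a..b}" "\<And>t. t \<in> {p..q} \<Longrightarrow> (h has_real_derivative h' t) (at t within {p..q})"
      "continuous_on {p..q} h'"
  shows "C1_path A p q (\<sigma> \<circ> h)"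
    and "\<And>t. t \<in> {p..q} \<Longrightarrow> velocity A (\<sigma> \<circ> h) {p..q} t = h' t *\<^sub>R velocity A \<sigma> {a..b} (h t)"
proof -
  have hc: "continuous_on {p..q} h"
    using h(2) by (meson DERIV_continuous continuous_on_eq_continuous_within)
  have \<sigma>: "continuous_on {a..b} \<sigma>" using ab(2) by (simp add: C1_path_def)
  have \<sigma>h: "continuous_on {p..q} (\<sigma> \<circ> h)"
    using continuous_on_compose[OF hc continuous_on_subset[OF \<sigma> h(1)]] .
  have D: "((snd c \<circ> (\<sigma> \<circ> h)) has_vector_derivative h' t *\<^sub>R velocity A \<sigma> {a..b} (h t) c) (at t within {p..q})"
    if "c \<in> A" "t \<in> {p..q}" "\<sigma> (h t) \<in> fst c" for c t
  proof -
    have "((snd c \<circ> \<sigma>) has_vector_derivative velocity A \<sigma> {a..b} (h t) c) (at (h t) within h ` {p..q})"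
    proof (rule has_vector_derivative_within_subset[OF C1_path_velocity(2)[OF ab that(1)] h(1)])
      show "h t \<in> {a..b}" using h(1) that(2) by blast
    qed (rule that(3))
    moreover have "(h has_vector_derivative h' t) (at t within {p..q})"
      using h(2)[OF that(2)] by (simp add: has_real_derivative_iff_has_vector_derivative)
    ultimately show ?thesis using vector_diff_chain_within by (metis comp_assoc)
  qed
  show path: "C1_path A p q (\<sigma> \<circ> h)"
  unfolding C1_path_def
  proof (intro conjI ballI \<sigma>h)
    fix c assume c: "c \<in> A"
    have "continuous_on ({p..q} \<inter> (\<sigma> \<circ> h) -` fst c) (\<lambda>t. h' t *\<^sub>R velocity A \<sigma> {a..b} (h t) c)"
    proof (intro continuous_on_scaleR)
      show "continuous_on ({p..q} \<inter> (\<sigma> \<circ> h) -` fst c) h'"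
        using h(3) by (rule continuous_on_subset) auto
      show "continuous_on ({p..q} \<inter> (\<sigma> \<circ> h) -` fst c) (\<lambda>t. velocity A \<sigma> {a..b} (h t) c)"
        using h(1) continuous_on_subset[OF hc]
        by (intro continuous_on_compose2[OF C1_path_velocity(1)[OF ab c]]) auto
    qed
    then show "\<exists>D. continuous_on ({p..q} \<inter> (\<sigma> \<circ> h) -` fst c) D \<and>
      (\<forall>t \<in> {p..q} \<inter> (\<sigma> \<circ> h) -` fst c. ((snd c \<circ> (\<sigma> \<circ> h)) has_vector_derivative D t) (at t within {p..q}))"
      using D[OF c] by (intro exI conjI ballI) auto
  qed
  fix t assume t: "t \<in> {p..q}"
  then have ht: "h t \<in> {a..b}" using h(1) by blast
  obtain c where c: "c \<in> charts_at A (\<sigma> (h t))" using exists_chart by blast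
  have "velocity A (\<sigma> \<circ> h) {p..q} t = chart_lift A c ((\<sigma> \<circ> h) t) (h' t *\<^sub>R velocity A \<sigma> {a..b} (h t) c)"
    using c t D[of c t] charts_atD[OF c] by (intro velocity_lift[OF pq \<sigma>h]) auto
  also have "\<dots> = h' t *\<^sub>R chart_lift A c (\<sigma> (h t)) (velocity A \<sigma> {a..b} (h t) c)"
    using linear_scale[OF linear_chart_lift[OF c]] by simp
  also have "\<dots> = h' t *\<^sub>R velocity A \<sigma> {a..b} (h t)"
    using C1_path_velocity_lift[OF ab ht c] by simp
  finally show "velocity A (\<sigma> \<circ> h) {p..q} t = h' t *\<^sub>R velocity A \<sigma> {a..b} (h t)" .
qed

text \<open>Vanishing velocities at the junction make the one-sided derivatives agree in every
  chart, which excludes a corner.\<close>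

lemma C1_path_join:
  assumes pq: "p < q" "q < r" and \<sigma>: "C1_path A p q \<sigma>" and \<tau>: "C1_path A q r \<tau>" and eq: "\<sigma> q = \<tau> q"
    and stop: "velocity A \<sigma> {p..q} q = 0" "velocity A \<tau> {q..r} q = 0"
  defines "\<rho> \<equiv> \<lambda>t. if t \<in> {p..q} then \<sigma> t else \<tau> t"
  shows "C1_path A p r \<rho>"
    and "\<And>t. t \<in> {p..q} \<Longrightarrow> velocity A \<rho> {p..r} t = velocity A \<sigma> {p..q} t"
    and "\<And>t. t \<in> {q..r} \<Longrightarrow> velocity A \<rho> {p..r} t = velocity A \<tau> {q..r} t"
proof -
  have un: "{p..r} = {p..q} \<union> {q..r}" using pq by auto
  have cl: "closure {p..q} \<inter> closure {q..r} = {q}" using pq by auto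
  \<comment> \<open>A piecewise function is differentiated within each piece enlarged by the common
    boundary \<open>{q}\<close>, which both pieces already contain.\<close>
  have S: "{p..q} \<union> (closure {p..q} \<inter> closure {q..r}) = {p..q}"
    and T: "{q..r} \<union> (closure {p..q} \<inter> closure {q..r}) = {q..r}"
    using pq cl by auto
  have \<rho>1: "\<rho> t = \<sigma> t" if "t \<in> {p..q}" for t using that by (simp add: \<rho>_def)
  have \<rho>2: "\<rho> t = \<tau> t" if "t \<in> {q..r}" for t using that eq by (auto simp: \<rho>_def)
  have cont: "continuous_on {p..r} \<rho>"
    unfolding un
  proof (rule continuous_on_closed_Un)
    have "continuous_on {p..q} \<sigma>" "continuous_on {q..r} \<tau>" using \<sigma> \<tau> unfolding C1_path_def by blast+
    then show "continuous_on {p..q} \<rho>" "continuous_on {q..r} \<rho>"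
      using \<rho>1 \<rho>2 by (metis continuous_on_cong)+
  qed auto
  define D where "D t c = (if t \<in> {p..q} then velocity A \<sigma> {p..q} t c else velocity A \<tau> {q..r} t c)" for t c
  have D1: "D t c = velocity A \<sigma> {p..q} t c" if "t \<in> {p..q}" for t c using that by (simp add: D_def)
  have D2: "D t c = velocity A \<tau> {q..r} t c" if "t \<in> {q..r}" for t c
    using that stop by (cases "t = q") (auto simp: D_def)
  have deriv: "((snd c \<circ> \<rho>) has_vector_derivative D t c) (at t within {p..r})"
    if c: "c \<in> A" and t: "t \<in> {p..r}" "\<rho> t \<in> fst c" for c t
  proof -
    have "((\<lambda>t. if t \<in> {p..q} then (snd c \<circ> \<sigma>) t else (snd c \<circ> \<tau>) t) has_vector_derivative
        (if t \<in> {p..q} then velocity A \<sigma> {p..q} t c else velocity A \<tau> {q..r} t c)) (at t within {p..r})"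
    proof (rule has_vector_derivative_If_within_closures[where T = "{q..r}"])
      show "t \<in> {p..q} \<union> {q..r}" "{p..r} = {p..q} \<union> {q..r}" using un t by auto
      show "((snd c \<circ> \<sigma>) has_vector_derivative velocity A \<sigma> {p..q} t c)
          (at t within {p..q} \<union> (closure {p..q} \<inter> closure {q..r}))"
        if "t \<in> {p..q} \<union> (closure {p..q} \<inter> closure {q..r})"
        using that C1_path_velocity(2)[OF pq(1) \<sigma> c, of t] \<rho>1[of t] t unfolding S by simp
      show "((snd c \<circ> \<tau>) has_vector_derivative velocity A \<tau> {q..r} t c)
          (at t within {q..r} \<union> (closure {p..q} \<inter> closure {q..r}))"
        if "t \<in> {q..r} \<union> (closure {p..q} \<inter> closure {q..r})"
        using that C1_path_velocity(2)[OF pq(2) \<tau> c, of t] \<rho>2[of t] t unfolding T by simp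
      show "(snd c \<circ> \<sigma>) t = (snd c \<circ> \<tau>) t" if "t \<in> closure {p..q}" "t \<in> closure {q..r}"
        using that cl eq by auto
      show "velocity A \<sigma> {p..q} t c = velocity A \<tau> {q..r} t c"
        if "t \<in> closure {p..q}" "t \<in> closure {q..r}"
        using that cl stop by auto
    qed
    moreover have "(\<lambda>t. if t \<in> {p..q} then (snd c \<circ> \<sigma>) t else (snd c \<circ> \<tau>) t) = snd c \<circ> \<rho>"
      by (auto simp: \<rho>_def)
    ultimately show ?thesis by (simp add: D_def)
  qed
  have Dcont: "continuous_on ({p..r} \<inter> \<rho> -` fst c) (\<lambda>t. D t c)" if c: "c \<in> A" for c
  proof -
    let ?W = "{p..r} \<inter> \<rho> -` fst c"
    have "continuous_on (({p..q} \<inter> \<sigma> -` fst c) \<union> ({q..r} \<inter> \<tau> -` fst c)) (\<lambda>t. D t c)"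
    proof (rule continuous_on_Un_local)
      have 1: "{p..q} \<inter> \<sigma> -` fst c \<union> {q..r} \<inter> \<tau> -` fst c = ?W"
        using un \<rho>1 \<rho>2 by auto
      have "{p..q} \<inter> \<sigma> -` fst c = ?W \<inter> {p..q}" "{q..r} \<inter> \<tau> -` fst c = ?W \<inter> {q..r}"
        using pq \<rho>1 \<rho>2 by auto
      then show "closedin (top_of_set ({p..q} \<inter> \<sigma> -` fst c \<union> {q..r} \<inter> \<tau> -` fst c)) ({p..q} \<inter> \<sigma> -` fst c)"
        "closedin (top_of_set ({p..q} \<inter> \<sigma> -` fst c \<union> {q..r} \<inter> \<tau> -` fst c)) ({q..r} \<inter> \<tau> -` fst c)"
        unfolding 1 by (simp_all add: closedin_closed_Int)
      show "continuous_on ({p..q} \<inter> \<sigma> -` fst c) (\<lambda>t. D t c)"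
        using D1 by (intro continuous_on_eq[OF C1_path_velocity(1)[OF pq(1) \<sigma> c]]) auto
      show "continuous_on ({q..r} \<inter> \<tau> -` fst c) (\<lambda>t. D t c)"
        using D2 by (intro continuous_on_eq[OF C1_path_velocity(1)[OF pq(2) \<tau> c]]) auto
    qed
    moreover have "{p..q} \<inter> \<sigma> -` fst c \<union> {q..r} \<inter> \<tau> -` fst c = ?W"
      using un \<rho>1 \<rho>2 by auto
    ultimately show ?thesis by simp
  qed
  have pr: "p < r" using pq by simp
  show "C1_path A p r \<rho>"
  unfolding C1_path_def
  proof (intro conjI ballI cont)
    fix c assume "c \<in> A"
    then show "\<exists>D. continuous_on ({p..r} \<inter> \<rho> -` fst c) D \<and>
      (\<forall>t \<in> {p..r} \<inter> \<rho> -` fst c. ((snd c \<circ> \<rho>) has_vector_derivative D t) (at t within {p..r}))"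
      using deriv Dcont by (intro exI[of _ "\<lambda>t. D t c"] conjI ballI) auto
  qed
  have vel: "velocity A \<rho> {p..r} t = chart_lift A c (\<rho> t) (D t c)" if "t \<in> {p..r}" "c \<in> charts_at A (\<rho> t)" for t c
    using velocity_lift[OF pr cont that] deriv charts_atD[OF that(2)] that(1) by blast
  show "velocity A \<rho> {p..r} t = velocity A \<sigma> {p..q} t" if t: "t \<in> {p..q}" for t
  proof -
    obtain c where c: "c \<in> charts_at A (\<sigma> t)" using exists_chart by blast
    show ?thesis
      using vel[of t c] C1_path_velocity_lift[OF pq(1) \<sigma> t c] \<rho>1[OF t] c t pq D1[OF t] by simp
  qed
  show "velocity A \<rho> {p..r} t = velocity A \<tau> {q..r} t" if t: "t \<in> {q..r}" for t
  proof -
    obtain c where c: "c \<in> charts_at A (\<tau> t)" using exists_chart by blast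
    show ?thesis
      using vel[of t c] C1_path_velocity_lift[OF pq(2) \<tau> t c] \<rho>2[OF t] c t pq D2[OF t] by simp
  qed
qed

text \<open>A straight segment has constant coordinate velocity, so its length is bounded by the
  chart norms of one displacement vector. Upper bounds for the distance come from here.\<close>

lemma C1_path_segment:
  assumes c: "c \<in> A" and seg: "\<And>t. t \<in> {0..1} \<Longrightarrow> z + t *\<^sub>R v \<in> snd c ` fst c"
  defines "\<sigma> \<equiv> \<lambda>t. chart_inv c (z + t *\<^sub>R v)"
  shows "C1_path A 0 1 \<sigma>"
    and "\<And>t. t \<in> {0..1} \<Longrightarrow> velocity A \<sigma> {0..1} t = chart_lift A c (\<sigma> t) v"
proof -
  have \<sigma>in: "\<sigma> t \<in> fst c" if "t \<in> {0..1}" for t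
    unfolding \<sigma>_def using seg[OF that] c by (rule chart_inv_in[rotated])
  have \<sigma>c: "snd c (\<sigma> t) = z + t *\<^sub>R v" if "t \<in> {0..1}" for t
    unfolding \<sigma>_def using seg[OF that] c by simp
  have cont: "continuous_on {0..1} \<sigma>"
    unfolding \<sigma>_def using seg
    by (intro continuous_on_compose2[OF continuous_chart_inv[OF c]] continuous_intros) auto
  have line: "((\<lambda>t. z + t *\<^sub>R v) has_vector_derivative v) (at t within {0..1})" for t
    by (auto intro!: derivative_eq_intros)
  show "C1_path A 0 1 \<sigma>"
    unfolding C1_path_def
  proof (intro conjI ballI cont)
    fix c' assume c': "c' \<in> A"
    obtain g' where g': "continuous_on (snd c ` (fst c \<inter> fst c')) g'"
      "\<And>x. x \<in> fst c \<Longrightarrow> x \<in> fst c' \<Longrightarrow>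
        (transition c c' has_derivative blinfun_apply (g' (snd c x))) (at (snd c x))"
      using transition_C1[OF c c'] by metis
    have "continuous_on ({0..1} \<inter> \<sigma> -` fst c') (\<lambda>t. blinfun_apply (g' (z + t *\<^sub>R v)) v)"
      by (intro continuous_intros continuous_on_compose2[OF g'(1)])
        (use \<sigma>in \<sigma>c in \<open>auto intro!: image_eqI[of _ _ "\<sigma> _"]\<close>)
    moreover have "((snd c' \<circ> \<sigma>) has_vector_derivative blinfun_apply (g' (z + t *\<^sub>R v)) v) (at t within {0..1})"
      if t: "t \<in> {0..1}" "\<sigma> t \<in> fst c'" for t
    proof -
      have "(transition c c' has_derivative blinfun_apply (g' (z + t *\<^sub>R v)))
          (at (z + t *\<^sub>R v) within (\<lambda>t. z + t *\<^sub>R v) ` {0..1})"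
        using g'(2)[OF \<sigma>in[OF t(1)] t(2)] \<sigma>c[OF t(1)] by (auto intro: has_derivative_at_withinI)
      from vector_derivative_diff_chain_within[OF line this]
      show ?thesis by (simp add: transition_def \<sigma>_def o_def)
    qed
    ultimately show "\<exists>D. continuous_on ({0..1} \<inter> \<sigma> -` fst c') D \<and>
      (\<forall>t \<in> {0..1} \<inter> \<sigma> -` fst c'. ((snd c' \<circ> \<sigma>) has_vector_derivative D t) (at t within {0..1}))"
      by (intro exI conjI ballI) auto
  qed
  fix t :: real assume t: "t \<in> {0..1}"
  have "((snd c \<circ> \<sigma>) has_vector_derivative v) (at t within {0..1})"
    using has_vector_derivative_transform[OF t _ line] \<sigma>c by (auto simp: o_def)
  then show "velocity A \<sigma> {0..1} t = chart_lift A c (\<sigma> t) v"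
    using t \<sigma>in[OF t] c by (intro velocity_lift cont) (auto intro: charts_atI)
qed

end

subsection \<open>The Finsler distance\<close>

text \<open>The function \<open>p (\<gamma> t - \<gamma> a)\<close> minus the integral of
  \<open>l\<close> has upper right Dini derivative at most 0, so \<open>dini_mvt\<close> applies. A
  multiple of the Finsler speed will be taken for \<open>l\<close>.\<close>

lemma (in equiv_norm) curve_bound:
  fixes \<gamma> :: "real \<Rightarrow> 'a"
  assumes ab: "a \<le> b" and \<gamma>: "\<And>t. t \<in> {a..b} \<Longrightarrow> (\<gamma> has_vector_derivative \<gamma>' t) (at t within {a..b})"
    and l: "continuous_on {a..b} l" and le: "\<And>t. t \<in> {a..b} \<Longrightarrow> p (\<gamma>' t) \<le> l t"
  shows "p (\<gamma> b - \<gamma> a) \<le> integral {a..b} l"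
proof -
  obtain M where M: "M > 0" "\<And>v. p v \<le> M * norm v" using upper_bound by blast
  let ?I = "\<lambda>t. integral {a..t} l"
  let ?\<phi> = "\<lambda>t. p (\<gamma> t - \<gamma> a) - ?I t"
  have I: "(?I has_vector_derivative l t) (at t within {a..b})" if "t \<in> {a..b}" for t
    using integral_has_vector_derivative[OF l that] .
  have "?\<phi> b - ?\<phi> a \<le> 0 * (b - a)"
  proof (rule dini_mvt[OF ab])
    have "continuous_on {a..b} \<gamma>" using \<gamma> by (meson continuous_on_vector_derivative)
    moreover have "continuous_on {a..b} ?I" using I by (meson continuous_on_vector_derivative)
    ultimately show "continuous_on {a..b} ?\<phi>"
      by (intro continuous_intros continuous_on_compose2[OF continuous[of UNIV]]) auto
    fix s K' :: real assume s: "a \<le> s" "s < b" and K': "0 < K'"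
    have sI: "s \<in> {a..b}" using s by simp
    \<comment> \<open>Linearizing \<open>\<gamma>\<close> costs \<open>M * k * t\<close> in
      \<open>p\<close>, linearizing the integral costs \<open>k * t\<close>; together this is
      \<open>K' * t\<close>.\<close>
    define k where "k = K' / (M + 1)"
    have k: "k > 0" using K' M by (simp add: k_def)
    obtain d1 where d1: "d1 > 0" "\<And>r. r \<in> {a..b} \<Longrightarrow> norm (r - s) < d1 \<Longrightarrow>
        norm (\<gamma> r - \<gamma> s - (r - s) *\<^sub>R \<gamma>' s) \<le> k * norm (r - s)"
      using \<gamma>[OF sI] k unfolding has_vector_derivative_def has_derivative_within_alt by blast
    obtain d2 where d2: "d2 > 0" "\<And>r. r \<in> {a..b} \<Longrightarrow> norm (r - s) < d2 \<Longrightarrow>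
        norm (?I r - ?I s - (r - s) *\<^sub>R l s) \<le> k * norm (r - s)"
      using I[OF sI] k unfolding has_vector_derivative_def has_derivative_within_alt by blast
    show "\<forall>\<^sub>F t in at_right 0. ?\<phi> (s + t) - ?\<phi> s \<le> K' * t"
    proof (rule eventually_at_rightI[of _ "min (b - s) (min d1 d2)"])
      show "0 < min (b - s) (min d1 d2)" using s d1 d2 by simp
      fix t assume "t \<in> {0<..<min (b - s) (min d1 d2)}"
      then have t: "0 < t" "t < b - s" "t < d1" "t < d2" by auto
      then have st: "s + t \<in> {a..b}" using s by simp
      define e where "e = \<gamma> (s + t) - \<gamma> s - t *\<^sub>R \<gamma>' s"
      have "norm e \<le> k * t" using d1(2)[OF st] t by (simp add: e_def)
      then have e: "p e \<le> M * (k * t)" using M(1) order_trans[OF M(2)[of e] mult_left_mono[of "norm e" "k * t" M]] by simp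
      have "norm (?I (s + t) - ?I s - t *\<^sub>R l s) \<le> k * t" using d2(2)[OF st] t by simp
      then have i: "?I (s + t) - ?I s \<ge> t * l s - k * t" by (simp add: abs_le_iff)
      have "p (\<gamma> (s + t) - \<gamma> a) - p (\<gamma> s - \<gamma> a) \<le> p (\<gamma> (s + t) - \<gamma> s)"
        using diff_le[of "\<gamma> (s + t) - \<gamma> a" "\<gamma> s - \<gamma> a"] by simp
      also have "\<dots> \<le> p (t *\<^sub>R \<gamma>' s) + p e" using triangle[of "t *\<^sub>R \<gamma>' s" e] by (simp add: e_def)
      also have "p (t *\<^sub>R \<gamma>' s) \<le> t * l s" using le[OF sI] t(1) by (simp add: scale)
      finally have "?\<phi> (s + t) - ?\<phi> s \<le> M * (k * t) + k * t" using e i by linarith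
      also have "\<dots> = (M + 1) * k * t" by (simp add: algebra_simps)
      also have "\<dots> = K' * t" using M by (simp add: k_def)
      finally show "?\<phi> (s + t) - ?\<phi> s \<le> K' * t" .
    qed
  qed
  then show ?thesis by simp
qed

section \<open>Path lengths\<close>

locale finsler = C1_mfd A for A :: "('x::t2_space, 'e::banach) chart set" +
  fixes N :: "'x \<Rightarrow> ('x, 'e) tvec \<Rightarrow> real"
  assumes finsler: "finsler_structure A N" and connected: "connected (UNIV :: 'x set)"
begin

lemma continuous_N: "c \<in> A \<Longrightarrow> continuous_on (fst c \<times> UNIV) (\<lambda>(x, v). N x (chart_lift A c x v))"
  using finsler unfolding finsler_structure_def by blast

lemma norm_on_N: "norm_on (tangent_space A x) (N x)"
  using finsler unfolding finsler_structure_def by blast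

lemma N_nonneg: "\<xi> \<in> tangent_space A x \<Longrightarrow> 0 \<le> N x \<xi>"
  and N_scale: "\<xi> \<in> tangent_space A x \<Longrightarrow> N x (r *\<^sub>R \<xi>) = \<bar>r\<bar> * N x \<xi>"
  using norm_on_N[of x] unfolding norm_on_def by blast+

abbreviation chart_norm :: "('x, 'e) chart \<Rightarrow> 'x \<Rightarrow> 'e \<Rightarrow> real"
  where "chart_norm c x v \<equiv> N x (chart_lift A c x v)"

lemma equiv_norm_N:
  assumes c: "c \<in> charts_at A x"
  shows "equiv_norm (chart_norm c x)"
proof -
  have n: "norm_on UNIV (chart_norm c x)"
    and b: "\<exists>m>0. \<exists>M>0. \<forall>v. m * norm v \<le> chart_norm c x v \<and>
          chart_norm c x v \<le> M * norm v"
    using finsler c unfolding finsler_structure_def by blast+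
  show ?thesis
  proof
    show "chart_norm c x (r *\<^sub>R v) = \<bar>r\<bar> * chart_norm c x v" for r v
      using n unfolding norm_on_def by blast
    show "chart_norm c x (u + v) \<le> chart_norm c x u + chart_norm c x v" for u v
      using n unfolding norm_on_def by blast
    show "\<exists>m>0. \<forall>v. m * norm v \<le> chart_norm c x v"
      "\<exists>M>0. \<forall>v. chart_norm c x v \<le> M * norm v"
      using b by blast+
  qed
qed

abbreviation speed :: "real \<Rightarrow> real \<Rightarrow> (real \<Rightarrow> 'x) \<Rightarrow> real \<Rightarrow> real"
  where "speed a b \<sigma> t \<equiv> N (\<sigma> t) (velocity A \<sigma> {a..b} t)"

lemma speed_nonneg: "a < b \<Longrightarrow> C1_path A a b \<sigma> \<Longrightarrow> t \<in> {a..b} \<Longrightarrow> 0 \<le> speed a b \<sigma> t"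
  by (intro N_nonneg velocity_tangent)

lemma continuous_speed:
  assumes ab: "a < b" and \<sigma>: "C1_path A a b \<sigma>"
  shows "continuous_on {a..b} (speed a b \<sigma>)"
  unfolding continuous_on_eq_continuous_within
proof
  fix t assume t: "t \<in> {a..b}"
  obtain c where c: "c \<in> charts_at A (\<sigma> t)" using exists_chart by blast
  have cA: "c \<in> A" "\<sigma> t \<in> fst c" using charts_atD[OF c] .
  have cont: "continuous_on {a..b} \<sigma>" using \<sigma> by (simp add: C1_path_def)
  obtain O' where O': "open O'" "O' \<inter> {a..b} = \<sigma> -` fst c \<inter> {a..b}"
    using cont open_domain[OF cA(1)] unfolding continuous_on_open_invariant by blast
  let ?S = "{a..b} \<inter> \<sigma> -` fst c"
  have "continuous_on ?S (\<lambda>s. (\<sigma> s, velocity A \<sigma> {a..b} s c))"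
    using continuous_on_subset[OF cont] C1_path_velocity(1)[OF ab \<sigma> cA(1)]
    by (intro continuous_on_Pair) auto
  then have "continuous_on ?S (\<lambda>s. (\<lambda>(x, v). chart_norm c x v) (\<sigma> s, velocity A \<sigma> {a..b} s c))"
    by (rule continuous_on_compose2[OF continuous_N[OF cA(1)]]) auto
  then have "continuous_on ?S (speed a b \<sigma>)"
  proof (rule continuous_on_eq)
    fix s assume "s \<in> ?S"
    then show "(\<lambda>(x, v). chart_norm c x v) (\<sigma> s, velocity A \<sigma> {a..b} s c) = speed a b \<sigma> s"
      using C1_path_velocity_lift[OF ab \<sigma>, of s c] cA(1) by (simp add: charts_atI)
  qed
  then have "continuous (at t within ?S) (speed a b \<sigma>)"
    using t cA(2) by (simp add: continuous_on_eq_continuous_within)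
  moreover have "at t within ?S = at t within {a..b}"
  proof (rule at_within_nhd[OF _ O'(1)])
    show "t \<in> O'" using O'(2) t cA(2) by blast
    show "?S \<inter> O' - {t} = {a..b} \<inter> O' - {t}" using O'(2) by blast
  qed
  ultimately show "continuous (at t within {a..b}) (speed a b \<sigma>)" by simp
qed

lemma speed_integrable: "a < b \<Longrightarrow> C1_path A a b \<sigma> \<Longrightarrow> speed a b \<sigma> integrable_on {a..b}"
  using continuous_speed integrable_continuous_real by blast

text \<open>Treating lengths as a relation lets symmetry and concatenation be proved before the
  infimum is known to range over a nonempty set.\<close>

definition joins :: "'x \<Rightarrow> 'x \<Rightarrow> real \<Rightarrow> bool"
  where "joins u v L \<longleftrightarrow> (\<exists>\<sigma> a b. L = integral {a..b} (speed a b \<sigma>) \<and>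
    a < b \<and> C1_path A a b \<sigma> \<and> \<sigma> a = u \<and> \<sigma> b = v)"

lemma finsler_dist_eq: "finsler_dist A N u v = Inf {L. joins u v L}"
  unfolding finsler_dist_def joins_def by (rule arg_cong[of _ _ Inf]) blast

lemma joins_nonneg: "joins u v L \<Longrightarrow> 0 \<le> L"
  unfolding joins_def using speed_integrable speed_nonneg by (auto intro!: integral_nonneg)

lemma joins_reparam:
  assumes ab: "a < b" "C1_path A a b \<sigma>" and pq: "p < q"
    and h: "h ` {p..q} \<subseteq> {a..b}" "\<And>t. t \<in> {p..q} \<Longrightarrow> (h has_real_derivative h' t) (at t within {p..q})"
      "continuous_on {p..q} h'"
  shows "integral {p..q} (speed p q (\<sigma> \<circ> h)) = integral {p..q} (\<lambda>t. \<bar>h' t\<bar> * speed a b \<sigma> (h t))"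
proof (rule integral_cong)
  fix t assume t: "t \<in> {p..q}"
  then have "h t \<in> {a..b}" using h(1) by blast
  then show "speed p q (\<sigma> \<circ> h) t = \<bar>h' t\<bar> * speed a b \<sigma> (h t)"
    using C1_path_reparam(2)[OF assms t] velocity_tangent[OF ab] by (simp add: N_scale)
qed

lemma joins_sym:
  assumes "joins u v L"
  shows "joins v u L"
proof -
  obtain \<sigma> a b where \<sigma>: "L = integral {a..b} (speed a b \<sigma>)" "a < b" "C1_path A a b \<sigma>" "\<sigma> a = u" "\<sigma> b = v"
    using assms unfolding joins_def by blast
  let ?h = "\<lambda>t. a + b - t"
  have h: "?h ` {a..b} \<subseteq> {a..b}" "\<And>t. t \<in> {a..b} \<Longrightarrow> (?h has_real_derivative -1) (at t within {a..b})"
    by (auto intro!: derivative_eq_intros)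
  \<comment> \<open>As \<open>?h\<close> decreases, the first of the two integrals is over the empty
    interval \<open>{b..a}\<close>, and the difference is \<open>- L\<close>.\<close>
  have "((\<lambda>t. -1 *\<^sub>R speed a b \<sigma> (?h t)) has_integral
      (integral {?h a..?h b} (speed a b \<sigma>) - integral {?h b..?h a} (speed a b \<sigma>))) {a..b}"
    using \<sigma>(2) h
    by (intro has_integral_substitution_general[of "{}" a b ?h a b] continuous_speed[OF \<sigma>(2,3)])
      (auto intro!: continuous_intros)
  then have "((\<lambda>t. - speed a b \<sigma> (?h t)) has_integral - L) {a..b}"
    using \<sigma>(1,2) by simp
  from has_integral_neg[OF this] have "((\<lambda>t. speed a b \<sigma> (?h t)) has_integral L) {a..b}" by simp
  then have "integral {a..b} (\<lambda>t. speed a b \<sigma> (?h t)) = L" by (rule integral_unique)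
  then have "integral {a..b} (speed a b (\<sigma> \<circ> ?h)) = L"
    using joins_reparam[OF \<sigma>(2,3) \<sigma>(2) h] by simp
  moreover have "C1_path A a b (\<sigma> \<circ> ?h)" using C1_path_reparam(1)[OF \<sigma>(2,3) \<sigma>(2) h] by simp
  ultimately show ?thesis
    unfolding joins_def using \<sigma>(2,4,5) by (intro exI[of _ "\<sigma> \<circ> ?h"] exI[of _ a] exI[of _ b]) auto
qed

text \<open>
  Slowing a path down to velocity \<open>0\<close> at both ends makes concatenations continuously differentiable.
\<close>

lemma joins_stopping:
  assumes "joins u v L"
  obtains \<tau> where "integral {p..p+1} (speed p (p + 1) \<tau>) = L" "C1_path A p (p + 1) \<tau>"
    "\<tau> p = u" "\<tau> (p + 1) = v" "velocity A \<tau> {p..p+1} p = 0" "velocity A \<tau> {p..p+1} (p + 1) = 0"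
proof -
  obtain \<sigma> a b where \<sigma>: "L = integral {a..b} (speed a b \<sigma>)" "a < b" "C1_path A a b \<sigma>" "\<sigma> a = u" "\<sigma> b = v"
    using assms unfolding joins_def by blast
  \<comment> \<open>With \<open>x = t - p\<close> this is the cubic
    \<open>3 * x\<^sup>2 - 2 * x\<^sup>3\<close>, rescaled to run monotonically from
    \<open>a\<close> to \<open>b\<close> with derivative 0 at both ends.\<close>
  define h where "h t = a + (b - a) * ((t - p)\<^sup>2 * (3 - 2 * (t - p)))" for t
  define h' where "h' t = (b - a) * (6 * (t - p) * (1 - (t - p)))" for t
  have h01: "h t \<in> {a..b}" if "t \<in> {p..p+1}" for t
  proof -
    let ?x = "t - p"
    have x: "0 \<le> ?x" "?x \<le> 1" using that by auto
    have "0 \<le> ?x\<^sup>2 * (3 - 2 * ?x)" using x by (intro mult_nonneg_nonneg) auto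
    \<comment> \<open>This product equals \<open>1 - x\<^sup>2 * (3 - 2 * x)\<close>.\<close>
    moreover have "0 \<le> (1 - ?x)\<^sup>2 * (1 + 2 * ?x)" using x by (intro mult_nonneg_nonneg) auto
    then have "?x\<^sup>2 * (3 - 2 * ?x) \<le> 1" by (simp add: power2_eq_square algebra_simps)
    ultimately have "0 \<le> (b - a) * (?x\<^sup>2 * (3 - 2 * ?x))" "(b - a) * (?x\<^sup>2 * (3 - 2 * ?x)) \<le> b - a"
      using \<sigma>(2) mult_left_le[of "?x\<^sup>2 * (3 - 2 * ?x)" "b - a"] by auto
    then show ?thesis unfolding h_def by simp
  qed
  have h: "h ` {p..p+1} \<subseteq> {a..b}" "(h has_real_derivative h' t) (at t within {p..p+1})"
    "continuous_on {p..p+1} h'" "p < p + 1" for t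
    using h01 unfolding h_def[abs_def] h'_def[abs_def]
    by (auto intro!: derivative_eq_intros continuous_intros simp: power2_eq_square algebra_simps)
  have h'0: "0 \<le> h' t" if "t \<in> {p..p+1}" for t
    using that \<sigma>(2) unfolding h'_def by (intro mult_nonneg_nonneg) auto
  have hends: "h p = a" "h (p + 1) = b" "h' p = 0" "h' (p + 1) = 0" by (auto simp: h_def h'_def)
  have "((\<lambda>t. h' t *\<^sub>R speed a b \<sigma> (h t)) has_integral
      (integral {h p..h (p+1)} (speed a b \<sigma>) - integral {h (p+1)..h p} (speed a b \<sigma>))) {p..p+1}"
    using h
    by (intro has_integral_substitution_general[of "{}" p "p+1" h a b] continuous_speed[OF \<sigma>(2,3)])
      (auto intro!: DERIV_continuous_on)
  then have "integral {p..p+1} (\<lambda>t. h' t * speed a b \<sigma> (h t)) = L"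
    using \<sigma>(1,2) hends by (intro integral_unique) simp
  moreover have "integral {p..p+1} (speed p (p+1) (\<sigma> \<circ> h)) = integral {p..p+1} (\<lambda>t. h' t * speed a b \<sigma> (h t))"
    unfolding joins_reparam[OF \<sigma>(2,3) h(4,1,2,3)] using h'0 by (intro integral_cong) simp
  ultimately have "integral {p..p+1} (speed p (p+1) (\<sigma> \<circ> h)) = L" by simp
  then show thesis
    using that[of "\<sigma> \<circ> h"] C1_path_reparam[OF \<sigma>(2,3) h(4,1,2,3)] hends \<sigma>(4,5) by simp
qed

lemma joins_trans:
  assumes "joins u v L" "joins v w L'"
  shows "joins u w (L + L')"
proof -
  obtain \<sigma> where \<sigma>: "integral {0..1} (speed 0 1 \<sigma>) = L" "C1_path A 0 1 \<sigma>"
    "\<sigma> 0 = u" "\<sigma> 1 = v" "velocity A \<sigma> {0..1} 1 = 0"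
    using joins_stopping[OF assms(1), of 0] by auto
  obtain \<tau> where \<tau>: "integral {1..2} (speed 1 2 \<tau>) = L'" "C1_path A 1 2 \<tau>"
    "\<tau> 1 = v" "\<tau> 2 = w" "velocity A \<tau> {1..2} 1 = 0"
    using joins_stopping[OF assms(2), of 1] by auto
  define \<rho> where "\<rho> t = (if t \<in> {0..1} then \<sigma> t else \<tau> t)" for t
  have eq: "\<sigma> 1 = \<tau> 1" using \<sigma>(4) \<tau>(3) by simp
  note join = C1_path_join[OF _ _ \<sigma>(2) \<tau>(2) eq \<sigma>(5) \<tau>(5), folded \<rho>_def[abs_def], simplified]
  have \<rho>2: "\<rho> t = \<tau> t" if "t \<in> {1..2}" for t using that eq by (cases "t = 1") (auto simp: \<rho>_def)
  have \<rho>: "C1_path A 0 2 \<rho>" by (rule join(1))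
  have "integral {0..2} (speed 0 2 \<rho>) = integral {0..1} (speed 0 2 \<rho>) + integral {1..2} (speed 0 2 \<rho>)"
    using Henstock_Kurzweil_Integration.integral_combine[of 0 1 2 "speed 0 2 \<rho>"] speed_integrable[OF _ \<rho>] by simp
  also have "integral {0..1} (speed 0 2 \<rho>) = integral {0..1} (speed 0 1 \<sigma>)"
    using join(2) by (intro integral_cong) (auto simp: \<rho>_def)
  also have "integral {1..2} (speed 0 2 \<rho>) = integral {1..2} (speed 1 2 \<tau>)"
    using join(3) \<rho>2 by (intro integral_cong) auto
  finally have "L + L' = integral {0..2} (speed 0 2 \<rho>)" using \<sigma>(1) \<tau>(1) by simp
  moreover have "\<rho> 0 = u" "\<rho> 2 = w" using \<sigma>(3) \<tau>(4) by (auto simp: \<rho>_def)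
  ultimately show ?thesis
    unfolding joins_def using \<rho> by (intro exI[of _ \<rho>] exI[of _ 0] exI[of _ 2] conjI) simp_all
qed

lemma chart_ball:
  assumes c: "c \<in> charts_at A x" and W: "open W" "x \<in> W" and e: "e > 0"
  defines "p \<equiv> \<lambda>v. chart_norm c x v"
  obtains r where "r > 0" "{z. p (z - snd c x) < r} \<subseteq> snd c ` fst c"
    "\<And>u. u \<in> fst c \<Longrightarrow> p (snd c u - snd c x) < r \<Longrightarrow> u \<in> W"
    "\<And>u v. u \<in> fst c \<Longrightarrow> p (snd c u - snd c x) < r \<Longrightarrow>
      p v / (1 + e) \<le> chart_norm c u v \<and> chart_norm c u v \<le> (1 + e) * p v"
proof -
  interpret p: equiv_norm p unfolding p_def by (rule equiv_norm_N[OF c])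
  have cA: "c \<in> A" "x \<in> fst c" using charts_atD[OF c] .
  obtain U where U: "open U" "x \<in> U" "U \<subseteq> fst c"
    "\<And>u v. u \<in> U \<Longrightarrow> p v / (1 + e) \<le> chart_norm c u v \<and> chart_norm c u v \<le> (1 + e) * p v"
    using finsler c e unfolding finsler_structure_def p_def
    by (metis (no_types, lifting) times_divide_eq_left mult_1)
  have "open (snd c ` (U \<inter> W))" using U W by (intro open_chart_image[OF cA(1)]) auto
  moreover have "snd c x \<in> snd c ` (U \<inter> W)" using U W by blast
  ultimately obtain r where r: "r > 0" "{z. p (z - snd c x) \<le> r} \<subseteq> snd c ` (U \<inter> W)"
    using p.ball_subset by blast
  have inUW: "u \<in> U \<inter> W" if u: "u \<in> fst c" "p (snd c u - snd c x) < r" for u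
  proof -
    have "snd c u \<in> snd c ` (U \<inter> W)" using r(2) that by auto
    then obtain u' where "u' \<in> U \<inter> W" "snd c u = snd c u'" by blast
    then show ?thesis using chart_inj[OF cA(1), of u u'] u(1) U(3) by blast
  qed
  show thesis
  proof (rule that[OF r(1)])
    show "{z. p (z - snd c x) < r} \<subseteq> snd c ` fst c" using r(2) U(3) by force
  qed (use inUW U(4) in blast)+
qed

text \<open>Balls of \<open>q\<close> are convex, so the coordinate segment stays where the speed is
  at most \<open>M\<close> times the \<open>q\<close>-norm of the displacement.\<close>

lemma joins_chart_ball:
  assumes c: "c \<in> A" and q: "equiv_norm q" and sub: "{z. q (z - z0) < r} \<subseteq> snd c ` fst c"
    and bd: "\<And>u v. u \<in> fst c \<Longrightarrow> q (snd c u - z0) < r \<Longrightarrow> chart_norm c u v \<le> M * q v"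
    and u: "u \<in> fst c" "q (snd c u - z0) < r" and v: "v \<in> fst c" "q (snd c v - z0) < r"
  obtains L where "joins u v L" "L \<le> M * q (snd c v - snd c u)"
proof -
  interpret q: equiv_norm q by (rule q)
  have seg: "snd c u + t *\<^sub>R (snd c v - snd c u) \<in> {z. q (z - z0) < r}" if t: "t \<in> {0..1}" for t
  proof -
    have "snd c u + t *\<^sub>R (snd c v - snd c u) = (1 - t) *\<^sub>R snd c u + t *\<^sub>R snd c v"
      by (simp add: algebra_simps)
    then show ?thesis using q.convex_ball[of z0 r] u v t unfolding convex_def by simp
  qed
  define \<sigma> where "\<sigma> t = chart_inv c (snd c u + t *\<^sub>R (snd c v - snd c u))" for t
  have "snd c u + t *\<^sub>R (snd c v - snd c u) \<in> snd c ` fst c" if "t \<in> {0..1}" for t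
    using seg[OF that] sub by blast
  note path = C1_path_segment[OF c this, folded \<sigma>_def[abs_def], simplified]
  have "integral {0..1} (speed 0 1 \<sigma>) \<le> integral {0..1::real} (\<lambda>_. M * q (snd c v - snd c u))"
  proof (rule Henstock_Kurzweil_Integration.integral_le)
    fix t :: real assume t: "t \<in> {0..1}"
    have "snd c u + t *\<^sub>R (snd c v - snd c u) \<in> snd c ` fst c" using seg[OF t] sub by blast
    then have "\<sigma> t \<in> fst c" "q (snd c (\<sigma> t) - z0) < r"
      using seg[OF t] c by (auto simp: \<sigma>_def chart_inv_in)
    then have "chart_norm c (\<sigma> t) (snd c v - snd c u) \<le> M * q (snd c v - snd c u)" by (rule bd)
    then show "speed 0 1 \<sigma> t \<le> M * q (snd c v - snd c u)" using path(2)[of t] t by (simp add: \<sigma>_def)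
  qed (use speed_integrable path(1) in auto)
  moreover have "joins u v (integral {0..1} (speed 0 1 \<sigma>))"
    unfolding joins_def using path(1) c u(1) v(1)
    by (intro exI[of _ \<sigma>] exI[of _ 0] exI[of _ 1]) (auto simp: \<sigma>_def)
  ultimately show thesis using that by simp
qed

lemma joins_refl: "joins u u 0"
proof -
  obtain c where c: "c \<in> charts_at A u" using exists_chart by blast
  note cA = charts_atD[OF c]
  define p where "p v = chart_norm c u v" for v
  interpret p: equiv_norm p using equiv_norm_N[OF c, folded p_def] .
  obtain r where r: "r > 0" "{z. p (z - snd c u) < r} \<subseteq> snd c ` fst c"
    "\<And>w v. w \<in> fst c \<Longrightarrow> p (snd c w - snd c u) < r \<Longrightarrow> chart_norm c w v \<le> (1 + 1) * p v"
    by (rule chart_ball[OF c open_UNIV UNIV_I zero_less_one, folded p_def]) blast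
  have "p (snd c u - snd c u) < r" using r(1) by simp
  then obtain L where "joins u u L" "L \<le> (1 + 1) * p (snd c u - snd c u)"
    using joins_chart_ball[OF cA(1) p.equiv_norm_axioms r(2,3) cA(2) _ cA(2)] by blast
  then show ?thesis using joins_nonneg by force
qed

text \<open>The points joined to \<open>u\<close> form an open set, and so do the others;
  connectedness leaves only the whole space. This keeps the infimum of lengths from ranging over the
  empty set.\<close>

lemma joins_ex: "\<exists>L. joins u v L"
proof -
  have nbhd: "\<exists>W. open W \<and> x \<in> W \<and> (\<forall>w\<in>W. \<exists>L. joins x w L)" for x
  proof -
    obtain c where c: "c \<in> charts_at A x" using exists_chart by blast
    have cA: "c \<in> A" "x \<in> fst c" using charts_atD[OF c] .
    define p where "p v = chart_norm c x v" for v
    interpret p: equiv_norm p using equiv_norm_N[OF c, folded p_def] .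
    obtain r where r: "r > 0" "{z. p (z - snd c x) < r} \<subseteq> snd c ` fst c"
      "\<And>u v. u \<in> fst c \<Longrightarrow> p (snd c u - snd c x) < r \<Longrightarrow> chart_norm c u v \<le> (1 + 1) * p v"
      by (rule chart_ball[OF c open_UNIV UNIV_I zero_less_one, folded p_def]) blast
    let ?W = "{w \<in> fst c. snd c w \<in> {z. p (z - snd c x) < r}}"
    have "open ?W" by (rule open_chart_preimage[OF cA(1) p.open_ball])
    moreover have "x \<in> ?W" using cA r(1) by simp
    moreover have "\<exists>L. joins x w L" if "w \<in> ?W" for w
    proof (rule joins_chart_ball[OF cA(1) p.equiv_norm_axioms r(2,3) cA(2)])
      show "p (snd c x - snd c x) < r" using r(1) by simp
      show "w \<in> fst c" "p (snd c w - snd c x) < r" using that by blast+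
    qed blast+
    ultimately show ?thesis by blast
  qed
  let ?S = "{v. \<exists>L. joins u v L}"
  have "open ?S"
  proof (subst open_subopen, intro ballI)
    fix x assume "x \<in> ?S"
    then obtain L where L: "joins u x L" by blast
    obtain W where W: "open W" "x \<in> W" "\<forall>w\<in>W. \<exists>L. joins x w L" using nbhd[of x] by (elim exE conjE)
    have "w \<in> ?S" if w: "w \<in> W" for w
    proof -
      obtain L' where "joins x w L'" using W(3) w by blast
      from joins_trans[OF L this] show ?thesis by blast
    qed
    then show "\<exists>T. open T \<and> x \<in> T \<and> T \<subseteq> ?S" using W(1,2) by blast
  qed
  moreover have "open (- ?S)"
  proof (subst open_subopen, intro ballI)
    fix x assume x: "x \<in> - ?S"
    obtain W where W: "open W" "x \<in> W" "\<forall>w\<in>W. \<exists>L. joins x w L" using nbhd[of x] by (elim exE conjE)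
    have "w \<in> - ?S" if w: "w \<in> W" for w
    proof
      assume "w \<in> ?S"
      then obtain L' where L': "joins u w L'" by blast
      obtain L where "joins x w L" using W(3) w by blast
      from joins_trans[OF L' joins_sym[OF this]] show False using x by blast
    qed
    then show "\<exists>T. open T \<and> x \<in> T \<and> T \<subseteq> - ?S" using W(1,2) by blast
  qed
  then have "closed ?S" by (simp only: closed_def)
  ultimately have "?S = {} \<or> ?S = UNIV"
    using connected[unfolded connected_clopen, THEN spec, of ?S]
    unfolding subtopology_UNIV by (simp only: open_openin closed_closedin simp_thms)
  then show ?thesis using joins_refl by blast
qed

section \<open>The infimum of lengths and its lower bounds\<close>

abbreviation dst :: "'x \<Rightarrow> 'x \<Rightarrow> real" where "dst \<equiv> finsler_dist A N"

lemma dist_le: "joins u v L \<Longrightarrow> dst u v \<le> L"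
  unfolding finsler_dist_eq by (intro cInf_lower bdd_belowI[of _ 0]) (auto intro: joins_nonneg)

lemma le_dist: "(\<And>L. joins u v L \<Longrightarrow> K \<le> L) \<Longrightarrow> K \<le> dst u v"
  unfolding finsler_dist_eq using joins_ex by (intro cInf_greatest) auto

lemma joins_less:
  assumes "dst u v < K"
  obtains L where "joins u v L" "L < K"
  using le_dist[of u v K] assms that by (meson leD leI)

text \<open>
  A path leaving a coordinate ball has a definite length: until it leaves, its coordinates are
  Cauchy, and a limit inside the ball would contradict the Hausdorff property. No regularity of the
  topology is needed.
\<close>

lemma length_lower_bound:
  assumes c: "c \<in> A" and q: "equiv_norm q" and sub: "{z. q (z - z0) < r} \<subseteq> snd c ` fst c"
    and bd: "\<And>u v. u \<in> fst c \<Longrightarrow> q (snd c u - z0) < r \<Longrightarrow> q v \<le> M * chart_norm c u v"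
    and M: "M > 0"
    and u: "u \<in> fst c" "q (snd c u - z0) < r" and L: "joins u v L"
  shows "(v \<in> fst c \<and> q (snd c v - snd c u) \<le> M * L) \<or> r - q (snd c u - z0) \<le> M * L"
proof -
  interpret q: equiv_norm q by (rule q)
  obtain \<sigma> a b where \<sigma>: "L = integral {a..b} (speed a b \<sigma>)" "a < b" "C1_path A a b \<sigma>" "\<sigma> a = u" "\<sigma> b = v"
    using L unfolding joins_def by blast
  have cont: "continuous_on {a..b} \<sigma>" using \<sigma>(3) by (simp add: C1_path_def)
  define O' where "O' = {w \<in> fst c. snd c w \<in> {z. q (z - z0) < r}}"
  have O': "open O'" unfolding O'_def by (rule open_chart_preimage[OF c q.open_ball])
  let ?l = "\<lambda>t. M * speed a b \<sigma> t"
  have l: "continuous_on {a..b} ?l" by (intro continuous_intros continuous_speed \<sigma>)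
  have piece: "q (snd c (\<sigma> t) - snd c (\<sigma> s)) \<le> integral {s..t} ?l"
    if st: "a \<le> s" "s \<le> t" "t \<le> b" and inO: "\<And>x. x \<in> {s..t} \<Longrightarrow> \<sigma> x \<in> O'" for s t
  proof -
    have sub': "{s..t} \<subseteq> {a..b}" using st by auto
    have "q ((snd c \<circ> \<sigma>) t - (snd c \<circ> \<sigma>) s) \<le> integral {s..t} ?l"
    proof (rule q.curve_bound[OF st(2)])
      fix x assume x: "x \<in> {s..t}"
      then have xab: "x \<in> {a..b}" and xO: "\<sigma> x \<in> O'" using sub' inO by auto
      then have xc: "\<sigma> x \<in> fst c" by (simp add: O'_def)
      show "((snd c \<circ> \<sigma>) has_vector_derivative velocity A \<sigma> {a..b} x c) (at x within {s..t})"
        using has_vector_derivative_within_subset[OF C1_path_velocity(2)[OF \<sigma>(2,3) c xab xc] sub'] .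
      show "q (velocity A \<sigma> {a..b} x c) \<le> ?l x"
        using bd[of "\<sigma> x" "velocity A \<sigma> {a..b} x c"] xO
          C1_path_velocity_lift[OF \<sigma>(2,3) xab charts_atI[OF c xc]] by (simp add: O'_def)
    qed (rule continuous_on_subset[OF l sub'])
    then show ?thesis by simp
  qed
  have le: "integral {s..t} ?l \<le> M * L" if st: "a \<le> s" "s \<le> t" "t \<le> b" for s t
  proof -
    have "integral {s..t} ?l \<le> integral {a..b} ?l"
    proof (rule integral_subset_le)
      show "{s..t} \<subseteq> {a..b}" using st by auto
      show "?l integrable_on {s..t}"
        by (rule integrable_continuous_real, rule continuous_on_subset[OF l]) (use st in auto)
      show "?l integrable_on {a..b}" by (rule integrable_continuous_real[OF l])
      show "\<forall>x\<in>{a..b}. 0 \<le> ?l x" using M speed_nonneg[OF \<sigma>(2,3)] by simp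
    qed
    then show ?thesis by (simp add: \<sigma>(1))
  qed
  show ?thesis
  proof (cases "\<forall>t\<in>{a..b}. \<sigma> t \<in> O'")
    case True
    then have "q (snd c v - snd c u) \<le> M * L" "v \<in> O'"
      using piece[of a b] le[of a b] \<sigma> by force+
    then show ?thesis by (simp add: O'_def)
  next
    case False
    show ?thesis
    proof (rule ccontr)
      assume neg: "\<not> ?thesis"
      obtain O'' where O'': "open O''" "O'' \<inter> {a..b} = \<sigma> -` O' \<inter> {a..b}"
        using cont O' unfolding continuous_on_open_invariant by blast
      have "compact ({a..b} - O'')" using O''(1) by (intro compact_diff) auto
      moreover have "{a..b} - O'' = {t \<in> {a..b}. \<sigma> t \<notin> O'}" using O''(2) by auto
      ultimately have "compact {t \<in> {a..b}. \<sigma> t \<notin> O'}" by simp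
      \<comment> \<open>The first parameter at which the path is outside \<open>O'\<close>.\<close>
      then obtain T where T: "T \<in> {a..b}" "\<sigma> T \<notin> O'" "\<And>t. t \<in> {a..b} \<Longrightarrow> \<sigma> t \<notin> O' \<Longrightarrow> T \<le> t"
        using compact_attains_inf[of "{t \<in> {a..b}. \<sigma> t \<notin> O'}"] False by blast
      have uO: "\<sigma> a \<in> O'" using u \<sigma>(4) by (simp add: O'_def)
      then have aT: "a < T" using T by (metis atLeastAtMost_iff order_le_less)
      have inO: "\<sigma> t \<in> O'" if "a \<le> t" "t < T" for t using T that by force
      define \<gamma> where "\<gamma> t = snd c (\<sigma> t)" for t
      obtain m where m: "m > 0" "\<And>v. m * norm v \<le> q v" using q.lower_bound by blast
      let ?I = "\<lambda>t. integral {a..t} ?l"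
      \<comment> \<open>Increments of \<open>\<gamma>\<close> are controlled by those of the
        indefinite integral of the speed, which is uniformly continuous; hence
        \<open>\<gamma>\<close> has a limit at \<open>T\<close>.\<close>
      have step: "m * dist (\<gamma> t) (\<gamma> s) \<le> \<bar>?I t - ?I s\<bar>" if "a \<le> s" "s \<le> t" "t < T" for s t
      proof -
        have "?l integrable_on {a..t}"
          by (rule integrable_continuous_real, rule continuous_on_subset[OF l]) (use that T in auto)
        then have "?I s + integral {s..t} ?l = ?I t"
          using that by (intro Henstock_Kurzweil_Integration.integral_combine)
        moreover have "q (\<gamma> t - \<gamma> s) \<le> integral {s..t} ?l"
          unfolding \<gamma>_def using that T inO by (intro piece) auto
        ultimately show ?thesis using m(2)[of "\<gamma> t - \<gamma> s"] by (simp add: dist_norm)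
      qed
      have "uniformly_continuous_on {a..b} ?I"
        using indefinite_integral_continuous_1[OF integrable_continuous_real[OF l]]
        by (rule compact_uniformly_continuous) simp
      moreover have near: "dist (\<gamma> t) (\<gamma> s) < e"
        if "s \<in> {a..<T}" "t \<in> {a..<T}" "dist (?I t) (?I s) < m * e" for s t e
      proof -
        have "m * dist (\<gamma> t) (\<gamma> s) \<le> \<bar>?I t - ?I s\<bar>"
          using step[of s t] step[of t s] that
          by (cases "s \<le> t") (auto simp: Real_Vector_Spaces.metric_space_class.dist_commute abs_minus_commute)
        also have "\<dots> < m * e" using that(3) by (simp add: dist_real_def)
        finally show ?thesis using m(1) by simp
      qed
      ultimately have "uniformly_continuous_on {a..<T} \<gamma>"
        unfolding uniformly_continuous_on_def
      proof (intro allI impI)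
        fix e :: real
        assume I: "\<forall>e>0. \<exists>d>0. \<forall>x\<in>{a..b}. \<forall>x'\<in>{a..b}. dist x' x < d \<longrightarrow> dist (?I x') (?I x) < e" and "e > 0"
        then have "m * e > 0" using m(1) by simp
        with I obtain d where "d > 0"
          "\<forall>x\<in>{a..b}. \<forall>x'\<in>{a..b}. dist x' x < d \<longrightarrow> dist (?I x') (?I x) < m * e" by blast
        moreover have "{a..<T} \<subseteq> {a..b}" using T(1) by auto
        ultimately show "\<exists>d>0. \<forall>x\<in>{a..<T}. \<forall>x'\<in>{a..<T}. dist x' x < d \<longrightarrow> dist (\<gamma> x') (\<gamma> x) < e"
          using near by (meson subsetD)
      qed
      moreover have Tcl: "T \<in> closure {a..<T}" using aT by simp
      ultimately obtain \<zeta> where \<zeta>: "(\<gamma> \<longlongrightarrow> \<zeta>) (at T within {a..<T})"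
        by (rule uniformly_continuous_on_extension_at_closure)
      have nontriv: "at T within {a..<T} \<noteq> bot"
        using Tcl by (simp add: at_within_eq_bot_iff)
      \<comment> \<open>Under the negated claim the path is too short to reach the sphere of radius
        \<open>r\<close>, so this bound puts the limit inside the ball.\<close>
      have "q (\<zeta> - \<gamma> a) \<le> M * L"
      proof (rule tendsto_upperbound[OF q.tendsto[OF tendsto_diff[OF \<zeta> tendsto_const]]])
        have "q (\<gamma> t - \<gamma> a) \<le> M * L" if "t \<in> {a..<T}" for t
          using piece[of a t] le[of a t] that T inO unfolding \<gamma>_def by force
        then show "\<forall>\<^sub>F t in at T within {a..<T}. q (\<gamma> t - \<gamma> a) \<le> M * L"
          by (simp add: eventually_at_filter)
      qed (rule nontriv)
      moreover have "q (\<zeta> - z0) \<le> q (\<zeta> - \<gamma> a) + q (\<gamma> a - z0)" by (rule q.diff_triangle)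
      moreover have "\<gamma> a = snd c u" by (simp add: \<gamma>_def \<sigma>(4))
      ultimately have \<zeta>r: "q (\<zeta> - z0) < r" using neg by simp
      then have \<zeta>c: "\<zeta> \<in> snd c ` fst c" using sub by blast
      have "((\<lambda>t. chart_inv c (\<gamma> t)) \<longlongrightarrow> chart_inv c \<zeta>) (at T within {a..<T})"
      proof (rule continuous_on_tendsto_compose[OF continuous_chart_inv[OF c] \<zeta> \<zeta>c])
        have "\<gamma> t \<in> snd c ` fst c" if "t \<in> {a..<T}" for t
          using inO[of t] that by (simp add: \<gamma>_def O'_def)
        then show "\<forall>\<^sub>F t in at T within {a..<T}. \<gamma> t \<in> snd c ` fst c"
          by (simp add: eventually_at_filter)
      qed
      moreover have "\<forall>\<^sub>F t in at T within {a..<T}. chart_inv c (\<gamma> t) = \<sigma> t"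
      proof -
        have "chart_inv c (\<gamma> t) = \<sigma> t" if "t \<in> {a..<T}" for t
          using inO[of t] that c by (simp add: \<gamma>_def O'_def)
        then show ?thesis by (simp add: eventually_at_filter)
      qed
      ultimately have "(\<sigma> \<longlongrightarrow> chart_inv c \<zeta>) (at T within {a..<T})"
        by (simp add: tendsto_cong)
      moreover have "(\<sigma> \<longlongrightarrow> \<sigma> T) (at T within {a..<T})"
      proof -
        have "(\<sigma> \<longlongrightarrow> \<sigma> T) (at T within {a..b})" using cont T(1) by (simp add: continuous_on_def)
        then show ?thesis by (rule tendsto_within_subset) (use T in auto)
      qed
      ultimately have "\<sigma> T = chart_inv c \<zeta>" using nontriv tendsto_unique by blast
      then have "\<sigma> T \<in> O'" using \<zeta>c \<zeta>r c by (simp add: O'_def chart_inv_in)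
      then show False using T(2) by simp
    qed
  qed
qed

text \<open>Either alternative of \<open>length_lower_bound\<close> yields
  \<open>K \<le> M * L\<close>, for every length \<open>L\<close> over which the infimum is
  taken.\<close>

lemma dist_lower_bound:
  assumes c: "c \<in> A" and q: "equiv_norm q" and sub: "{z. q (z - z0) < r} \<subseteq> snd c ` fst c"
    and bd: "\<And>u v. u \<in> fst c \<Longrightarrow> q (snd c u - z0) < r \<Longrightarrow> q v \<le> M * chart_norm c u v"
    and M: "M > 0"
    and u: "u \<in> fst c" "q (snd c u - z0) < r"
    and K: "v \<in> fst c \<Longrightarrow> K \<le> q (snd c v - snd c u)" "K \<le> r - q (snd c u - z0)"
  shows "K \<le> M * dst u v"
proof -
  have "K / M \<le> dst u v"
  proof (rule le_dist)
    fix L assume "joins u v L"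
    from length_lower_bound[OF c q sub bd M u this] K have "K \<le> M * L" by fastforce
    then show "K / M \<le> L" using M by (simp add: pos_divide_le_eq mult.commute)
  qed
  then show ?thesis using M by (simp add: pos_divide_le_eq mult.commute)
qed

end

section \<open>Metric axioms and the manifold topology\<close>

context finsler
begin

lemma dist_commute: "dst u v = dst v u"
proof -
  have "{L. joins u v L} = {L. joins v u L}" using joins_sym by blast
  then show ?thesis unfolding finsler_dist_eq by simp
qed

lemma dist_nonneg: "0 \<le> dst u v"
  by (rule le_dist) (rule joins_nonneg)

lemma dist_self: "dst u u = 0"
  using dist_le[OF joins_refl, of u] dist_nonneg[of u u] by simp

lemma dist_triangle: "dst u w \<le> dst u v + dst v w"
proof (rule field_le_epsilon)
  fix e :: real assume e: "e > 0"
  obtain L where L: "joins u v L" "L < dst u v + e / 2"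
    using joins_less[of u v "dst u v + e / 2"] e by auto
  obtain L' where L': "joins v w L'" "L' < dst v w + e / 2"
    using joins_less[of v w "dst v w + e / 2"] e by auto
  show "dst u w \<le> dst u v + dst v w + e"
    using dist_le[OF joins_trans[OF L(1) L'(1)]] L(2) L'(2) by linarith
qed

lemma dist_ball_in_open:
  assumes W: "open W" "x \<in> W"
  obtains r where "r > 0" "\<And>v. dst x v < r \<Longrightarrow> v \<in> W"
proof -
  obtain c where c: "c \<in> charts_at A x" using exists_chart by blast
  note cA = charts_atD[OF c]
  define p where "p v = chart_norm c x v" for v
  interpret p: equiv_norm p using equiv_norm_N[OF c, folded p_def] .
  obtain r where r: "r > 0" "{z. p (z - snd c x) < r} \<subseteq> snd c ` fst c"
    "\<And>u. u \<in> fst c \<Longrightarrow> p (snd c u - snd c x) < r \<Longrightarrow> u \<in> W"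
    "\<And>u v. u \<in> fst c \<Longrightarrow> p (snd c u - snd c x) < r \<Longrightarrow> p v / (1 + 1) \<le> chart_norm c u v"
    by (rule chart_ball[OF c W zero_less_one, folded p_def]) blast
  have bd: "p v \<le> 2 * chart_norm c u v" if "u \<in> fst c" "p (snd c u - snd c x) < r" for u v
    using r(4)[OF that, of v] by simp
  have "v \<in> W" if v: "dst x v < r / 2" for v
  proof (rule ccontr)
    assume neg: "v \<notin> W"
    have "r \<le> 2 * dst x v"
    proof (rule dist_lower_bound[OF cA(1) p.equiv_norm_axioms r(2) bd _ cA(2)])
      show "p (snd c x - snd c x) < r" using r(1) by simp
      show "r \<le> r - p (snd c x - snd c x)" by simp
      show "r \<le> p (snd c v - snd c x)" if "v \<in> fst c"
        using r(3)[OF that] neg by (meson leI)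
    qed simp_all
    then show False using v by simp
  qed
  then show thesis using that[of "r / 2"] r(1) by simp
qed

lemma dist_eq_0:
  assumes "dst u v = 0"
  shows "u = v"
proof (rule ccontr)
  assume "u \<noteq> v"
  then have "open (- {v})" "u \<in> - {v}" by auto
  then obtain r where "r > 0" "\<And>w. dst u w < r \<Longrightarrow> w \<in> - {v}"
    by (rule dist_ball_in_open) blast
  then show False using assms by force
qed

lemma metric: "Metric_space UNIV dst"
proof
  show "dst x y = 0 \<longleftrightarrow> x = y" for x y
    using dist_eq_0 dist_self by blast
qed (rule dist_nonneg dist_commute dist_triangle)+

sublocale d: Metric_space "UNIV :: 'x set" dst
  by (rule metric)

lemma finsler_ball_eq: "finsler_ball A N x r = {v. dst x v < r}"
  by (simp add: d.mball_def)

lemma local_comparison: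
  assumes c: "c \<in> charts_at A x" and W: "open W" "x \<in> W" and e: "e > 0"
  defines "p \<equiv> \<lambda>v. chart_norm c x v"
  obtains r where "r > 0" "{z. p (z - snd c x) < r} \<subseteq> snd c ` fst c"
    "\<And>u. u \<in> fst c \<Longrightarrow> p (snd c u - snd c x) < r \<Longrightarrow> u \<in> W"
    "\<And>u v. u \<in> fst c \<Longrightarrow> p (snd c u - snd c x) < r \<Longrightarrow> v \<in> fst c \<Longrightarrow> p (snd c v - snd c x) < r \<Longrightarrow>
      dst u v \<le> (1 + e) * p (snd c u - snd c v) \<and>
      p (snd c u - snd c v) \<le> (1 + e) * dst u v"
proof -
  note cA = charts_atD[OF c]
  interpret p: equiv_norm p unfolding p_def by (rule equiv_norm_N[OF c])
  obtain r where r: "r > 0" "{z. p (z - snd c x) < r} \<subseteq> snd c ` fst c"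
    "\<And>u. u \<in> fst c \<Longrightarrow> p (snd c u - snd c x) < r \<Longrightarrow> u \<in> W"
    "\<And>u v. u \<in> fst c \<Longrightarrow> p (snd c u - snd c x) < r \<Longrightarrow>
      p v / (1 + e) \<le> chart_norm c u v \<and> chart_norm c u v \<le> (1 + e) * p v"
    unfolding p_def by (rule chart_ball[OF c W e]) blast
  have bd: "p v \<le> (1 + e) * chart_norm c u v" "chart_norm c u v \<le> (1 + e) * p v"
    if "u \<in> fst c" "p (snd c u - snd c x) < r" for u v
    using r(4)[OF that, of v] e by (simp_all add: pos_divide_le_eq mult.commute)
  \<comment> \<open>Points within \<open>r / 3\<close> of the centre are less than
    \<open>2 * r / 3\<close> apart in coordinates, while leaving the ball of radius \<open>r\<close>
    from one of them costs more than that. So a detour through the outside cannot spoil the lower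
    estimate.\<close>
  show thesis
  proof (rule that[of "r / 3"])
    show "r / 3 > 0" "{z. p (z - snd c x) < r / 3} \<subseteq> snd c ` fst c"
      using r(1,2) by force+
    show "u \<in> W" if "u \<in> fst c" "p (snd c u - snd c x) < r / 3" for u
      using r(3)[OF that(1)] that(2) r(1) by simp
    fix u v assume u: "u \<in> fst c" "p (snd c u - snd c x) < r / 3" and v: "v \<in> fst c" "p (snd c v - snd c x) < r / 3"
    have ur: "p (snd c u - snd c x) < r" and vr: "p (snd c v - snd c x) < r" using u(2) v(2) r(1) by simp_all
    obtain L where "joins u v L" "L \<le> (1 + e) * p (snd c v - snd c u)"
      by (rule joins_chart_ball[OF cA(1) p.equiv_norm_axioms r(2) bd(2) u(1) ur v(1) vr])
    then have "dst u v \<le> (1 + e) * p (snd c v - snd c u)" using dist_le by fastforce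
    moreover have "p (snd c u - snd c v) \<le> (1 + e) * dst u v"
    proof (rule dist_lower_bound[OF cA(1) p.equiv_norm_axioms r(2) bd(1) _ u(1) ur])
      show "p (snd c u - snd c v) \<le> p (snd c v - snd c u)" using p.minus_commute by (rule eq_refl)
      show "p (snd c u - snd c v) \<le> r - p (snd c u - snd c x)"
        using p.diff_triangle[of "snd c u" "snd c v" "snd c x"] p.minus_commute[of "snd c x" "snd c v"] u(2) v(2)
        by linarith
    qed (use e in simp_all)
    ultimately show "dst u v \<le> (1 + e) * p (snd c u - snd c v) \<and>
      p (snd c u - snd c v) \<le> (1 + e) * dst u v"
      using p.minus_commute by metis
  qed
qed

lemma open_in_dist_ball:
  assumes "r > 0"
  obtains W where "open W" "x \<in> W" "\<And>v. v \<in> W \<Longrightarrow> dst x v < r"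
proof -
  obtain c where c: "c \<in> charts_at A x" using exists_chart by blast
  note cA = charts_atD[OF c]
  define p where "p v = chart_norm c x v" for v
  interpret p: equiv_norm p using equiv_norm_N[OF c, folded p_def] .
  obtain r' where r': "r' > 0"
    "\<And>u v. u \<in> fst c \<Longrightarrow> p (snd c u - snd c x) < r' \<Longrightarrow> v \<in> fst c \<Longrightarrow> p (snd c v - snd c x) < r' \<Longrightarrow>
      dst u v \<le> (1 + 1) * p (snd c u - snd c v)"
    by (rule local_comparison[OF c open_UNIV UNIV_I zero_less_one, folded p_def]) blast
  let ?W = "{w \<in> fst c. snd c w \<in> {z. p (z - snd c x) < min r' (r / 2)}}"
  show thesis
  proof (rule that)
    show "open ?W" by (rule open_chart_preimage[OF cA(1) p.open_ball])
    show "x \<in> ?W" using cA r'(1) assms by simp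
    fix v assume v: "v \<in> ?W"
    then have "dst x v \<le> (1 + 1) * p (snd c x - snd c v)"
      using cA(2) r'(1) by (intro r'(2)) auto
    also have "\<dots> < r" using v p.minus_commute[of "snd c x" "snd c v"] by simp
    finally show "dst x v < r" .
  qed
qed

lemma mtopology_eq: "d.mtopology = euclidean"
proof -
  have "openin d.mtopology S \<longleftrightarrow> open S" for S
  proof
    assume S: "openin d.mtopology S"
    show "open S"
    proof (subst open_subopen, intro ballI)
      fix x assume "x \<in> S"
      then obtain r where r: "r > 0" "d.mball x r \<subseteq> S" using S unfolding d.openin_mtopology by blast
      obtain W where "open W" "x \<in> W" "\<And>v. v \<in> W \<Longrightarrow> dst x v < r"
        by (rule open_in_dist_ball[OF r(1), of x]) blast
      then show "\<exists>T. open T \<and> x \<in> T \<and> T \<subseteq> S" using r(2) unfolding finsler_ball_eq by blast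
    qed
  next
    assume S: "open S"
    show "openin d.mtopology S"
      unfolding d.openin_mtopology
    proof (intro conjI allI impI)
      fix x assume "x \<in> S"
      then obtain r where "r > 0" "\<And>v. dst x v < r \<Longrightarrow> v \<in> S"
        using dist_ball_in_open[OF S] by blast
      then show "\<exists>r>0. d.mball x r \<subseteq> S" unfolding finsler_ball_eq by blast
    qed simp
  qed
  then show ?thesis by (simp add: topology_eq)
qed

lemma open_dist_ball: "open {v. dst x v < r}"
  using d.openin_mball[of x r] unfolding mtopology_eq finsler_ball_eq by simp

lemma complete_LIMSEQ:
  assumes complete: "finsler_complete A N"
    and s: "\<And>e. e > 0 \<Longrightarrow> \<exists>M. \<forall>m\<ge>M. \<forall>n\<ge>M. dst (s m) (s n) < e"
  obtains l where "s \<longlonglongrightarrow> l"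
proof -
  have "d.MCauchy s" using s unfolding d.MCauchy_def by auto
  then obtain l where "limitin d.mtopology s l sequentially"
    using complete unfolding finsler_complete_def d.mcomplete_def by blast
  then show thesis using that unfolding mtopology_eq by simp
qed

end

section \<open>Pseudo-Jacobians of maps between Finsler manifolds\<close>

locale finsler_map = X: finsler A NX + Y: finsler B NY
  for A :: "('x::t2_space, 'e::banach) chart set" and NX
    and B :: "('y::t2_space, 'f::banach) chart set" and NY +
  fixes f :: "'x \<Rightarrow> 'y" and J :: "'x \<Rightarrow> (('x, 'e) tvec \<Rightarrow> ('y, 'f) tvec) set"
  assumes smooth: "smooth_norm B NY"
    and strong: "strong_pseudo_jacobian_mapping A B f J"
begin

abbreviation index :: "'x \<Rightarrow> ennreal" where "index \<equiv> regularity_index A NX B NY f J"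

lemma tangent_op_change:
  assumes c: "c \<in> charts_at A x" "c' \<in> charts_at A x" and d: "d \<in> charts_at B y" "d' \<in> charts_at B y"
  shows "tangent_op A B c' d' x y T =
    tangent_op A B c d x y (Blinfun (transition_deriv d' d y) o\<^sub>L T o\<^sub>L Blinfun (transition_deriv c c' x))"
proof
  fix \<xi>
  show "tangent_op A B c' d' x y T \<xi> =
    tangent_op A B c d x y (Blinfun (transition_deriv d' d y) o\<^sub>L T o\<^sub>L Blinfun (transition_deriv c c' x)) \<xi>"
  proof (cases "\<xi> \<in> tangent_space A x")
    case True
    then have "\<xi> c' = transition_deriv c c' x (\<xi> c)" using c unfolding tangent_space_def by blast
    then show ?thesis
      using True X.bounded_linear_transition_deriv[OF c] Y.bounded_linear_transition_deriv[OF d(2,1)]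
        Y.chart_lift_change[OF d(2,1)]
      by (simp add: tangent_op_def bounded_linear_Blinfun_apply)
  qed (simp add: tangent_op_def)
qed

lemma tangent_op_lift:
  assumes "c \<in> charts_at A x" "d \<in> charts_at B y"
  shows "tangent_op A B c d x y T (chart_lift A c x v) = chart_lift B d y (blinfun_apply T v)"
  using assms by (simp add: tangent_op_def)

text \<open>Two representations of the same set \<open>J u\<close> are compared by cancelling this
  map.\<close>

lemma inj_tangent_op:
  assumes c: "c \<in> charts_at A x" and d: "d \<in> charts_at B y"
  shows "inj (tangent_op A B c d x y)"
proof (rule injI, rule blinfun_eqI)
  fix S T v assume "tangent_op A B c d x y S = tangent_op A B c d x y T"
  then have "tangent_op A B c d x y S (chart_lift A c x v) d = tangent_op A B c d x y T (chart_lift A c x v) d"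
    by simp
  then show "blinfun_apply S v = blinfun_apply T v" by (simp add: tangent_op_lift c d)
qed

text \<open>Linearity moves convex hulls between tangent operators and their coordinate
  representations.\<close>

lemma linear_tangent_op:
  assumes d: "d \<in> charts_at B y"
  shows "linear (tangent_op A B c d x y)"
proof (rule linearI)
  note lin = Y.linear_chart_lift[OF d]
  show "tangent_op A B c d x y (S + T) = tangent_op A B c d x y S + tangent_op A B c d x y T" for S T
    by (rule ext) (simp add: tangent_op_def blinfun.add_left linear_add[OF lin])
  show "tangent_op A B c d x y (r *\<^sub>R T) = r *\<^sub>R tangent_op A B c d x y T" for r T
    by (rule ext) (simp add: tangent_op_def scaleR_fun_def[of r "\<lambda>\<xi>. if _ \<xi> then _ \<xi> else _"]
        blinfun.scaleR_left linear_scale[OF lin])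
qed

lemma jacobian_repD:
  assumes "jacobian_rep A B f J x c d Jb"
  shows "c \<in> charts_at A x" "d \<in> charts_at B (f x)" "f ` fst c \<subseteq> fst d"
    "pseudo_jacobian_map (snd c ` fst c) (snd d \<circ> f \<circ> chart_inv c) Jb"
    "locally_bounded_map (snd c ` fst c) Jb"
    "\<And>u. u \<in> fst c \<Longrightarrow> J u = tangent_op A B c d u (f u) ` Jb (snd c u)"
  using assms unfolding jacobian_rep_def by blast+

text \<open>
  The adapted charts need not be among those that witness strength, so that convexity and compactness
  have to be carried over from one representation to another.
\<close>

lemma jacobian_rep_convex_compact:
  assumes rep: "jacobian_rep A B f J x c d Jb" and u: "u \<in> fst c"
  shows "convex (Jb (snd c u))" "compactin weak_operator_topology (Jb (snd c u))"
proof -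
  note r = jacobian_repD[OF rep]
  obtain c' d' Jb' where rep': "jacobian_rep A B f J u c' d' Jb'"
    and J': "\<And>z. z \<in> snd c' ` fst c' \<Longrightarrow> convex (Jb' z) \<and> compactin weak_operator_topology (Jb' z)"
    using strong unfolding strong_pseudo_jacobian_mapping_def by meson
  note r' = jacobian_repD[OF rep']
  have cu: "c \<in> charts_at A u" using X.charts_atD(1)[OF r(1)] u by (rule X.charts_atI)
  have "f u \<in> fst d" using r(3) u by blast
  with Y.charts_atD(1)[OF r(2)] have du: "d \<in> charts_at B (f u)" by (rule Y.charts_atI)
  note u' = X.charts_atD(2)[OF r'(1)]
  define F where "F T = Blinfun (transition_deriv d' d (f u)) o\<^sub>L T o\<^sub>L Blinfun (transition_deriv c c' u)" for T
  have "tangent_op A B c d u (f u) ` Jb (snd c u) = tangent_op A B c' d' u (f u) ` Jb' (snd c' u)"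
    using r(6)[OF u] r'(6)[OF u'] by simp
  also have "\<dots> = tangent_op A B c d u (f u) ` F ` Jb' (snd c' u)"
    unfolding tangent_op_change[OF cu r'(1) du r'(2)] F_def image_image ..
  finally have eq: "Jb (snd c u) = F ` Jb' (snd c' u)"
    by (rule iffD1[OF inj_image_eq_iff[OF inj_tangent_op[OF cu du]]])
  have lin: "linear F"
    by (rule linearI)
      (auto intro!: blinfun_eqI simp: F_def blinfun.bilinear_simps bounded_linear_Blinfun_apply)
  have J'u: "convex (Jb' (snd c' u))" "compactin weak_operator_topology (Jb' (snd c' u))"
    using J' u' by blast+
  show "convex (Jb (snd c u))" unfolding eq using lin J'u(1) by (rule convex_linear_image)
  show "compactin weak_operator_topology (Jb (snd c u))"
    unfolding eq using J'u(2) unfolding F_def by (rule image_compactin) (rule wot_continuous_compose)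
qed

lemma adapted_charts_rep:
  obtains c d Jb where "adapted_charts A B f J x = (c, d)" "jacobian_rep A B f J x c d Jb"
proof -
  have "\<exists>cd. case cd of (c, d) \<Rightarrow> \<exists>Jb. jacobian_rep A B f J x c d Jb"
  proof -
    obtain c d Jb where "jacobian_rep A B f J x c d Jb"
      using strong unfolding strong_pseudo_jacobian_mapping_def by meson
    then show ?thesis by (intro exI[of _ "(c, d)"]) auto
  qed
  from someI_ex[OF this] have "case adapted_charts A B f J x of (c, d) \<Rightarrow> \<exists>Jb. jacobian_rep A B f J x c d Jb"
    unfolding adapted_charts_def .
  then show thesis using that by (cases "adapted_charts A B f J x") auto
qed

text \<open>The local representations of \<open>J\<close> carry the continuity of \<open>f\<close>
  in coordinates; the charts transport it back.\<close>

lemma continuous_f: "continuous_on UNIV f"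
  unfolding continuous_on_eq_continuous_at[OF open_UNIV]
proof
  fix x
  obtain c d Jb where rep: "jacobian_rep A B f J x c d Jb" using adapted_charts_rep by metis
  note r = jacobian_repD[OF rep]
  note cA = X.charts_atD[OF r(1)] and dB = Y.charts_atD[OF r(2)]
  let ?g = "snd d \<circ> f \<circ> chart_inv c"
  have "continuous_on (snd c ` fst c) ?g" using r(4) unfolding pseudo_jacobian_map_def by blast
  then have "continuous_on (fst c) (\<lambda>u. ?g (snd c u))"
    using X.continuous_chart[OF cA(1)] by (rule continuous_on_compose2) simp
  then have "continuous_on (fst c) (\<lambda>u. chart_inv d (?g (snd c u)))"
    by (rule continuous_on_compose2[OF Y.continuous_chart_inv[OF dB(1)]])
      (use r(3) cA(1) in auto)
  moreover have "chart_inv d (?g (snd c u)) = f u" if u: "u \<in> fst c" for u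
  proof -
    have "f u \<in> fst d" using r(3) u by blast
    then show ?thesis using u cA(1) dB(1) by simp
  qed
  ultimately have "continuous_on (fst c) f" by (rule continuous_on_eq)
  then show "isCont f x"
    using X.open_domain[OF cA(1)] cA(2) by (simp add: continuous_on_eq_continuous_at)
qed

text \<open>For a small radius every \<open>u\<close> of the ball lies in the domain of
  \<open>c\<close>, and transporting an operator from \<open>u\<close> to \<open>x\<close> keeps its
  coordinate representation.\<close>

lemma jacobian_ball_eq:
  assumes ch: "adapted_charts A B f J x = (c, d)" and rep: "jacobian_rep A B f J x c d Jb"
    and R: "R \<in> small_radii A NX B f J x"
  shows "jacobian_ball A NX B f J x R =
    tangent_op A B c d x (f x) ` (\<Union>u\<in>finsler_ball A NX x R. Jb (snd c u))"
proof -
  note r = jacobian_repD[OF rep]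
  have sub: "finsler_ball A NX x R \<subseteq> fst c" using R ch unfolding small_radii_def by simp
  have "transport_op A B f c d x u ` J u = tangent_op A B c d x (f x) ` Jb (snd c u)"
    if "u \<in> finsler_ball A NX x R" for u
  proof -
    have u: "u \<in> fst c" using that sub by blast
    then have fu: "f u \<in> fst d" using r(3) by blast
    have cu: "c \<in> charts_at A u" using X.charts_atD(1)[OF r(1)] u by (rule X.charts_atI)
    have du: "d \<in> charts_at B (f u)" using Y.charts_atD(1)[OF r(2)] fu by (rule Y.charts_atI)
    have "transport_op A B f c d x u (tangent_op A B c d u (f u) T) = tangent_op A B c d x (f x) T" for T
      by (rule ext) (simp add: transport_op_def tangent_op_lift[OF cu du] du, simp add: tangent_op_def)
    then show ?thesis unfolding r(6)[OF u] image_image by simp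
  qed
  then show ?thesis unfolding jacobian_ball_def ch by (simp add: image_UN)
qed

lemma dual_lower_bound_C_finsler:
  assumes c: "c \<in> charts_at A x" and d: "d \<in> charts_at B y"
    and k: "ennreal k \<le> C_finsler A NX B NY x y (tangent_op A B c d x y T)"
  shows "dual_lower_bound (X.chart_norm c x) (Y.chart_norm d y) k T"
proof -
  define p where "p v = X.chart_norm c x v" for v
  define q where "q v = Y.chart_norm d y v" for v
  interpret p: equiv_norm p using X.equiv_norm_N[OF c, folded p_def] .
  interpret q: equiv_norm q using Y.equiv_norm_N[OF d, folded q_def] .
  have "dual_lower_bound p q k T"
    unfolding dual_lower_bound_def
  proof (intro allI impI, elim conjE exE)
    fix \<eta> :: "'f \<Rightarrow>\<^sub>L real" and k' w
    assume le: "\<forall>w. \<bar>blinfun_apply \<eta> w\<bar> \<le> q w" and w: "w \<noteq> 0" "blinfun_apply \<eta> w = q w" and k': "k' < k"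
    define \<eta>' where "\<eta>' \<xi> = blinfun_apply \<eta> (\<xi> d)" for \<xi> :: "('y, 'f) tvec"
    have lin: "lin_on (tangent_space B y) \<eta>'"
      by (simp add: lin_on_def \<eta>'_def blinfun.bilinear_simps scaleR_fun_def)
    have dual: "dual_norm_on (tangent_space B y) (NY y) \<eta>' = 1"
      unfolding dual_norm_on_def
    proof (rule antisym)
      show "(SUP \<xi>\<in>{\<xi> \<in> tangent_space B y. NY y \<xi> \<le> 1}. ennreal \<bar>\<eta>' \<xi>\<bar>) \<le> 1"
      proof (rule SUP_least)
        fix \<xi> assume \<xi>: "\<xi> \<in> {\<xi> \<in> tangent_space B y. NY y \<xi> \<le> 1}"
        then have "\<bar>\<eta>' \<xi>\<bar> \<le> NY y \<xi>"
          using le[THEN spec, of "\<xi> d"] Y.chart_lift_tangent_eq[OF d, of \<xi>] by (simp add: \<eta>'_def q_def)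
        then have "\<bar>\<eta>' \<xi>\<bar> \<le> 1" using \<xi> by simp
        then show "ennreal \<bar>\<eta>' \<xi>\<bar> \<le> 1" using ennreal_leI by fastforce
      qed
      let ?\<xi> = "chart_lift B d y ((1 / q w) *\<^sub>R w)"
      have qw: "q w > 0" using w(1) by (rule q.pos)
      have "q ((1 / q w) *\<^sub>R w) = 1" using qw w(1) unfolding q.scale by simp
      then have "?\<xi> \<in> {\<xi> \<in> tangent_space B y. NY y \<xi> \<le> 1}" using d by (simp add: q_def)
      moreover have "\<eta>' ?\<xi> = 1"
        using w d by (simp add: \<eta>'_def blinfun.bilinear_simps)
      ultimately show "1 \<le> (SUP \<xi>\<in>{\<xi> \<in> tangent_space B y. NY y \<xi> \<le> 1}. ennreal \<bar>\<eta>' \<xi>\<bar>)"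
        by (intro SUP_upper2[of ?\<xi>]) simp_all
    qed
    have "ennreal k \<le> dual_norm_on (tangent_space A x) (NX x) (\<eta>' \<circ> tangent_op A B c d x y T)"
      using k unfolding C_finsler_def by (rule order_trans) (rule INF_lower, use lin dual in simp)
    then have ge: "ennreal k \<le> (SUP \<xi>\<in>{\<xi> \<in> tangent_space A x. NX x \<xi> \<le> 1}.
        ennreal \<bar>(\<eta>' \<circ> tangent_op A B c d x y T) \<xi>\<bar>)"
      unfolding dual_norm_on_def .
    show "\<exists>v. p v \<le> 1 \<and> blinfun_apply \<eta> (blinfun_apply T v) < - k'"
    proof (cases "k' < 0")
      case True
      then show ?thesis by (intro exI[of _ 0]) (simp add: blinfun.bilinear_simps)
    next
      case False
      then have "ennreal k' < ennreal k" using k' by (simp add: ennreal_less_iff)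
      with ge obtain \<xi> where \<xi>: "\<xi> \<in> tangent_space A x" "NX x \<xi> \<le> 1"
        "ennreal k' < ennreal \<bar>\<eta>' (tangent_op A B c d x y T \<xi>)\<bar>"
        unfolding less_SUP_iff[symmetric] by (force dest: less_le_trans simp: less_SUP_iff)
      define v where "v = \<xi> c"
      have \<xi>v: "\<xi> = chart_lift A c x v" unfolding v_def by (rule X.chart_lift_tangent_eq[OF c \<xi>(1), symmetric])
      have pv: "p v \<le> 1" using \<xi>(2) by (simp add: p_def \<xi>v)
      have "\<eta>' (tangent_op A B c d x y T \<xi>) = blinfun_apply \<eta> (blinfun_apply T v)"
        unfolding \<xi>v tangent_op_lift[OF c d] by (simp add: \<eta>'_def d)
      then have "k' < \<bar>blinfun_apply \<eta> (blinfun_apply T v)\<bar>"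
        using \<xi>(3) False by (simp add: ennreal_less_iff)
      then show ?thesis
        using pv p.minus[of v]
        by (cases "blinfun_apply \<eta> (blinfun_apply T v) < 0")
          (auto intro: exI[of _ v] exI[of _ "- v"] simp: blinfun.bilinear_simps)
    qed
  qed
  then show ?thesis by (simp only: p_def[abs_def] q_def[abs_def])
qed

lemma inj_blinfun_of_bij:
  assumes c: "c \<in> charts_at A x" and d: "d \<in> charts_at B y"
    and bij: "bij_betw (tangent_op A B c d x y T) (tangent_space A x) (tangent_space B y)"
  shows "inj (blinfun_apply T)"
proof (rule injI)
  fix v w assume "blinfun_apply T v = blinfun_apply T w"
  then have "tangent_op A B c d x y T (chart_lift A c x v) = tangent_op A B c d x y T (chart_lift A c x w)"
    by (simp add: tangent_op_lift[OF c d])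
  then have "chart_lift A c x v = chart_lift A c x w"
    using bij c unfolding bij_betw_def by (auto dest!: inj_onD)
  then have "chart_lift A c x v c = chart_lift A c x w c" by simp
  then show "v = w" using c by simp
qed

text \<open>\<open>local_inverse\<close> is applied with a constant \<open>k'\<close> strictly
  between \<open>k\<close> and the index, in the norms frozen at \<open>x\<close> and
  \<open>f x\<close>. Passing from these norms to the Finsler distances costs one factor
  \<open>1 + e\<close> in each manifold, and the gap pays for both.\<close>

theorem local_inverse_manifold:
  assumes reg: "jacobian_regular A NX B NY f J x" and k: "0 < k" "ennreal k < index x"
  obtains O' where "open O'" "x \<in> O'" "\<And>W. open W \<Longrightarrow> W \<subseteq> O' \<Longrightarrow> open (f ` W)"
    "\<And>a b. a \<in> O' \<Longrightarrow> b \<in> O' \<Longrightarrow> k * X.dst a b \<le> Y.dst (f a) (f b)"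
proof -
  obtain c d Jb where ch: "adapted_charts A B f J x = (c, d)" and rep: "jacobian_rep A B f J x c d Jb"
    by (rule adapted_charts_rep)
  note r = jacobian_repD[OF rep]
  note cA = X.charts_atD[OF r(1)] and dB = Y.charts_atD[OF r(2)]
  define p where "p v = X.chart_norm c x v" for v
  define q where "q v = Y.chart_norm d (f x) v" for v
  interpret p: equiv_norm p using X.equiv_norm_N[OF r(1), folded p_def] .
  interpret q: equiv_norm q using Y.equiv_norm_N[OF r(2), folded q_def] .
  have qs: "\<forall>v. v \<noteq> 0 \<longrightarrow> q differentiable (at v)"
    using smooth r(2) unfolding smooth_norm_def q_def[abs_def] by blast
  obtain k0 where k0: "ennreal k < k0" "k0 < index x" using dense[OF k(2)] by blast
  then obtain k' where k': "k0 = ennreal k'" "0 \<le> k'"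
    by (metis ennreal_cases not_less_iff_gr_or_eq top.not_eq_extremum top_neq_ennreal)
  have kk': "k < k'" using k0(1) k(1) unfolding k'(1) by (simp add: ennreal_less_iff)
  obtain R1 where R1: "R1 \<in> small_radii A NX B f J x"
    "ennreal k' < (INF T\<in>convex hull (jacobian_ball A NX B f J x R1). C_finsler A NX B NY x (f x) T)"
    using k0(2) unfolding regularity_index_def k'(1) less_SUP_iff by blast
  obtain R2 where R2: "R2 \<in> small_radii A NX B f J x"
    "\<And>T. T \<in> convex hull (jacobian_ball A NX B f J x R2) \<Longrightarrow>
      bij_betw T (tangent_space A x) (tangent_space B (f x))"
    using reg unfolding jacobian_regular_def by blast
  \<comment> \<open>The bound and bijectivity are given at different radii. The hull grows with the
    radius, so operators coming from the smaller ball have both properties.\<close>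
  define R where "R = min R1 R2"
  have R: "R > 0" using R1(1) R2(1) unfolding R_def small_radii_def by simp
  obtain W1 where W1: "open W1" "x \<in> W1" "\<And>v. v \<in> W1 \<Longrightarrow> X.dst x v < R"
    by (rule X.open_in_dist_ball[OF R]) blast
  have T: "dual_lower_bound p q k' T \<and> inj (blinfun_apply T)"
    if T: "T \<in> convex hull (\<Union>u\<in>W1. Jb (snd c u))" for T
  proof -
    have "tangent_op A B c d x (f x) T \<in> convex hull (jacobian_ball A NX B f J x R')"
      if R': "R' \<in> small_radii A NX B f J x" "R \<le> R'" for R'
    proof -
      have "(\<Union>u\<in>W1. Jb (snd c u)) \<subseteq> (\<Union>u\<in>finsler_ball A NX x R'. Jb (snd c u))"
        using W1(3) R'(2) unfolding X.finsler_ball_eq by force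
      then have "T \<in> convex hull (\<Union>u\<in>finsler_ball A NX x R'. Jb (snd c u))"
        using T hull_mono by blast
      then show ?thesis
        unfolding jacobian_ball_eq[OF ch rep R'(1)]
        using convex_hull_linear_image[OF linear_tangent_op[OF r(2)]] by blast
    qed
    then have T1: "tangent_op A B c d x (f x) T \<in> convex hull (jacobian_ball A NX B f J x R1)"
      and T2: "tangent_op A B c d x (f x) T \<in> convex hull (jacobian_ball A NX B f J x R2)"
      using R1(1) R2(1) by (simp_all add: R_def)
    have "ennreal k' \<le> C_finsler A NX B NY x (f x) (tangent_op A B c d x (f x) T)"
      using R1(2) INF_lower[OF T1] by (meson less_imp_le order_trans)
    then have "dual_lower_bound p q k' T"
      using dual_lower_bound_C_finsler[OF r(1,2)] unfolding p_def[abs_def] q_def[abs_def] by blast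
    then show ?thesis using inj_blinfun_of_bij[OF r(1,2) R2(2)[OF T2]] by blast
  qed
  \<comment> \<open>The two distortion factors then multiply to \<open>k' / k\<close>.\<close>
  define e where "e = sqrt (k' / k) - 1"
  have e: "e > 0" "(1 + e) * (1 + e) = k' / k" using kk' k(1) by (auto simp: e_def)
  obtain rY where rY: "rY > 0"
    "\<And>u v. u \<in> fst d \<Longrightarrow> q (snd d u - snd d (f x)) < rY \<Longrightarrow> v \<in> fst d \<Longrightarrow> q (snd d v - snd d (f x)) < rY \<Longrightarrow>
      q (snd d u - snd d v) \<le> (1 + e) * Y.dst u v"
    by (rule Y.local_comparison[OF r(2) open_UNIV UNIV_I e(1), folded q_def]) blast
  define V where "V = {w \<in> fst d. snd d w \<in> {z. q (z - snd d (f x)) < rY}}"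
  have V: "open V" "f x \<in> V"
    unfolding V_def using Y.open_chart_preimage[OF dB(1) q.open_ball] dB(2) rY(1) by auto
  obtain r0 where r0: "r0 > 0" "bounded (\<Union>z\<in>ball (snd c x) r0. Jb z)"
    using r(5) cA(2) unfolding locally_bounded_map_def by blast
  \<comment> \<open>\<open>W1\<close> gives the hypotheses on the hull, the preimage of
    \<open>V\<close> the comparison of distances in \<open>Y\<close>, and the last set the
    boundedness of \<open>Jb\<close>.\<close>
  define W where "W = W1 \<inter> f -` V \<inter> {w \<in> fst c. snd c w \<in> ball (snd c x) r0}"
  have W: "open W" "x \<in> W"
    unfolding W_def using W1(1,2) V r0(1) cA(2) X.open_chart_preimage[OF cA(1) open_ball]
      open_vimage[OF V(1) continuous_f] by auto
  obtain rX where rX: "rX > 0" "{z. p (z - snd c x) < rX} \<subseteq> snd c ` fst c"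
    "\<And>u. u \<in> fst c \<Longrightarrow> p (snd c u - snd c x) < rX \<Longrightarrow> u \<in> W"
    "\<And>u v. u \<in> fst c \<Longrightarrow> p (snd c u - snd c x) < rX \<Longrightarrow> v \<in> fst c \<Longrightarrow> p (snd c v - snd c x) < rX \<Longrightarrow>
      X.dst u v \<le> (1 + e) * p (snd c u - snd c v)"
    by (rule X.local_comparison[OF r(1) W e(1), folded p_def]) blast
  define U where "U = {z. p (z - snd c x) < rX}"
  define O' where "O' = {w \<in> fst c. snd c w \<in> U}"
  define g where "g = snd d \<circ> f \<circ> chart_inv c"
  have g: "g (snd c u) = snd d (f u)" if "u \<in> fst c" for u using that cA(1) by (simp add: g_def)
  have O'W: "u \<in> W" if "u \<in> O'" for u using rX(3) that unfolding O'_def U_def by blast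
  have UO: "\<exists>u\<in>O'. z = snd c u" if "z \<in> U" for z
    using rX(2) that unfolding O'_def U_def by blast
  have Ufc: "U \<subseteq> snd c ` fst c" unfolding U_def by (rule rX(2))
  have JbU: "(\<Union>z\<in>U. Jb z) \<subseteq> (\<Union>u\<in>W1. Jb (snd c u))" "U \<subseteq> ball (snd c x) r0"
    using UO O'W unfolding W_def by blast+
  have "bounded (\<Union>z\<in>U. Jb z)" by (rule bounded_subset[OF r0(2)]) (use JbU(2) in blast)
  moreover have "\<And>u. u \<in> U \<Longrightarrow> pseudo_jacobian_at g u (Jb u)" and "continuous_on U g"
    using r(4) Ufc unfolding pseudo_jacobian_map_def g_def by (blast, metis continuous_on_subset)
  moreover have "\<And>z. z \<in> U \<Longrightarrow> convex (Jb z)" "\<And>z. z \<in> U \<Longrightarrow> compactin weak_operator_topology (Jb z)"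
    using Ufc jacobian_rep_convex_compact[OF rep] by blast+
  moreover have "T \<in> convex hull (\<Union>z\<in>U. Jb z) \<Longrightarrow> dual_lower_bound p q k' T \<and> inj (blinfun_apply T)" for T
    using T hull_mono[OF JbU(1)] by blast
  moreover have "k' > 0" using kk' k(1) by simp
  moreover have "open U" "convex U" unfolding U_def by (rule p.open_ball p.convex_ball)+
  ultimately have exp: "\<forall>a\<in>U. \<forall>b\<in>U. k' * p (a - b) \<le> q (g a - g b)"
    and op: "\<And>W. open W \<Longrightarrow> W \<subseteq> U \<Longrightarrow> open (g ` W)"
    using local_inverse[OF p.equiv_norm_axioms q.equiv_norm_axioms qs, of U g Jb k'] by blast+
  show thesis
  proof (rule that[of O'])
    show "open O'" unfolding O'_def U_def by (rule X.open_chart_preimage[OF cA(1) p.open_ball])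
    show "x \<in> O'" using cA(2) rX(1) by (simp add: O'_def U_def)
    show "open (f ` W')" if W': "open W'" "W' \<subseteq> O'" for W'
    proof -
      have sub: "W' \<subseteq> fst c" "snd c ` W' \<subseteq> U" using W'(2) unfolding O'_def by blast+
      have "open (g ` snd c ` W')" using op X.open_chart_image[OF cA(1) W'(1) sub(1)] sub(2) by blast
      then have "open {w \<in> fst d. snd d w \<in> g ` snd c ` W'}" by (rule Y.open_chart_preimage[OF dB(1)])
      moreover have "f ` W' = {w \<in> fst d. snd d w \<in> g ` snd c ` W'}"
      proof (intro set_eqI iffI)
        fix w assume "w \<in> f ` W'"
        then obtain u where u: "u \<in> W'" "w = f u" by blast
        then have "f u \<in> fst d" "snd d w = g (snd c u)" using r(3) sub(1) g by auto
        then show "w \<in> {w \<in> fst d. snd d w \<in> g ` snd c ` W'}" using u by blast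
      next
        fix w assume "w \<in> {w \<in> fst d. snd d w \<in> g ` snd c ` W'}"
        then obtain u where u: "u \<in> W'" "w \<in> fst d" "snd d w = g (snd c u)" by blast
        then have "f u \<in> fst d" "snd d w = snd d (f u)" using r(3) sub(1) g by auto
        then show "w \<in> f ` W'" using Y.chart_inj[OF dB(1) u(2)] u(1) by blast
      qed
      ultimately show ?thesis by simp
    qed
    fix a b assume ab: "a \<in> O'" "b \<in> O'"
    then have a: "a \<in> fst c" "p (snd c a - snd c x) < rX" "f a \<in> V" "snd c a \<in> U"
      and b: "b \<in> fst c" "p (snd c b - snd c x) < rX" "f b \<in> V" "snd c b \<in> U"
      using O'W unfolding W_def O'_def U_def by blast+
    have "k' * p (snd c a - snd c b) \<le> q (snd d (f a) - snd d (f b))"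
      using exp a b g by metis
    also have "\<dots> \<le> (1 + e) * Y.dst (f a) (f b)"
      using a(3) b(3) unfolding V_def by (intro rY(2)) auto
    finally have "(1 + e) * (k' * p (snd c a - snd c b)) \<le> (1 + e) * ((1 + e) * Y.dst (f a) (f b))"
      using e(1) by (intro mult_left_mono) auto
    also have "\<dots> = k' / k * Y.dst (f a) (f b)" by (simp flip: e(2))
    finally have "k' * ((1 + e) * p (snd c a - snd c b)) \<le> k' * (Y.dst (f a) (f b) / k)"
      by (simp add: mult.left_commute)
    then have "(1 + e) * p (snd c a - snd c b) \<le> Y.dst (f a) (f b) / k"
      using mult_le_cancel_left_pos[of k'] kk' k(1) by (metis order_less_trans)
    then have "X.dst a b \<le> Y.dst (f a) (f b) / k"
      using rX(4)[OF a(1,2) b(1,2)] by linarith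
    then show "k * X.dst a b \<le> Y.dst (f a) (f b)"
      using k(1) by (simp add: pos_le_divide_eq mult.commute)
  qed
qed

end

subsection \<open>Lifting of segments\<close>

context finsler
begin

lemma continuous_on_finsler_dist:
  fixes \<sigma> \<tau> :: "'z::topological_space \<Rightarrow> 'x"
  assumes \<sigma>: "continuous_on S \<sigma>" and \<tau>: "continuous_on S \<tau>"
  shows "continuous_on S (\<lambda>t. dst (\<sigma> t) (\<tau> t))"
  unfolding continuous_on_def
proof (intro ballI tendstoI)
  fix t and e :: real assume t: "t \<in> S" and e: "e > 0"
  have near: "\<forall>\<^sub>F s in at t within S. dst (h t) (h s) < e / 2" if h: "continuous_on S h" for h
  proof -
    have "(h \<longlongrightarrow> h t) (at t within S)" using h t unfolding continuous_on_def by blast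
    from topological_tendstoD[OF this open_dist_ball[of "h t" "e / 2"]] show ?thesis
      using e by (simp add: dist_self)
  qed
  show "\<forall>\<^sub>F s in at t within S. dist (dst (\<sigma> s) (\<tau> s)) (dst (\<sigma> t) (\<tau> t)) < e"
    using near[OF \<sigma>] near[OF \<tau>]
  proof eventually_elim
    case (elim s)
    have "dst (\<sigma> s) (\<tau> s) \<le> dst (\<sigma> s) (\<sigma> t) + (dst (\<sigma> t) (\<tau> t) + dst (\<tau> t) (\<tau> s))"
      "dst (\<sigma> t) (\<tau> t) \<le> dst (\<sigma> t) (\<sigma> s) + (dst (\<sigma> s) (\<tau> s) + dst (\<tau> s) (\<tau> t))"
      by (meson add_left_mono dist_triangle order_trans)+
    then show ?case
      using elim dist_commute[of "\<sigma> s" "\<sigma> t"] dist_commute[of "\<tau> s" "\<tau> t"] by (simp add: dist_real_def)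
  qed
qed

lemma continuous_on_if_dist_le:
  fixes h :: "'z::metric_space \<Rightarrow> 'x"
  assumes "\<And>a b. a \<in> S \<Longrightarrow> b \<in> S \<Longrightarrow> dst (h a) (h b) \<le> C * dist a b"
  shows "continuous_on S h"
  unfolding continuous_on_def
proof (intro ballI topological_tendstoI)
  fix a W assume a: "a \<in> S" and W: "open W" "h a \<in> W"
  obtain r where r: "r > 0" "\<And>v. dst (h a) v < r \<Longrightarrow> v \<in> W" using dist_ball_in_open[OF W] by blast
  have "h b \<in> W" if b: "b \<in> S" "dist b a < r / (\<bar>C\<bar> + 1)" for b
  proof (rule r(2))
    have "dst (h a) (h b) \<le> C * dist a b" using assms[OF a b(1)] .
    also have "\<dots> \<le> (\<bar>C\<bar> + 1) * dist b a"
      unfolding Real_Vector_Spaces.metric_space_class.dist_commute[of a b] by (intro mult_right_mono) auto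
    also have "\<dots> < r" using b(2) by (simp add: pos_less_divide_eq mult.commute)
    finally show "dst (h a) (h b) < r" .
  qed
  then show "\<forall>\<^sub>F b in at a within S. h b \<in> W"
    unfolding eventually_at using r(1) by (intro exI[of _ "r / (\<bar>C\<bar> + 1)"]) auto
qed

end

text \<open>Models \<open>g = snd d \<circ> f\<close> on the preimage \<open>D\<close> of a
  coordinate ball \<open>V\<close>, with a constant \<open>\<kappa>\<close> uniform on
  \<open>D\<close>. The set \<open>D\<close> need not be closed in the manifold; the assumption
  \<open>closed\<close> says that a limit cannot escape from \<open>D\<close> while the images
  converge inside \<open>V\<close>.\<close>

locale lifting = finsler A N
  for A :: "('x::t2_space, 'e::banach) chart set" and N +
  fixes D :: "'x set" and g :: "'x \<Rightarrow> 'b::banach" and V :: "'b set" and q :: "'b \<Rightarrow> real" and \<kappa> :: real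
  assumes complete: "finsler_complete A N"
    and q: "equiv_norm q"
    and V: "convex V" "g ` D \<subseteq> V"
    and g_cont: "continuous_on D g"
    and D: "open D"
    and g_open: "\<And>W. open W \<Longrightarrow> W \<subseteq> D \<Longrightarrow> open (g ` W)"
    and expanding: "\<And>u. u \<in> D \<Longrightarrow> \<exists>O'. open O' \<and> u \<in> O' \<and> O' \<subseteq> D \<and>
      (\<forall>a\<in>O'. \<forall>b\<in>O'. dst a b \<le> \<kappa> * q (g a - g b))"
    and closed: "\<And>s l z. (\<And>n. s n \<in> D) \<Longrightarrow> s \<longlonglongrightarrow> l \<Longrightarrow> (\<lambda>n. g (s n)) \<longlonglongrightarrow> z \<Longrightarrow> z \<in> V \<Longrightarrow> l \<in> D"
    and \<kappa>: "\<kappa> > 0"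
begin

sublocale q: equiv_norm q by (rule q)

lemma expanding_ball:
  assumes u: "u \<in> D"
  obtains r where "r > 0" "\<And>v w. dst u v < r \<Longrightarrow> dst u w < r \<Longrightarrow> v \<in> D \<and> dst v w \<le> \<kappa> * q (g v - g w)"
proof -
  obtain O' where O': "open O'" "u \<in> O'" "O' \<subseteq> D" "\<forall>a\<in>O'. \<forall>b\<in>O'. dst a b \<le> \<kappa> * q (g a - g b)"
    using expanding[OF u] by blast
  obtain r where r: "r > 0" "\<And>v. dst u v < r \<Longrightarrow> v \<in> O'"
    by (rule dist_ball_in_open[OF O'(1,2)]) blast
  show thesis by (rule that[OF r(1)]) (use r(2) O'(3,4) in blast)
qed

text \<open>A Lebesgue number argument: finitely many balls of half the local radius cover the
  compact image of \<open>\<sigma>\<close>, and the other half absorbs the distance to a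
  centre.\<close>

lemma uniform_radius:
  fixes \<sigma> :: "real \<Rightarrow> 'x"
  assumes \<sigma>: "continuous_on {a..b} \<sigma>" "\<sigma> ` {a..b} \<subseteq> D" and ab: "a \<le> b"
  obtains r where "r > 0"
    "\<And>t v w. t \<in> {a..b} \<Longrightarrow> dst (\<sigma> t) v < r \<Longrightarrow> dst (\<sigma> t) w < r \<Longrightarrow> dst v w \<le> \<kappa> * q (g v - g w)"
proof -
  have "\<exists>r>0. \<forall>v w. dst (\<sigma> t) v < r \<longrightarrow> dst (\<sigma> t) w < r \<longrightarrow> dst v w \<le> \<kappa> * q (g v - g w)" if "t \<in> {a..b}" for t
  proof -
    have "\<sigma> t \<in> D" using \<sigma>(2) that by blast
    then show ?thesis using expanding_ball by metis
  qed
  then obtain rad where rad: "\<And>t. t \<in> {a..b} \<Longrightarrow> rad t > 0"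
    "\<And>t v w. t \<in> {a..b} \<Longrightarrow> dst (\<sigma> t) v < rad t \<Longrightarrow> dst (\<sigma> t) w < rad t \<Longrightarrow> dst v w \<le> \<kappa> * q (g v - g w)"
    by metis
  have "\<exists>G. open G \<and> G \<inter> {a..b} = \<sigma> -` {v. dst (\<sigma> t) v < rad t / 2} \<inter> {a..b}" for t
    using \<sigma>(1) open_dist_ball unfolding continuous_on_open_invariant by blast
  then obtain G where G: "\<And>t. open (G t)" "\<And>t. G t \<inter> {a..b} = \<sigma> -` {v. dst (\<sigma> t) v < rad t / 2} \<inter> {a..b}"
    by metis
  have inG: "t \<in> G t" if t: "t \<in> {a..b}" for t
  proof -
    have "t \<in> \<sigma> -` {v. dst (\<sigma> t) v < rad t / 2} \<inter> {a..b}" using rad(1)[OF t] t by (simp add: dist_self)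
    then show ?thesis unfolding G(2)[symmetric] by blast
  qed
  obtain C where C: "C \<subseteq> {a..b}" "finite C" "{a..b} \<subseteq> (\<Union>t\<in>C. G t)"
    using compactE_image[OF compact_Icc, of "{a..b}" G a b] G(1) inG by blast
  have "C \<noteq> {}" using C(3) ab by force
  define r where "r = Min ((\<lambda>t. rad t / 2) ` C)"
  have r: "r \<le> rad t / 2" if "t \<in> C" for t unfolding r_def using C(2) that by (intro Min_le) auto
  have "r > 0" unfolding r_def using C(1,2) \<open>C \<noteq> {}\<close> rad(1) by (subst Min_gr_iff) auto
  then show thesis
  proof (rule that)
    fix t v w assume t: "t \<in> {a..b}" and v: "dst (\<sigma> t) v < r" and w: "dst (\<sigma> t) w < r"
    obtain s where s: "s \<in> C" "t \<in> G s" using C(3) t by blast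
    then have st: "dst (\<sigma> s) (\<sigma> t) < rad s / 2" using G(2)[of s] t by blast
    have "dst (\<sigma> s) v < rad s" "dst (\<sigma> s) w < rad s"
      using dist_triangle[of "\<sigma> s" v "\<sigma> t"] dist_triangle[of "\<sigma> s" w "\<sigma> t"] v w r[OF s(1)] st by linarith+
    then show "dst v w \<le> \<kappa> * q (g v - g w)" using rad(2) C(1) s(1) by blast
  qed
qed

text \<open>As long as \<open>\<tau>\<close> is within \<open>r\<close> of \<open>\<sigma>\<close>,
  local expansion bounds their distance by a quantity below \<open>r\<close>. So being within
  \<open>r\<close> is at once an open and a closed condition on \<open>t\<close>.\<close>

lemma stability:
  fixes \<sigma> \<tau> :: "real \<Rightarrow> 'x"
  assumes ab: "a \<le> b" and \<sigma>: "continuous_on {a..b} \<sigma>" "\<sigma> ` {a..b} \<subseteq> D"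
    and \<tau>: "continuous_on {a..b} \<tau>" "\<tau> ` {a..b} \<subseteq> D"
    and r: "\<And>t v w. t \<in> {a..b} \<Longrightarrow> dst (\<sigma> t) v < r \<Longrightarrow> dst (\<sigma> t) w < r \<Longrightarrow> dst v w \<le> \<kappa> * q (g v - g w)"
    and close: "\<And>t. t \<in> {a..b} \<Longrightarrow> \<kappa> * q (g (\<sigma> t) - g (\<tau> t)) < r"
    and start: "dst (\<sigma> a) (\<tau> a) < r"
    and t: "t \<in> {a..b}"
  shows "dst (\<sigma> t) (\<tau> t) \<le> \<kappa> * q (g (\<sigma> t) - g (\<tau> t))"
proof -
  let ?d = "\<lambda>t. dst (\<sigma> t) (\<tau> t)" and ?e = "\<lambda>t. \<kappa> * q (g (\<sigma> t) - g (\<tau> t))"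
  have d: "continuous_on {a..b} ?d" by (rule continuous_on_finsler_dist[OF \<sigma>(1) \<tau>(1)])
  have e: "continuous_on {a..b} ?e"
    by (intro continuous_intros continuous_on_compose2[OF q.continuous[of UNIV]]
        continuous_on_compose2[OF g_cont \<sigma>(1) \<sigma>(2)] continuous_on_compose2[OF g_cont \<tau>(1) \<tau>(2)]) auto
  have r0: "0 < r" using start dist_nonneg[of "\<sigma> a" "\<tau> a"] by linarith
  have iff: "?d t < r \<longleftrightarrow> ?d t - ?e t \<le> 0" if t: "t \<in> {a..b}" for t
    using r[OF t, of "\<sigma> t" "\<tau> t"] close[OF t] r0 by (auto simp: dist_self)
  let ?S = "{a..b} \<inter> ?d -` {..<r}"
  have "openin (top_of_set {a..b}) ?S" by (rule continuous_openin_preimage_gen[OF d]) simp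
  moreover have "?S = {a..b} \<inter> (\<lambda>t. ?d t - ?e t) -` {..0}" using iff by auto
  then have "closedin (top_of_set {a..b}) ?S"
    using continuous_closedin_preimage[OF continuous_on_diff[OF d e], of "{..0}"] by simp
  ultimately have "?S = {} \<or> ?S = {a..b}"
    using connected_Icc[of a b] unfolding connected_clopen by blast
  moreover have "a \<in> ?S" using ab start by simp
  ultimately have "t \<in> ?S" using t by blast
  then show ?thesis using iff[OF t] by simp
qed

section \<open>Uniqueness and existence of lifts\<close>

definition lift :: "'x \<Rightarrow> 'b \<Rightarrow> real \<Rightarrow> (real \<Rightarrow> 'x) \<Rightarrow> bool"
  where "lift u z T \<sigma> \<longleftrightarrow> continuous_on {0..T} \<sigma> \<and> \<sigma> 0 = u \<and>
    (\<forall>t\<in>{0..T}. \<sigma> t \<in> D \<and> g (\<sigma> t) = g u + t *\<^sub>R (z - g u))"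

text \<open>The case of \<open>stability\<close> with two paths over the same segment, where the
  right-hand side is 0.\<close>

lemma lift_unique:
  assumes \<sigma>: "lift u z T \<sigma>" and \<tau>: "lift u z T \<tau>" and t: "t \<in> {0..T}"
  shows "\<sigma> t = \<tau> t"
proof -
  have T: "0 \<le> T" using t by simp
  have \<sigma>': "continuous_on {0..T} \<sigma>" "\<sigma> ` {0..T} \<subseteq> D" and \<tau>': "continuous_on {0..T} \<tau>" "\<tau> ` {0..T} \<subseteq> D"
    using \<sigma> \<tau> unfolding lift_def by blast+
  have eq: "g (\<sigma> t) - g (\<tau> t) = 0" if "t \<in> {0..T}" for t using \<sigma> \<tau> that unfolding lift_def by simp
  obtain r where r: "r > 0"
    "\<And>t v w. t \<in> {0..T} \<Longrightarrow> dst (\<sigma> t) v < r \<Longrightarrow> dst (\<sigma> t) w < r \<Longrightarrow> dst v w \<le> \<kappa> * q (g v - g w)"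
    using uniform_radius[OF \<sigma>' T] by metis
  have "dst (\<sigma> t) (\<tau> t) \<le> \<kappa> * q (g (\<sigma> t) - g (\<tau> t))"
  proof (rule stability[OF T \<sigma>' \<tau>' r(2) _ _ t])
    show "\<kappa> * q (g (\<sigma> s) - g (\<tau> s)) < r" if "s \<in> {0..T}" for s using eq[OF that] r(1) by simp
    show "dst (\<sigma> 0) (\<tau> 0) < r" using \<sigma> \<tau> r(1) unfolding lift_def by (simp add: dist_self)
  qed
  then have "dst (\<sigma> t) (\<tau> t) = 0" using eq[OF t] dist_nonneg[of "\<sigma> t" "\<tau> t"] by simp
  then show ?thesis by (rule dist_eq_0)
qed

lemma lift_restrict: "lift u z T \<sigma> \<Longrightarrow> T' \<le> T \<Longrightarrow> lift u z T' \<sigma>"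
  unfolding lift_def by (auto intro: continuous_on_subset)

text \<open>The expansion estimate is only local; \<open>dini_mvt\<close>, applied to the distance
  from \<open>\<sigma> s\<close>, adds it up along a merely continuous path.\<close>

lemma lift_lipschitz:
  assumes \<sigma>: "lift u z T \<sigma>" and st: "0 \<le> s" "s \<le> t" "t \<le> T"
  shows "dst (\<sigma> s) (\<sigma> t) \<le> \<kappa> * q (z - g u) * (t - s)"
proof -
  have cont: "continuous_on {s..t} \<sigma>"
    using \<sigma> st unfolding lift_def by (auto intro: continuous_on_subset)
  have g\<sigma>: "\<sigma> x \<in> D" "g (\<sigma> x) = g u + x *\<^sub>R (z - g u)" if "x \<in> {s..t}" for x
    using \<sigma> st that unfolding lift_def by auto
  have "dst (\<sigma> s) (\<sigma> t) - dst (\<sigma> s) (\<sigma> s) \<le> \<kappa> * q (z - g u) * (t - s)"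
  proof (rule dini_mvt[OF st(2)])
    show "continuous_on {s..t} (\<lambda>x. dst (\<sigma> s) (\<sigma> x))"
      by (intro continuous_on_finsler_dist cont) auto
    fix x K' assume x: "s \<le> x" "x < t" and K': "\<kappa> * q (z - g u) < K'"
    have xI: "x \<in> {s..t}" using x by simp
    obtain r where r: "r > 0" "\<And>v w. dst (\<sigma> x) v < r \<Longrightarrow> dst (\<sigma> x) w < r \<Longrightarrow> dst v w \<le> \<kappa> * q (g v - g w)"
      using expanding_ball[OF g\<sigma>(1)[OF xI]] by metis
    have "(\<sigma> \<longlongrightarrow> \<sigma> x) (at x within {s..t})" using cont xI unfolding continuous_on_def by blast
    from topological_tendstoD[OF this open_dist_ball[of "\<sigma> x" r]]
    have "\<forall>\<^sub>F y in at x within {s..t}. dst (\<sigma> x) (\<sigma> y) < r" using r(1) by (simp add: dist_self)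
    then obtain d where d: "d > 0" "\<And>y. y \<in> {s..t} \<Longrightarrow> y \<noteq> x \<Longrightarrow> dist y x < d \<Longrightarrow> dst (\<sigma> x) (\<sigma> y) < r"
      unfolding eventually_at by blast
    show "\<forall>\<^sub>F h in at_right 0. dst (\<sigma> s) (\<sigma> (x + h)) - dst (\<sigma> s) (\<sigma> x) \<le> K' * h"
    proof (rule eventually_at_rightI[of _ "min d (t - x)"])
      show "0 < min d (t - x)" using d x by simp
      fix h assume "h \<in> {0<..<min d (t - x)}"
      then have h: "0 < h" "h < d" "x + h \<in> {s..t}" using x by auto
      have "dst (\<sigma> x) (\<sigma> (x + h)) < r" using h by (intro d(2)) (auto simp: dist_real_def)
      then have "dst (\<sigma> x) (\<sigma> (x + h)) \<le> \<kappa> * q (g (\<sigma> x) - g (\<sigma> (x + h)))"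
        using r by (simp add: dist_self)
      also have "g (\<sigma> x) - g (\<sigma> (x + h)) = (- h) *\<^sub>R (z - g u)"
        unfolding g\<sigma>(2)[OF xI] g\<sigma>(2)[OF h(3)] by (simp add: algebra_simps)
      also have "\<kappa> * q ((- h) *\<^sub>R (z - g u)) = \<kappa> * q (z - g u) * h"
        unfolding q.scale using h(1) by simp
      also have "\<dots> \<le> K' * h" using K' h(1) by (intro mult_right_mono) auto
      finally show "dst (\<sigma> s) (\<sigma> (x + h)) - dst (\<sigma> s) (\<sigma> x) \<le> K' * h"
        using dist_triangle[of "\<sigma> s" "\<sigma> (x + h)" "\<sigma> x"] by linarith
    qed
  qed
  then show ?thesis by (simp add: dist_self)
qed

text \<open>On \<open>O'\<close> the map \<open>g\<close> is injective with a Lipschitz inverse;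
  this inverse, applied to the segment, continues the lift.\<close>

lemma lift_extend:
  assumes \<sigma>: "lift u z T \<sigma>" and T: "0 \<le> T" "T \<le> T'"
    and O': "open O'" "O' \<subseteq> D" "\<sigma> T \<in> O'" "\<forall>a\<in>O'. \<forall>b\<in>O'. dst a b \<le> \<kappa> * q (g a - g b)"
    and seg: "\<And>t. t \<in> {T..T'} \<Longrightarrow> g u + t *\<^sub>R (z - g u) \<in> g ` O'"
  shows "\<exists>\<tau>. lift u z T' \<tau>"
proof -
  let ?\<gamma> = "\<lambda>t. g u + t *\<^sub>R (z - g u)"
  have inj: "a = b" if "a \<in> O'" "b \<in> O'" "g a = g b" for a b
  proof -
    have "dst a b \<le> \<kappa> * q (g a - g b)" using O'(4) that by blast
    then have "dst a b = 0" using dist_nonneg[of a b] that(3) by simp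
    then show ?thesis by (rule dist_eq_0)
  qed
  define h where "h t = inv_into O' g (?\<gamma> t)" for t
  have h: "h t \<in> O'" "g (h t) = ?\<gamma> t" if "t \<in> {T..T'}" for t
    unfolding h_def using seg[OF that] by (auto intro: inv_into_into f_inv_into_f)
  have hcont: "continuous_on {T..T'} h"
  proof (rule continuous_on_if_dist_le)
    fix a b assume ab: "a \<in> {T..T'}" "b \<in> {T..T'}"
    have "dst (h a) (h b) \<le> \<kappa> * q (g (h a) - g (h b))" using O'(4) h(1)[OF ab(1)] h(1)[OF ab(2)] by blast
    also have "g (h a) - g (h b) = (a - b) *\<^sub>R (z - g u)"
      unfolding h(2)[OF ab(1)] h(2)[OF ab(2)] by (simp add: algebra_simps)
    also have "\<kappa> * q ((a - b) *\<^sub>R (z - g u)) = \<kappa> * q (z - g u) * dist a b"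
      unfolding q.scale by (simp add: dist_real_def)
    finally show "dst (h a) (h b) \<le> \<kappa> * q (z - g u) * dist a b" .
  qed
  have hT: "h T = \<sigma> T"
    using \<sigma> T h[of T] O'(3) by (intro inj) (auto simp: lift_def)
  define \<tau> where "\<tau> t = (if t \<le> T then \<sigma> t else h t)" for t
  have \<tau>1: "\<tau> t = \<sigma> t" if "t \<in> {0..T}" for t using that by (simp add: \<tau>_def)
  have \<tau>2: "\<tau> t = h t" if "t \<in> {T..T'}" for t using that hT by (cases "t = T") (auto simp: \<tau>_def)
  have un: "{0..T'} = {0..T} \<union> {T..T'}" using T by auto
  have "continuous_on {0..T'} \<tau>"
    unfolding un
  proof (rule continuous_on_closed_Un)
    have "continuous_on {0..T} \<sigma>" using \<sigma> by (simp add: lift_def)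
    then show "continuous_on {0..T} \<tau>" by (rule continuous_on_eq) (simp add: \<tau>1)
    show "continuous_on {T..T'} \<tau>" using hcont by (rule continuous_on_eq) (simp add: \<tau>2)
  qed auto
  moreover have "\<tau> t \<in> D \<and> g (\<tau> t) = ?\<gamma> t" if t: "t \<in> {0..T'}" for t
  proof (cases "t \<le> T")
    case True
    then show ?thesis using \<sigma> t \<tau>1[of t] by (simp add: lift_def)
  next
    case False
    then show ?thesis using h[of t] t \<tau>2[of t] O'(2) by auto
  qed
  moreover have "\<tau> 0 = u" using \<sigma> T by (simp add: \<tau>_def lift_def)
  ultimately show ?thesis unfolding lift_def by blast
qed

text \<open>The endpoints of partial lifts, up to parameters tending to the supremum
  \<open>T\<close>, form a Cauchy sequence by \<open>lift_lipschitz\<close>. Their limit lies over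
  the point of the segment at \<open>T\<close>, and openness of \<open>g\<close> near it continues a
  lift beyond \<open>T\<close> unless \<open>T = 1\<close>.\<close>

lemma lift_exists:
  assumes u: "u \<in> D" and z: "z \<in> V"
  shows "\<exists>\<sigma>. lift u z 1 \<sigma>"
proof -
  let ?\<gamma> = "\<lambda>t. g u + t *\<^sub>R (z - g u)"
  have \<gamma>V: "?\<gamma> t \<in> V" if "t \<in> {0..1}" for t
  proof -
    have "?\<gamma> t = (1 - t) *\<^sub>R g u + t *\<^sub>R z" by (simp add: algebra_simps)
    moreover have "g u \<in> V" using V(2) u by blast
    ultimately show ?thesis using V(1) z that unfolding convex_def by simp
  qed
  define S where "S = {T \<in> {0..1}. \<exists>\<sigma>. lift u z T \<sigma>}"
  have "lift u z 0 (\<lambda>_. u)" using u by (simp add: lift_def)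
  then have S0: "0 \<in> S" unfolding S_def by auto
  have bdd: "bdd_above S" unfolding S_def by (rule bdd_aboveI[of _ 1]) auto
  define T where "T = Sup S"
  have T: "0 \<le> T" "T \<le> 1"
    unfolding T_def using cSup_upper[OF S0 bdd] S0 by (auto intro!: cSup_least simp: S_def)
  have "\<exists>t\<in>S. T - inverse (real (Suc n)) < t" for n
    using less_cSupD[of S "T - inverse (real (Suc n))"] S0 unfolding T_def by auto
  then obtain tn where tn: "\<And>n. tn n \<in> S" "\<And>n. T - inverse (real (Suc n)) < tn n" by metis
  have tnT: "tn n \<le> T" for n unfolding T_def using tn(1) bdd by (rule cSup_upper)
  have tn01: "0 \<le> tn n" "tn n \<le> 1" for n using tn(1)[of n] unfolding S_def by auto
  have "(\<lambda>n. T - inverse (real (Suc n))) \<longlonglongrightarrow> T - 0" by (intro tendsto_intros LIMSEQ_inverse_real_of_nat)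
  then have "(\<lambda>n. T - inverse (real (Suc n))) \<longlonglongrightarrow> T" by (simp only: diff_zero)
  then have tnlim: "tn \<longlonglongrightarrow> T"
    by (rule tendsto_sandwich[OF always_eventually always_eventually _ tendsto_const, rotated 2])
      (intro allI less_imp_le tn(2) tnT)+
  obtain \<sigma> where \<sigma>: "\<And>n. lift u z (tn n) (\<sigma> n)" using tn(1) unfolding S_def by (simp, metis)
  define w where "w n = \<sigma> n (tn n)" for n
  have wD: "w n \<in> D" "g (w n) = ?\<gamma> (tn n)" for n
    using \<sigma>[of n] tn01[of n] unfolding lift_def w_def by auto
  define C where "C = \<kappa> * q (z - g u)"
  have C: "0 \<le> C" unfolding C_def using \<kappa> by simp
  \<comment> \<open>The lifts are chosen independently of each other; uniqueness makes the shorter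
    one a restriction of the longer one.\<close>
  have wle: "dst (w m) (w n) \<le> C * (tn n - tn m)" if "tn m \<le> tn n" for m n
  proof -
    have "w m = \<sigma> n (tn m)"
      unfolding w_def using lift_unique[OF \<sigma>[of m] lift_restrict[OF \<sigma>[of n] that]] tn01(1)[of m] by simp
    then show ?thesis unfolding C_def using lift_lipschitz[OF \<sigma>[of n] tn01(1) that] by (simp add: w_def)
  qed
  have wle': "dst (w m) (w n) \<le> C * \<bar>tn n - tn m\<bar>" for m n
    using wle[of m n] wle[of n m] dist_commute[of "w m" "w n"] by (cases "tn m \<le> tn n") auto
  obtain l where l: "w \<longlonglongrightarrow> l"
  proof (rule complete_LIMSEQ[OF complete])
    fix e :: real assume e: "e > 0"
    have "Cauchy tn" using tnlim by (rule LIMSEQ_imp_Cauchy)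
    moreover have "e / (C + 1) > 0" using e C by simp
    ultimately obtain M where M: "\<forall>m\<ge>M. \<forall>n\<ge>M. dist (tn m) (tn n) < e / (C + 1)"
      unfolding Cauchy_def by blast
    have "dst (w m) (w n) < e" if mn: "m \<ge> M" "n \<ge> M" for m n
    proof -
      have "dst (w m) (w n) \<le> C * dist (tn m) (tn n)"
        using wle'[of m n] by (simp add: dist_real_def abs_minus_commute)
      also have "\<dots> \<le> (C + 1) * dist (tn m) (tn n)" by (intro mult_right_mono) auto
      also have "\<dots> < e"
      proof -
        have "dist (tn m) (tn n) < e / (C + 1)" using M mn by blast
        then show ?thesis using C by (simp add: pos_less_divide_eq mult.commute)
      qed
      finally show ?thesis .
    qed
    then show "\<exists>M. \<forall>m\<ge>M. \<forall>n\<ge>M. dst (w m) (w n) < e" by blast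
  qed
  have glim: "(\<lambda>n. g (w n)) \<longlonglongrightarrow> ?\<gamma> T" unfolding wD(2) by (intro tendsto_intros tnlim)
  have lD: "l \<in> D" by (rule closed[OF wD(1) l glim]) (use \<gamma>V T in simp)
  have "(\<lambda>n. g (w n)) \<longlonglongrightarrow> g l" using continuous_on_tendsto_compose[OF g_cont l lD] wD(1) by simp
  then have gl: "g l = ?\<gamma> T" using glim LIMSEQ_unique by blast
  obtain O' where O': "open O'" "l \<in> O'" "O' \<subseteq> D" "\<forall>a\<in>O'. \<forall>b\<in>O'. dst a b \<le> \<kappa> * q (g a - g b)"
    using expanding[OF lD] by blast
  have op: "open (g ` O')" using g_open[OF O'(1,3)] .
  have "?\<gamma> T \<in> g ` O'" using O'(2) gl by (metis imageI)
  moreover have "continuous_on UNIV ?\<gamma>" by (intro continuous_intros)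
  then have "open (?\<gamma> -` (g ` O'))" using open_vimage[OF op] by blast
  ultimately obtain d where d: "d > 0" "ball T d \<subseteq> ?\<gamma> -` (g ` O')"
    by (metis openE vimageI)
  have "\<forall>\<^sub>F n in sequentially. w n \<in> O' \<and> tn n \<in> ball T d"
    using topological_tendstoD[OF l O'(1,2)] topological_tendstoD[OF tnlim open_ball, of T d] d(1)
    by (simp add: eventually_conj)
  then obtain n where n: "w n \<in> O'" "tn n \<in> ball T d" unfolding eventually_sequentially by blast
  \<comment> \<open>\<open>d / 2\<close> keeps the segment inside the open image; cut off at 1,
    \<open>T'\<close> still exceeds \<open>T\<close> except when \<open>T = 1\<close>.\<close>
  define T' where "T' = min 1 (T + d / 2)"
  have T': "tn n \<le> T'" "T' \<le> 1" "0 \<le> T'" using tnT[of n] T d(1) by (auto simp: T'_def)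
  have "\<exists>\<tau>. lift u z T' \<tau>"
  proof (rule lift_extend[OF \<sigma>[of n] tn01(1) T'(1) O'(1,3) _ O'(4)])
    show "\<sigma> n (tn n) \<in> O'" using n(1) by (simp add: w_def)
    show "?\<gamma> t \<in> g ` O'" if "t \<in> {tn n..T'}" for t
    proof -
      have "T' < T + d" using d(1) by (auto simp: T'_def)
      then have "t \<in> ball T d" using that n(2) d(1) by (auto simp: dist_real_def)
      then show ?thesis using d(2) by blast
    qed
  qed
  then have T'S: "T' \<in> S" unfolding S_def using T'(2,3) by auto
  have "T' \<le> T" unfolding T_def using T'S bdd by (rule cSup_upper)
  then have "T' = 1" using d(1) T(2) by (auto simp: T'_def min_def split: if_splits)
  then show ?thesis using T'S unfolding S_def by blast
qed

text \<open>Reversal exchanges the roles of a point and of its retraction, which is how the points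
  of a sheet are recovered from its centre.\<close>

lemma lift_reverse:
  assumes "lift u z 1 \<sigma>"
  shows "lift (\<sigma> 1) (g u) 1 (\<lambda>t. \<sigma> (1 - t))"
  unfolding lift_def
proof (intro conjI ballI)
  have \<sigma>: "continuous_on {0..1} \<sigma>" "\<sigma> 0 = u" "\<And>t. t \<in> {0..1} \<Longrightarrow> \<sigma> t \<in> D"
    "\<And>t. t \<in> {0..1} \<Longrightarrow> g (\<sigma> t) = g u + t *\<^sub>R (z - g u)"
    using assms unfolding lift_def by blast+
  show "continuous_on {0..1} (\<lambda>t. \<sigma> (1 - t))"
    by (intro continuous_on_compose2[OF \<sigma>(1)] continuous_intros) auto
  fix t :: real assume "t \<in> {0..1}"
  then have t: "1 - t \<in> {0..1}" by simp
  show "\<sigma> (1 - t) \<in> D" using \<sigma>(3)[OF t] .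
  have "g (\<sigma> 1) = z" using \<sigma>(4)[of 1] by simp
  then show "g (\<sigma> (1 - t)) = g (\<sigma> 1) + t *\<^sub>R (g u - g (\<sigma> 1))"
    unfolding \<sigma>(4)[OF t] by (simp add: algebra_simps)
qed simp

section \<open>The retraction onto a fibre and its sheets\<close>

lemma lift_endpoint:
  assumes "lift u z 1 \<sigma>"
  shows "\<sigma> 1 \<in> D" "g (\<sigma> 1) = z"
  using assms unfolding lift_def by auto

text \<open>By \<open>lift_unique\<close> all lifts have the same endpoint, so the choice is
  immaterial.\<close>

definition retract :: "'b \<Rightarrow> 'x \<Rightarrow> 'x"
  where "retract z u = (SOME \<sigma>. lift u z 1 \<sigma>) 1"

lemma retract_eq:
  assumes "lift u z 1 \<sigma>"
  shows "retract z u = \<sigma> 1"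
  unfolding retract_def using lift_unique[OF someI[of "lift u z 1", OF assms] assms] by simp

text \<open>Segments from nearby points to the same \<open>z\<close> have a gap that shrinks by the
  factor \<open>1 - t\<close>. By \<open>stability\<close> the lifts stay close, and at time 1,
  where the gap is 0, they meet.\<close>

lemma retract_locally_constant:
  assumes u0: "u0 \<in> D" and z: "z \<in> V"
  obtains W where "open W" "u0 \<in> W" "W \<subseteq> D" "\<And>u. u \<in> W \<Longrightarrow> retract z u = retract z u0"
proof -
  obtain \<sigma> where \<sigma>: "lift u0 z 1 \<sigma>" using lift_exists[OF u0 z] by blast
  have \<sigma>': "continuous_on {0..1} \<sigma>" "\<sigma> ` {0..1} \<subseteq> D" using \<sigma> unfolding lift_def by blast+
  obtain r where r: "r > 0"
    "\<And>t v w. t \<in> {0..1} \<Longrightarrow> dst (\<sigma> t) v < r \<Longrightarrow> dst (\<sigma> t) w < r \<Longrightarrow> dst v w \<le> \<kappa> * q (g v - g w)"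
    using uniform_radius[OF \<sigma>'] by (metis zero_le_one)
  define W where "W = (D \<inter> (\<lambda>u. \<kappa> * q (g u0 - g u)) -` {..<r}) \<inter> {u. dst u0 u < r}"
  have "continuous_on D (\<lambda>u. \<kappa> * q (g u0 - g u))"
    by (intro continuous_intros continuous_on_compose2[OF q.continuous[of UNIV]] g_cont) auto
  then have "open (D \<inter> (\<lambda>u. \<kappa> * q (g u0 - g u)) -` {..<r})"
    using D by (intro continuous_open_preimage) auto
  then have W: "open W" "u0 \<in> W" "W \<subseteq> D"
    unfolding W_def using open_dist_ball u0 r(1) by (auto simp: dist_self)
  have "retract z u = retract z u0" if u: "u \<in> W" for u
  proof -
    have uD: "u \<in> D" using u W(3) by blast
    obtain \<tau> where \<tau>: "lift u z 1 \<tau>" using lift_exists[OF uD z] by blast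
    have \<tau>': "continuous_on {0..1} \<tau>" "\<tau> ` {0..1} \<subseteq> D" using \<tau> unfolding lift_def by blast+
    have "dst (\<sigma> 1) (\<tau> 1) \<le> \<kappa> * q (g (\<sigma> 1) - g (\<tau> 1))"
    proof (rule stability[OF zero_le_one \<sigma>' \<tau>'])
      show "dst v w \<le> \<kappa> * q (g v - g w)" if "t \<in> {0..1}" "dst (\<sigma> t) v < r" "dst (\<sigma> t) w < r" for t v w
        using r(2) that .
    next
      fix t :: real assume t: "t \<in> {0..1}"
      have "g (\<sigma> t) = g u0 + t *\<^sub>R (z - g u0)" "g (\<tau> t) = g u + t *\<^sub>R (z - g u)"
        using \<sigma> \<tau> t unfolding lift_def by blast+
      then have "g (\<sigma> t) - g (\<tau> t) = (1 - t) *\<^sub>R (g u0 - g u)" by (simp add: algebra_simps)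
      then have "\<kappa> * q (g (\<sigma> t) - g (\<tau> t)) = (1 - t) * (\<kappa> * q (g u0 - g u))" using t by (simp add: q.scale)
      also have "\<dots> \<le> 1 * (\<kappa> * q (g u0 - g u))" using t \<kappa> by (intro mult_right_mono) auto
      also have "\<dots> < r" using u unfolding W_def by simp
      finally show "\<kappa> * q (g (\<sigma> t) - g (\<tau> t)) < r" .
    next
      show "dst (\<sigma> 0) (\<tau> 0) < r" using \<sigma> \<tau> u unfolding lift_def W_def by simp
      show "1 \<in> {0..1::real}" by simp
    qed
    then have "dst (\<sigma> 1) (\<tau> 1) = 0"
      using lift_endpoint(2)[OF \<sigma>] lift_endpoint(2)[OF \<tau>] dist_nonneg[of "\<sigma> 1" "\<tau> 1"] by simp
    then have "\<sigma> 1 = \<tau> 1" by (rule dist_eq_0)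
    then show ?thesis using retract_eq[OF \<sigma>] retract_eq[OF \<tau>] by simp
  qed
  then show thesis using that W by blast
qed

text \<open>A point of the sheet of \<open>x\<close> is the endpoint of the lift that starts at
  \<open>x\<close> along the segment to its image. Uniqueness of lifts then gives injectivity,
  existence of lifts surjectivity, and local constancy of the retraction openness.\<close>

lemma sheets:
  assumes z: "z \<in> V"
  defines "U \<equiv> \<lambda>x. {u \<in> D. retract z u = x}"
  shows "\<And>x. open (U x)"
    and "\<And>u. u \<in> D \<Longrightarrow> retract z u \<in> D \<and> g (retract z u) = z"
    and "\<And>x. inj_on g (U x)"
    and "\<And>x. x \<in> D \<Longrightarrow> g x = z \<Longrightarrow> g ` U x = V"
proof -
  show "open (U x)" for x
  proof (subst open_subopen, intro ballI)
    fix u assume u: "u \<in> U x"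
    obtain W where "open W" "u \<in> W" "W \<subseteq> D" "\<And>u'. u' \<in> W \<Longrightarrow> retract z u' = retract z u"
      using retract_locally_constant[OF _ z, of u] u unfolding U_def by blast
    then show "\<exists>T. open T \<and> u \<in> T \<and> T \<subseteq> U x" using u unfolding U_def by blast
  qed
  show "retract z u \<in> D \<and> g (retract z u) = z" if u: "u \<in> D" for u
    using lift_exists[OF u z] retract_eq lift_endpoint by metis
  have rev: "\<exists>\<sigma>. lift (retract z u) (g u) 1 \<sigma> \<and> \<sigma> 1 = u" if u: "u \<in> D" for u
  proof -
    obtain \<sigma> where \<sigma>: "lift u z 1 \<sigma>" using lift_exists[OF u z] by blast
    have "\<sigma> 0 = u" using \<sigma> by (simp add: lift_def)
    then show ?thesis using lift_reverse[OF \<sigma>] retract_eq[OF \<sigma>] by (intro exI[of _ "\<lambda>t. \<sigma> (1 - t)"]) simp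
  qed
  show "inj_on g (U x)" for x
  proof (rule inj_onI)
    fix u u' assume u: "u \<in> U x" and u': "u' \<in> U x" and eq: "g u = g u'"
    obtain \<sigma> where \<sigma>: "lift x (g u) 1 \<sigma>" "\<sigma> 1 = u" using rev[of u] u unfolding U_def by blast
    obtain \<tau> where \<tau>: "lift x (g u) 1 \<tau>" "\<tau> 1 = u'" using rev[of u'] u' eq unfolding U_def by force
    show "u = u'" using lift_unique[OF \<sigma>(1) \<tau>(1), of 1] \<sigma>(2) \<tau>(2) by simp
  qed
  show "g ` U x = V" if x: "x \<in> D" "g x = z" for x
  proof
    show "g ` U x \<subseteq> V" using V(2) unfolding U_def by blast
    show "V \<subseteq> g ` U x"
    proof
      fix w assume w: "w \<in> V"
      obtain \<sigma> where \<sigma>: "lift x w 1 \<sigma>" using lift_exists[OF x(1) w] by blast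
      have "\<sigma> 0 = x" using \<sigma> by (simp add: lift_def)
      then have "retract z (\<sigma> 1) = x"
        using retract_eq[of "\<sigma> 1" z] lift_reverse[OF \<sigma>] x(2) by simp
      then show "w \<in> g ` U x" using lift_endpoint[OF \<sigma>] unfolding U_def by (intro image_eqI[of _ _ "\<sigma> 1"]) auto
    qed
  qed
qed

end

subsection \<open>Covering and the Lipschitz modulus of the inverse\<close>

lemma ennreal_between:
  assumes "0 < (c :: ennreal)"
  obtains k where "0 < k" "ennreal k < c"
proof -
  obtain k0 where k0: "0 < k0" "k0 < c" using dense[OF assms] by blast
  then show thesis using that by (cases k0) auto
qed

text \<open>The values 0 and \<infinity> are inverse to each other, so inversion is an involution
  without exceptions.\<close>

lemma ennreal_inverse_inverse: "inverse (inverse c) = (c :: ennreal)"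
proof (cases c)
  case (real r)
  then show ?thesis by (cases "r = 0") (simp_all add: inverse_ennreal)
qed simp

lemma ennreal_inverse_antimono: "inverse d \<le> inverse c" if "c \<le> d" for c d :: ennreal
proof (cases "c = 0 \<or> d = top")
  case False
  then have "d < top" by (simp add: less_top)
  then have "c < top" using that by (rule le_less_trans[rotated])
  then obtain r s where rs: "c = ennreal r" "0 \<le> r" "d = ennreal s" "0 \<le> s"
    using \<open>d < top\<close> by (cases c; cases d) auto
  then have "r \<noteq> 0" "r \<le> s" using False that by auto
  then show ?thesis using rs by (simp add: inverse_ennreal le_imp_inverse_le ennreal_leI)
qed auto

section \<open>The index near a fibre, even covering and the modulus\<close>

context finsler_map
begin

text \<open>Failure for \<open>k = r = 1 / (n + 1)\<close>, for every \<open>n\<close>, produces the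
  kind of sequence that strong submersivity excludes.\<close>

lemma index_lower_bound:
  assumes sub: "strong_submersion A NX B NY f J"
  obtains k r where "0 < k" "0 < r"
    "\<And>x. Y.dst y (f x) < r \<Longrightarrow> ennreal k < index x"
proof (rule ccontr)
  assume neg: "\<not> thesis"
  have "\<exists>x. Y.dst y (f x) < inverse (real (Suc n)) \<and>
      index x \<le> ennreal (inverse (real (Suc n)))" for n
    using neg that[of "inverse (real (Suc n))" "inverse (real (Suc n))"] by (force simp: not_less)
  then obtain s where s: "\<And>n. Y.dst y (f (s n)) < inverse (real (Suc n))"
    "\<And>n. index (s n) \<le> ennreal (inverse (real (Suc n)))" by metis
  have "(\<lambda>n. f (s n)) \<longlonglongrightarrow> y"
  proof (rule topological_tendstoI)
    fix W assume "open W" "y \<in> W"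
    then obtain r where r: "r > 0" "\<And>v. Y.dst y v < r \<Longrightarrow> v \<in> W"
      by (rule Y.dist_ball_in_open) blast
    have "\<forall>\<^sub>F n in sequentially. inverse (real (Suc n)) < r"
      using LIMSEQ_inverse_real_of_nat r(1) by (rule order_tendstoD(2))
    then show "\<forall>\<^sub>F n in sequentially. f (s n) \<in> W"
      by eventually_elim (meson r(2) s(1) less_trans)
  qed
  moreover have "(\<lambda>n. index (s n)) \<longlonglongrightarrow> 0"
  proof (rule tendsto_sandwich[OF always_eventually always_eventually tendsto_const])
    show "(\<lambda>n. ennreal (inverse (real (Suc n)))) \<longlonglongrightarrow> 0"
      using tendsto_ennrealI[OF LIMSEQ_inverse_real_of_nat] by (simp only: ennreal_0)
    show "\<forall>n. index (s n) \<le> ennreal (inverse (real (Suc n)))"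
      using s(2) by blast
  qed simp
  ultimately show False using sub unfolding strong_submersion_def by blast
qed

lemma open_map:
  assumes reg: "\<And>x. jacobian_regular A NX B NY f J x" and W: "open W"
  shows "open (f ` W)"
proof (subst open_subopen, intro ballI)
  fix w assume "w \<in> f ` W"
  then obtain x where x: "x \<in> W" "w = f x" by blast
  have "index x > 0" using reg unfolding jacobian_regular_def by blast
  then obtain k where k: "0 < k" "ennreal k < index x"
    by (rule ennreal_between)
  obtain O' where O': "open O'" "x \<in> O'" "\<And>W. open W \<Longrightarrow> W \<subseteq> O' \<Longrightarrow> open (f ` W)"
    by (rule local_inverse_manifold[OF reg k]) blast
  have "open (f ` (O' \<inter> W))" using O'(1) W by (intro O'(3)) auto
  then show "\<exists>T. open T \<and> w \<in> T \<and> T \<subseteq> f ` W" using x O'(2) by (intro exI[of _ "f ` (O' \<inter> W)"]) auto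
qed

text \<open>In a coordinate ball around \<open>y\<close> the map fits the locale
  \<open>lifting\<close>, and the sheets are indexed by the fibre of \<open>y\<close>, which may
  still be empty. The last conclusion makes every sheet meet that fibre, so that an empty fibre
  leaves no sheets and hence no preimage of \<open>T\<close>.\<close>

lemma evenly_covered:
  assumes complete: "finsler_complete A NX"
    and reg: "\<And>x. jacobian_regular A NX B NY f J x"
    and sub: "strong_submersion A NX B NY f J"
  obtains T v where "y \<in> T" "open T" "\<Union>v = f -` T" "\<And>u. u \<in> v \<Longrightarrow> open u" "pairwise disjnt v"
    "\<And>u. u \<in> v \<Longrightarrow> \<exists>h. homeomorphism u T f h" "\<And>u. u \<in> v \<Longrightarrow> y \<in> f ` u"
proof -
  obtain k r0 where k: "0 < k" and r0: "0 < r0"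
    "\<And>x. Y.dst y (f x) < r0 \<Longrightarrow> ennreal k < index x"
    by (rule index_lower_bound[OF sub]) blast
  obtain d where d: "d \<in> charts_at B y" using Y.exists_chart by blast
  note dB = Y.charts_atD[OF d]
  define q where "q v = Y.chart_norm d y v" for v
  interpret q: equiv_norm q using Y.equiv_norm_N[OF d, folded q_def] .
  have ball: "open {v. Y.dst y v < r0}" "y \<in> {v. Y.dst y v < r0}"
    using Y.open_dist_ball r0(1) by (auto simp: Y.dist_self)
  obtain r where r: "r > 0" "{z. q (z - snd d y) < r} \<subseteq> snd d ` fst d"
    "\<And>u. u \<in> fst d \<Longrightarrow> q (snd d u - snd d y) < r \<Longrightarrow> u \<in> {v. Y.dst y v < r0}"
    "\<And>u v. u \<in> fst d \<Longrightarrow> q (snd d u - snd d y) < r \<Longrightarrow> v \<in> fst d \<Longrightarrow> q (snd d v - snd d y) < r \<Longrightarrow>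
      Y.dst u v \<le> (1 + 1) * q (snd d u - snd d v)"
    by (rule Y.local_comparison[OF d ball zero_less_one, folded q_def]) blast
  define V where "V = {z. q (z - snd d y) < r}"
  define T where "T = {w \<in> fst d. snd d w \<in> V}"
  define D where "D = f -` T"
  define g where "g = snd d \<circ> f"
  have T: "open T" "y \<in> T" "T \<subseteq> fst d"
    unfolding T_def V_def using Y.open_chart_preimage[OF dB(1) q.open_ball] dB(2) r(1) by auto
  have gD: "f u \<in> fst d" "g u \<in> V" if "u \<in> D" for u using that unfolding D_def T_def g_def by auto
  have g_cont: "continuous_on D g"
    unfolding g_def
    by (intro continuous_on_compose continuous_on_subset[OF continuous_f]
        continuous_on_subset[OF Y.continuous_chart[OF dB(1)]]) (use gD(1) in auto)
  \<comment> \<open>\<open>1 / k\<close> comes from the local inverse, the factor 2 from comparing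
    the distance of \<open>Y\<close> with the coordinate norm (\<open>1 + 1\<close> above).\<close>
  interpret L: lifting A NX D g V q "2 / k"
  proof
    show "finsler_complete A NX" by (rule complete)
    show "convex V" unfolding V_def by (rule q.convex_ball)
    show "g ` D \<subseteq> V" using gD(2) by blast
    show "continuous_on D g" by (rule g_cont)
    show "open D" unfolding D_def using open_vimage[OF T(1) continuous_f] .
    show "open (g ` W)" if W: "open W" "W \<subseteq> D" for W
    proof -
      have "open (snd d ` f ` W)"
        using gD(1) W by (intro Y.open_chart_image[OF dB(1)] open_map[OF reg]) auto
      then show ?thesis unfolding g_def image_comp .
    qed
    show "\<exists>O'. open O' \<and> u \<in> O' \<and> O' \<subseteq> D \<and>
        (\<forall>a\<in>O'. \<forall>b\<in>O'. X.dst a b \<le> 2 / k * q (g a - g b))" if u: "u \<in> D" for u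
    proof -
      have "Y.dst y (f u) < r0"
        using r(3)[OF gD(1)[OF u]] gD(2)[OF u] unfolding V_def g_def by simp
      then have "ennreal k < index u" by (rule r0(2))
      then obtain O' where O': "open O'" "u \<in> O'"
        "\<And>a b. a \<in> O' \<Longrightarrow> b \<in> O' \<Longrightarrow> k * X.dst a b \<le> Y.dst (f a) (f b)"
        by (rule local_inverse_manifold[OF reg k]) blast
      have "X.dst a b \<le> 2 / k * q (g a - g b)" if "a \<in> O' \<inter> D" "b \<in> O' \<inter> D" for a b
      proof -
        have a: "a \<in> O'" "a \<in> D" and b: "b \<in> O'" "b \<in> D" using that by blast+
        have "Y.dst (f a) (f b) \<le> (1 + 1) * q (snd d (f a) - snd d (f b))"
          using gD[OF a(2)] gD[OF b(2)] unfolding V_def g_def by (intro r(4)) auto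
        then have "k * X.dst a b \<le> 2 * q (g a - g b)"
          using O'(3)[OF a(1) b(1)] by (simp add: g_def)
        then show ?thesis using k by (simp add: pos_le_divide_eq mult.commute)
      qed
      moreover have "open (O' \<inter> D)" using O'(1) T(1) open_vimage[OF _ continuous_f] unfolding D_def by blast
      ultimately show ?thesis using O'(2) u by (intro exI[of _ "O' \<inter> D"]) blast
    qed
    \<comment> \<open>Continuity of \<open>f\<close> at \<open>l\<close> and uniqueness of limits in
      \<open>Y\<close> identify \<open>f l\<close> with the point whose coordinates are
      \<open>z\<close>.\<close>
    show "l \<in> D" if s: "\<And>n. s n \<in> D" "s \<longlonglongrightarrow> l" "(\<lambda>n. g (s n)) \<longlonglongrightarrow> z" "z \<in> V" for s l z
    proof -
      have zd: "z \<in> snd d ` fst d" using s(4) r(2) unfolding V_def by blast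
      have "(\<lambda>n. chart_inv d (g (s n))) \<longlonglongrightarrow> chart_inv d z"
        by (rule continuous_on_tendsto_compose[OF Y.continuous_chart_inv[OF dB(1)] s(3) zd])
          (use gD(1)[OF s(1)] in \<open>auto simp: g_def\<close>)
      moreover have "chart_inv d (g (s n)) = f (s n)" for n
        using gD(1)[OF s(1)] dB(1) by (simp add: g_def)
      moreover have "(\<lambda>n. f (s n)) \<longlonglongrightarrow> f l"
        using continuous_on_tendsto_compose[OF continuous_f s(2)] by simp
      ultimately have "f l = chart_inv d z" using LIMSEQ_unique by auto
      then show ?thesis
        unfolding D_def T_def using s(4) Y.chart_inv_in[OF dB(1) zd] Y.chart_chart_inv[OF dB(1) zd] by simp
    qed
    show "2 / k > 0" using k by simp
  qed
  have z: "snd d y \<in> V" unfolding V_def using r(1) by simp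
  note sheets = L.sheets[OF z]
  define U where "U x = {u \<in> D. L.retract (snd d y) u = x}" for x
  have fib: "x \<in> D \<and> g x = snd d y \<longleftrightarrow> f x = y" for x
    using T(2) gD(1)[of x] Y.chart_inj[OF dB(1) _ dB(2), of "f x"] unfolding D_def g_def by auto
  show thesis
  proof (rule that[of T "U ` {x. f x = y}"])
    show "y \<in> T" "open T" using T by blast+
    show "\<Union>(U ` {x. f x = y}) = f -` T"
      using sheets(2) fib unfolding U_def D_def[symmetric] by blast
    show "open u" if "u \<in> U ` {x. f x = y}" for u using that sheets(1) unfolding U_def by blast
    show "pairwise disjnt (U ` {x. f x = y})"
      unfolding pairwise_def disjnt_def U_def by auto
    fix u assume "u \<in> U ` {x. f x = y}"
    then obtain x where x: "f x = y" "u = U x" by blast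
    have gU: "g ` u = V" using sheets(4) fib x unfolding U_def by blast
    have uD: "u \<subseteq> D" unfolding x(2) U_def by blast
    have img: "f ` u = T"
    proof
      show "f ` u \<subseteq> T" using uD unfolding D_def by blast
      show "T \<subseteq> f ` u"
      proof
        fix w assume w: "w \<in> T"
        then have "snd d w \<in> g ` u" unfolding gU T_def by blast
        then obtain a where a: "a \<in> u" "snd d w = snd d (f a)" unfolding g_def by auto
        have "f a \<in> fst d" using gD(1) a(1) uD by blast
        moreover have "w \<in> fst d" using w T(3) by blast
        ultimately have "w = f a" using a(2) Y.chart_inj[OF dB(1)] by blast
        then show "w \<in> f ` u" using a(1) by blast
      qed
    qed
    then show "y \<in> f ` u" using T(2) by blast
    have "inj_on g u" using sheets(3) unfolding x(2) U_def .
    then have "inj_on f u" unfolding g_def by (rule inj_on_imageI2)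
    moreover have "continuous_on u f" using continuous_on_subset[OF continuous_f] by blast
    moreover have "openin (top_of_set T) (f ` W)" if W: "openin (top_of_set u) W" for W
    proof -
      have "open u" using sheets(1) unfolding x(2) U_def by blast
      then have "open W" "W \<subseteq> u" using W by (auto simp: openin_open_eq)
      then show ?thesis using open_map[OF reg] img T(1) by (auto simp: openin_open_eq)
    qed
    ultimately show "\<exists>h. homeomorphism u T f h" using homeomorphism_injective_open_map[OF _ img] by metis
  qed
qed

text \<open>Surjectivity also comes from even covering: a point outside the range has a
  neighbourhood with no sheets above it, so the range is closed. It is open because \<open>f\<close>
  is an open map, and \<open>Y\<close> is connected.\<close>

theorem covering:
  assumes complete: "finsler_complete A NX"
    and reg: "\<And>x. jacobian_regular A NX B NY f J x"
    and sub: "strong_submersion A NX B NY f J"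
  shows "covering_space UNIV f UNIV"
proof -
  note even = evenly_covered[OF complete reg sub]
  have "open (- range f)"
  proof (subst open_subopen, intro ballI)
    fix y assume y: "y \<in> - range f"
    obtain T v where T: "y \<in> T" "open T" "\<Union>v = f -` T" "\<And>u. u \<in> v \<Longrightarrow> y \<in> f ` u"
      by (rule even[of y]) blast
    have "v = {}" using T(4) y by blast
    then have "f -` T = {}" using T(3) by simp
    then show "\<exists>T. open T \<and> y \<in> T \<and> T \<subseteq> - range f" using T(1,2) by blast
  qed
  then have "closed (range f)" by (simp only: closed_def)
  moreover have "open (range f)" using open_map[OF reg open_UNIV] .
  ultimately have "range f = {} \<or> range f = UNIV"
    using Y.connected[unfolded connected_clopen, THEN spec, of "range f"]
    unfolding subtopology_UNIV by (simp only: open_openin closed_closedin simp_thms)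
  then have "range f = UNIV" by blast
  moreover have "\<exists>T. y \<in> T \<and> openin (top_of_set UNIV) T \<and>
      (\<exists>v. \<Union>v = UNIV \<inter> f -` T \<and> (\<forall>u\<in>v. openin (top_of_set UNIV) u) \<and> pairwise disjnt v \<and>
        (\<forall>u\<in>v. \<exists>q. homeomorphism u T f q))" for y
  proof -
    obtain T v where T: "y \<in> T" "open T" "\<Union>v = f -` T" "\<And>u. u \<in> v \<Longrightarrow> open u" "pairwise disjnt v"
      "\<And>u. u \<in> v \<Longrightarrow> \<exists>h. homeomorphism u T f h"
      by (rule even[of y]) blast
    show ?thesis
      unfolding subtopology_UNIV open_openin[symmetric] using T by (intro exI[of _ T] conjI exI[of _ v]) auto
  qed
  ultimately show ?thesis unfolding covering_space_def using continuous_f by blast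
qed

text \<open>The neighbourhoods are \<open>O'\<close> and its image: every \<open>z\<close> in the
  image has a preimage in \<open>O'\<close>, to which the Lipschitz estimate for the local inverse
  applies.\<close>

lemma pseudo_lipschitz_const_inverse:
  assumes reg: "\<And>x. jacobian_regular A NX B NY f J x" and k: "0 < k" "ennreal k < index x"
  shows "pseudo_lipschitz_const (X.dst) (Y.dst) (\<lambda>z. f -` {z}) (f x) x (1 / k)"
proof -
  obtain O' where O': "open O'" "x \<in> O'" "\<And>W. open W \<Longrightarrow> W \<subseteq> O' \<Longrightarrow> open (f ` W)"
    "\<And>a b. a \<in> O' \<Longrightarrow> b \<in> O' \<Longrightarrow> k * X.dst a b \<le> Y.dst (f a) (f b)"
    by (rule local_inverse_manifold[OF reg k]) blast
  have main: "(INF v\<in>f -` {z}. ennreal (X.dst u v)) \<le> ennreal (1 / k * Y.dst w z)"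
    if z: "z \<in> f ` O'" and uw: "u \<in> O' \<inter> f -` {w}" for w z u
  proof -
    obtain v where v: "v \<in> O'" "f v = z" using z by blast
    have u: "u \<in> O'" "f u = w" using uw by blast+
    have "k * X.dst u v \<le> Y.dst w z" using O'(4)[OF u(1) v(1)] u(2) v(2) by simp
    then have "X.dst u v \<le> 1 / k * Y.dst w z"
      using k(1) by (simp add: pos_le_divide_eq mult.commute)
    then have "ennreal (X.dst u v) \<le> ennreal (1 / k * Y.dst w z)" by (rule ennreal_leI)
    moreover have "v \<in> f -` {z}" using v(2) by simp
    ultimately show ?thesis by (rule INF_lower2[rotated])
  qed
  have op: "open (f ` O')" using O'(1) by (rule O'(3)) simp
  show ?thesis
    unfolding pseudo_lipschitz_const_def
  proof (intro conjI exI[of _ "f ` O'"] exI[of _ O'] ballI)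
    show "0 < 1 / k" "open (f ` O')" "open O'" "f x \<in> f ` O'" "x \<in> O'"
      using k(1) op O'(1,2) by simp_all
  qed (rule main)
qed

text \<open>After inversion the claim bounds the index from above and can be tested on the real
  numbers below it by \<open>dense_le\<close>. An infinite index is covered as well, with inverse
  0.\<close>

lemma lip_modulus_le:
  assumes reg: "\<And>x. jacobian_regular A NX B NY f J x"
  shows "lip_modulus (X.dst) (Y.dst) (\<lambda>z. f -` {z}) (f x) x
    \<le> inverse (index x)" (is "?L \<le> inverse ?I")
proof -
  have "?I \<le> inverse ?L"
  proof (rule dense_le)
    fix k0 assume k0: "k0 < ?I"
    then have "k0 < top" using top.not_eq_extremum top.extremum_strict by fastforce
    then obtain k where k: "k0 = ennreal k" "0 \<le> k" by (cases k0) auto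
    show "k0 \<le> inverse ?L"
    proof (cases "k = 0")
      case False
      then have k_pos: "0 < k" using k(2) by simp
      have "?L \<le> ennreal (1 / k)"
        unfolding lip_modulus_def
        using pseudo_lipschitz_const_inverse[OF reg k_pos] k0 k(1) by (intro INF_lower2[of "1 / k"]) auto
      also have "\<dots> = inverse k0" unfolding k(1) using k_pos by (simp add: inverse_ennreal inverse_eq_divide)
      finally have "inverse (inverse k0) \<le> inverse ?L" by (rule ennreal_inverse_antimono)
      then show ?thesis by (simp only: ennreal_inverse_inverse)
    qed (simp add: k)
  qed
  from ennreal_inverse_antimono[OF this] show ?thesis by (simp only: ennreal_inverse_inverse)
qed

end

theorem theorem23:
  fixes A :: "('x::t2_space, 'e::banach) chart set"
    and NX :: "'x \<Rightarrow> ('x, 'e) tvec \<Rightarrow> real"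
    and B :: "('y::t2_space, 'f::banach) chart set"
    and NY :: "'y \<Rightarrow> ('y, 'f) tvec \<Rightarrow> real"
    and f :: "'x \<Rightarrow> 'y"
    and J :: "'x \<Rightarrow> (('x, 'e) tvec \<Rightarrow> ('y, 'f) tvec) set"
  assumes "finsler_manifold A NX" and "finsler_complete A NX"
    and "finsler_manifold B NY" and "smooth_norm B NY"
    and "finsler_locally_lipschitz A NX B NY f"
    and "strong_pseudo_jacobian_mapping A B f J"
    and "\<And>x. jacobian_regular A NX B NY f J x"
    and "strong_submersion A NX B NY f J"
  shows "covering_space UNIV f UNIV \<and>
    (\<forall>y. \<forall>x\<in>f -` {y}.
      pseudo_lipschitz (finsler_dist A NX) (finsler_dist B NY) (\<lambda>z. f -` {z}) y x \<and>
      lip_modulus (finsler_dist A NX) (finsler_dist B NY) (\<lambda>z. f -` {z}) y x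
        \<le> inverse (regularity_index A NX B NY f J x))"
proof -
  interpret finsler_map A NX B NY f J
    using assms(1,3,4,6) unfolding finsler_manifold_def by unfold_locales blast+
  have "pseudo_lipschitz (finsler_dist A NX) (finsler_dist B NY) (\<lambda>z. f -` {z}) (f x) x" for x
  proof -
    have "0 < regularity_index A NX B NY f J x" using assms(7) unfolding jacobian_regular_def by blast
    then obtain k where "0 < k" "ennreal k < regularity_index A NX B NY f J x"
      by (rule ennreal_between)
    then show ?thesis
      unfolding pseudo_lipschitz_def using pseudo_lipschitz_const_inverse[OF assms(7)] by blast
  qed
  then show ?thesis using covering[OF assms(2,7,8)] lip_modulus_le[OF assms(7)] by auto
qed

end
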